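(* Let $N\ge 1$, $0<s<1$, and let $\Omega\subset\mathbb{R}^N$ be a bounded Lipschitz domain satisfying the exterior cone condition. Let $p$ be a real number satisfying $p>\frac{N}{2s}$ if $N>2s$, $p>1$ if $N=2s$, and $p=1$ if $N<2s$, and let $p'$ be defined by $\frac1p+\frac1{p'}=1$ (so $p'=\infty$ if $p=1$). Then there is a constant $C=C(N,s,p,\Omega)>0$ such that for every $\mu\in\mathcal{M}(\Omega)$ there exists a unique $u\in L^{p'}(\Omega)$ which is a very-weak solution of $$(-\Delta)^s u=\mu\ \text{ in }\Omega,\qquad u=0\ \text{ in }\mathbb{R}^N\setminus\Omega,$$ and this $u$ satisfies $$\|u\|_{L^{p'}(\Omega)}\le C\|\mu\|_{\mathcal{M}(\Omega)} .$$
   Context: All functions are real valued. $C_0(\Omega)$ is the space of continuous functions on $\overline\Omega$ vanishing on $\partial\Omega$, with the sup norm (its elements are extended by zero to $\mathbb{R}^N$). $\mathcal{M}(\Omega)$ is the space of Radon measures on $\Omega$, i.e. $\mathcal{M}(\Omega)=C_0(\Omega)^\star$ with pairing $\langle\mu,v\rangle=\int_\Omega v\,d\mu$ and norm $\|\mu\|_{\mathcal M(\Omega)}=\sup\{\int_\Omega v\,d\mu: v\in C_0(\Omega),|v|\le1\}$. $W^{s,2}(\mathbb{R}^N)$ is the space of $u\in L^2(\mathbb{R}^N)$ with $\int_{\mathbb{R}^N}\int_{\mathbb{R}^N}\frac{|u(x)-u(y)|^2}{|x-y|^{N+2s}}\,dx\,dy<\infty$, and $\widetilde W_0^{s,2}(\Omega):=\{u\in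 W^{s,2}(\mathbb{R}^N): u=0 \text{ on }\mathbb{R}^N\setminus\Omega\}$. Let $C_{N,s}:=\frac{s2^{2s}\Gamma(\frac{2s+N}{2})}{\pi^{N/2}\Gamma(1-s)}$; $(-\Delta)^s v(x)=C_{N,s}\,\mathrm{P.V.}\int_{\mathbb{R}^N}\frac{v(x)-v(y)}{|x-y|^{N+2s}}\,dy$. For $v\in\widetilde W_0^{s,2}(\Omega)$, $(-\Delta)^s v=g$ in $\Omega$ with $g\in L^p(\Omega)$ is understood weakly: $\frac{C_{N,s}}{2}\int_{\mathbb{R}^N}\int_{\mathbb{R}^N}\frac{(v(x)-v(y))(w(x)-w(y))}{|x-y|^{N+2s}}\,dx\,dy=\int_\Omega g w\,dx$ for all $w\in\widetilde W_0^{s,2}(\Omega)$ (the right side is well defined since $\widetilde W_0^{s,2}(\Omega)\hookrightarrow L^{p'}(\Omega)$). A very-weak solution of the Dirichlet problem with datum $\mu\in\mathcal M(\Omega)$ is a function $u\in L^{p'}(\Omega)$ such that $$\int_\Omega u\,(-\Delta)^s v\,dx=\int_\Omega v\,d\mu\quad\text{for all } v\in V:=\{v\in C_0(\Omega)\cap\widetilde W_0^{s,2}(\Omega): (-\Delta)^s v\in L^p(\Omega)\}.$$ *)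

theory Defs
  imports "HOL-Analysis.Analysis" "HOL-Probability.Essential_Supremum"
begin

section \<open>Domains\<close>

text \<open>Near each boundary point, after a rotation taking the last coordinate axis to \<open>e\<close>,
  the set lies strictly above the graph of a Lipschitz function of the coordinates
  orthogonal to \<open>e\<close>.\<close>

definition lipschitz_boundary :: "'a::euclidean_space set \<Rightarrow> bool" where
  "lipschitz_boundary \<Omega> \<longleftrightarrow>
     (\<forall>z\<in>frontier \<Omega>. \<exists>r>0. \<exists>e L \<gamma>. norm e = 1 \<and> L-lipschitz_on {y. y \<bullet> e = 0} \<gamma> \<and>
        \<Omega> \<inter> ball z r = {x \<in> ball z r. \<gamma> (x - (x \<bullet> e) *\<^sub>R e) < x \<bullet> e})"

definition bounded_lipschitz_domain :: "'a::euclidean_space set \<Rightarrow> bool" where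
  "bounded_lipschitz_domain \<Omega> \<longleftrightarrow>
     open \<Omega> \<and> connected \<Omega> \<and> \<Omega> \<noteq> {} \<and> bounded \<Omega> \<and> lipschitz_boundary \<Omega>"

definition finite_cone :: "'a::euclidean_space \<Rightarrow> 'a \<Rightarrow> real \<Rightarrow> real \<Rightarrow> 'a set" where
  "finite_cone z e \<theta> h = {x. norm (x - z) * cos \<theta> \<le> (x - z) \<bullet> e \<and> (x - z) \<bullet> e \<le> h}"

definition exterior_cone_condition :: "'a::euclidean_space set \<Rightarrow> bool" where
  "exterior_cone_condition \<Omega> \<longleftrightarrow>
     (\<forall>z\<in>frontier \<Omega>. \<exists>e \<theta> h. norm e = 1 \<and> 0 < \<theta> \<and> \<theta> < pi / 2 \<and> 0 < h \<and>
        finite_cone z e \<theta> h \<inter> closure \<Omega> = {z})"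

section \<open>Lebesgue spaces\<close>

text \<open>Elements are functions, not equivalence classes. For finite \<open>q\<close> the intended range
  is \<open>q \<ge> 1\<close>.\<close>

definition Lp :: "ennreal \<Rightarrow> 'a measure \<Rightarrow> ('a \<Rightarrow> real) set" where
  "Lp q M = {f \<in> borel_measurable M.
     if q = \<infinity> then \<exists>c. AE x in M. \<bar>f x\<bar> \<le> c
     else integrable M (\<lambda>x. \<bar>f x\<bar> powr enn2real q)}"

definition Lp_norm :: "ennreal \<Rightarrow> 'a measure \<Rightarrow> ('a \<Rightarrow> real) \<Rightarrow> real" where
  "Lp_norm q M f =
     (if q = \<infinity> then enn2real (esssup M (\<lambda>x. ennreal \<bar>f x\<bar>))
      else (LINT x|M. \<bar>f x\<bar> powr enn2real q) powr (1 / enn2real q))"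

section \<open>Continuous functions vanishing on the boundary and Radon measures\<close>

definition C0 :: "'a::euclidean_space set \<Rightarrow> ('a \<Rightarrow> real) set" where
  "C0 \<Omega> = {v. continuous_on (closure \<Omega>) v \<and> (\<forall>x. x \<notin> \<Omega> \<longrightarrow> v x = 0)}"

text \<open>For open \<open>\<Omega>\<close> every finite signed Borel measure on \<open>\<Omega>\<close> is regular, so that these
  are exactly the measures representing the dual of \<open>C0 \<Omega>\<close>. Only the values of \<open>\<mu>\<close> on
  Borel subsets of \<open>\<Omega>\<close> are relevant.\<close>

definition radon_measure :: "'a::euclidean_space set \<Rightarrow> ('a set \<Rightarrow> real) \<Rightarrow> bool" where
  "radon_measure \<Omega> \<mu> \<longleftrightarrow>
     (\<forall>A :: nat \<Rightarrow> 'a set. range A \<subseteq> sets (restrict_space borel \<Omega>) \<and> disjoint_family A \<longrightarrow>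
        (\<lambda>i. \<mu> (A i)) sums \<mu> (\<Union>i. A i))"

text \<open>The positive part of the Jordan decomposition; the negative part of \<open>\<mu>\<close> is
  the positive part of \<open>-\<mu>\<close>. Negative values of \<open>\<mu> B\<close> are truncated by \<^term>\<open>ennreal\<close>,
  which is harmless since \<open>B = {}\<close> is admitted.\<close>

definition pos_variation :: "'a::euclidean_space set \<Rightarrow> ('a set \<Rightarrow> real) \<Rightarrow> 'a measure" where
  "pos_variation \<Omega> \<mu> = measure_of \<Omega> (sets (restrict_space borel \<Omega>))
     (\<lambda>A. SUP B \<in> {B \<in> sets (restrict_space borel \<Omega>). B \<subseteq> A}. ennreal (\<mu> B))"

definition pairing :: "'a::euclidean_space set \<Rightarrow> ('a set \<Rightarrow> real) \<Rightarrow> ('a \<Rightarrow> real) \<Rightarrow> real" where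
  "pairing \<Omega> \<mu> v =
     (LINT x|pos_variation \<Omega> \<mu>. v x) - (LINT x|pos_variation \<Omega> (\<lambda>A. - \<mu> A). v x)"

definition radon_norm :: "'a::euclidean_space set \<Rightarrow> ('a set \<Rightarrow> real) \<Rightarrow> real" where
  "radon_norm \<Omega> \<mu> = (SUP v \<in> {v \<in> C0 \<Omega>. \<forall>x. \<bar>v x\<bar> \<le> 1}. pairing \<Omega> \<mu> v)"

section \<open>Fractional Sobolev spaces and the fractional Laplacian\<close>

definition W_s2 :: "real \<Rightarrow> ('a::euclidean_space \<Rightarrow> real) set" where
  "W_s2 s = {u \<in> Lp 2 lebesgue.
     (\<integral>\<^sup>+y. (\<integral>\<^sup>+x. ennreal (\<bar>u x - u y\<bar>\<^sup>2 / norm (x - y) powr (real DIM('a) + 2 * s))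
        \<partial>lebesgue) \<partial>lebesgue) < \<infinity>}"

definition W0_s2 :: "real \<Rightarrow> 'a::euclidean_space set \<Rightarrow> ('a \<Rightarrow> real) set" where
  "W0_s2 s \<Omega> = {u \<in> W_s2 s. AE x in lebesgue. x \<notin> \<Omega> \<longrightarrow> u x = 0}"

definition frac_const :: "nat \<Rightarrow> real \<Rightarrow> real" where
  "frac_const N s = s * 2 powr (2 * s) * Gamma ((2 * s + real N) / 2) /
     (pi powr (real N / 2) * Gamma (1 - s))"

definition frac_form :: "real \<Rightarrow> ('a::euclidean_space \<Rightarrow> real) \<Rightarrow> ('a \<Rightarrow> real) \<Rightarrow> real" where
  "frac_form s v w = frac_const DIM('a) s / 2 *
     (LINT y|lebesgue. LINT x|lebesgue.
        (v x - v y) * (w x - w y) / norm (x - y) powr (real DIM('a) + 2 * s))"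

text \<open>\<open>weak_frac_laplacian s p \<Omega> v g\<close>: the function \<open>v\<close> is in \<^term>\<open>W0_s2 s \<Omega>\<close>, \<open>g\<close> is in
  \<open>L\<^sup>p(\<Omega>)\<close>, and \<open>(-\<Delta>)\<^sup>s v = g\<close> in \<open>\<Omega>\<close> in the weak sense. This determines \<open>g\<close> almost
  everywhere on \<open>\<Omega>\<close>.\<close>

definition weak_frac_laplacian ::
  "real \<Rightarrow> ennreal \<Rightarrow> 'a::euclidean_space set \<Rightarrow> ('a \<Rightarrow> real) \<Rightarrow> ('a \<Rightarrow> real) \<Rightarrow> bool" where
  "weak_frac_laplacian s p \<Omega> v g \<longleftrightarrow>
     v \<in> W0_s2 s \<Omega> \<and> g \<in> Lp p (lebesgue_on \<Omega>) \<and>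
     (\<forall>w \<in> W0_s2 s \<Omega>. frac_form s v w = (LINT x|lebesgue_on \<Omega>. g x * w x))"

definition V_space :: "real \<Rightarrow> ennreal \<Rightarrow> 'a::euclidean_space set \<Rightarrow> ('a \<Rightarrow> real) set" where
  "V_space s p \<Omega> = {v \<in> C0 \<Omega> \<inter> W0_s2 s \<Omega>. \<exists>g. weak_frac_laplacian s p \<Omega> v g}"

definition very_weak_solution ::
  "real \<Rightarrow> ennreal \<Rightarrow> ennreal \<Rightarrow> 'a::euclidean_space set \<Rightarrow> ('a set \<Rightarrow> real) \<Rightarrow> ('a \<Rightarrow> real) \<Rightarrow> bool"
where
  "very_weak_solution s p p' \<Omega> \<mu> u \<longleftrightarrow>
     u \<in> Lp p' (lebesgue_on \<Omega>) \<and>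
     (\<forall>v \<in> V_space s p \<Omega>. \<forall>g. weak_frac_laplacian s p \<Omega> v g \<longrightarrow>
        (LINT x|lebesgue_on \<Omega>. u x * g x) = pairing \<Omega> \<mu> v)"

end

theory Submission
  imports Defs
begin

text \<open>The very-weak solution is the transpose of the Green operator \<open>T g = v\<close>, where
  \<open>(-\<Delta>)\<^sup>s v = g\<close>. For nonnegative finite measures \<open>m\<close> the set function \<open>A \<mapsto> \<integral> T 1\<^sub>A dm\<close> is,
  by the maximum principle and the bound \<open>\<bar>T g\<bar> \<le> C \<parallel>g\<parallel>\<^sub>p\<close>, a finite measure that is absolutely
  continuous with respect to the Lebesgue measure; its Radon-Nikodym density represents
  \<open>g \<mapsto> \<integral> T g dm\<close>, and the two parts of \<open>\<mu>\<close> give \<open>u\<close>. Uniqueness holds since \<open>T\<close> is defined for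
  all bounded data.

  The bound for \<open>T\<close> is Stampacchia's truncation argument. It needs no Sobolev embedding, only the
  Faber-Krahn inequality \<open>\<integral> w\<^sup>2 \<le> C \<bar>A\<bar> powr (2s/N) E(w,w)\<close> for \<open>w\<close> vanishing off \<open>A\<close>, which for
  a nonlocal form follows by integrating the kernel over a ball of twice the volume of \<open>A\<close>.

  At a boundary point with exterior balls at all small scales, the interaction with such a ball is
  a gain of order \<open>r powr (-2s)\<close> that dominates the right-hand side, the tail, and the energy of a
  semiconvex bump, so that \<open>T g\<close> decays there. Interior continuity is then a consequence of the same
  truncation argument, applied to \<open>v(x + h) - v(x)\<close>: this difference is small outside
  \<open>\<Omega> \<inter> (\<Omega> - h)\<close> by the boundary decay, and inside it solves an equation with small data.\<close>

section \<open>Size of the kernel, and changes of variables in double integrals\<close>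

section \<open>The kernel\<close>

text \<open>A measure may charge null sets, so \<open>T g\<close> must be determined at every point
  and vanish on the frontier: this is why continuity up to the boundary, and not just a bound, is
  needed. The translation argument asks that \<open>g (x + h) - g x\<close> be uniformly small,
  hence yields continuity for continuous \<open>g\<close> only; bounded Borel data follow by
  approximation in the p-norm, which the bound for \<open>T\<close> turns into uniform convergence.
  The same bound closes the gap between bounded data, for which \<open>T\<close> is built, and the
  elements of \<open>V_space\<close>, whose fractional Laplacian is only p-integrable. The
  conditions on p amount to \<open>1 / p < 2 * s / N\<close>. By Hoelder the datum contributes the
  power \<open>1 - 1 / p\<close> of the measure of a level set, Faber-Krahn contributes the power
  \<open>2 * s / N\<close>, and the truncation argument needs a total power above 1. The
  Radon-Nikodym density gives u only as an integrable function. That it lies in the dual exponent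
  space, with the stated estimate, comes from testing with truncated powers of u, or for p = 1 with
  the sign of u on a level set.\<close>

definition frac_kernel :: "real \<Rightarrow> 'a::euclidean_space \<Rightarrow> real" where
  "frac_kernel s h = norm h powr (- (real DIM('a) + 2 * s))"

lemma frac_kernel_measurable [measurable]: "frac_kernel s \<in> borel_measurable borel"
  unfolding frac_kernel_def by measurable

lemma frac_kernel_nonneg [simp]: "0 \<le> frac_kernel s h"
  by (simp add: frac_kernel_def)

lemma frac_kernel_commute: "frac_kernel s (x - y) = frac_kernel s (y - x)"
  by (simp add: frac_kernel_def norm_minus_commute)

text \<open>Since \<open>0 powr x = 0\<close>, the kernel takes the value 0 at the origin, so a
  lower bound must exclude \<open>h = 0\<close>; in applications this costs a null set.\<close>

lemma frac_kernel_lower: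
  fixes h :: "'a::euclidean_space"
  assumes "0 \<le> s" "norm h \<le> r" "h \<noteq> 0"
  shows "r powr (- (real DIM('a) + 2 * s)) \<le> frac_kernel s h"
  unfolding frac_kernel_def using assms by (intro powr_mono2') auto

lemma frac_kernel_upper:
  fixes h :: "'a::euclidean_space"
  assumes "0 \<le> s" "r \<le> norm h" "0 < r"
  shows "frac_kernel s h \<le> r powr (- (real DIM('a) + 2 * s))"
  unfolding frac_kernel_def using assms by (intro powr_mono2') auto

text \<open>The exponent is the floor of \<open>log 2 (t / r)\<close>. It is split by sign so that
  the shells inside and outside radius \<open>r\<close> are both indexed by natural numbers and can
  be summed as series.\<close>

lemma dyadic_scale:
  fixes t r :: real assumes "0 < t" "0 < r"
  obtains j :: nat where "r * 2 powr (- real j - 1) \<le> t" "t \<le> r * 2 powr (- real j)"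
  | j :: nat where "r * 2 powr (real j) \<le> t" "t \<le> r * 2 powr (real j + 1)"
proof -
  define k where "k = \<lfloor>log 2 (t / r)\<rfloor>"
  have k: "real_of_int k \<le> log 2 (t / r)" "log 2 (t / r) \<le> real_of_int k + 1"
    unfolding k_def by linarith+
  have tr: "2 powr (log 2 (t / r)) = t / r" using assms by simp
  have "2 powr (real_of_int k) \<le> 2 powr (log 2 (t / r))" using k by (intro powr_mono) auto
  then have lo: "r * 2 powr (real_of_int k) \<le> t" using assms tr by (simp add: field_simps)
  have "2 powr (log 2 (t / r)) \<le> 2 powr (real_of_int k + 1)" using k by (intro powr_mono) auto
  then have hi: "t \<le> r * 2 powr (real_of_int k + 1)" using assms tr by (simp add: field_simps)
  show ?thesis
  proof (cases "k \<ge> 0")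
    case True
    then show ?thesis using that(2)[of "nat k"] lo hi by simp
  next
    case False
    then have "- real (nat (- k - 1)) - 1 = real_of_int k" by simp
    then show ?thesis using that(1)[of "nat (- k - 1)"] lo hi 
      by (metis add.commute diff_add_cancel uminus_add_conv_diff)
  qed
qed

lemma suminf_ennreal_geometric:
  fixes q c :: real assumes "0 < q" "0 \<le> c"
  shows "(\<Sum>j. ennreal (c * 2 powr (- (q * real j)))) = ennreal (c / (1 - 2 powr (- q)))"
proof -
  have lt: "2 powr (- q) < (1::real)" using assms by (simp add: powr_less_one)
  have eq: "2 powr (- (q * real j)) = (2 powr (- q)) ^ j" for j
    by (simp add: powr_powr flip: powr_realpow)
  have "(\<lambda>j. c * (2 powr (- q)) ^ j) sums (c * (1 / (1 - 2 powr (- q))))"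
    using lt by (intro sums_mult geometric_sums) auto
  then show ?thesis using assms unfolding eq
    by (subst suminf_ennreal_eq) auto
qed

text \<open>Sum over dyadic shells. At distance \<open>r 2^(-j)\<close> the square contributes
  \<open>2^(-2j)\<close>, the kernel \<open>2^(j(N+2s))\<close> and the volume
  \<open>2^(-jN)\<close>, in total \<open>2^(-(2-2s)j)\<close>, summable because s < 1. At distance
  \<open>r 2^j\<close> the total is \<open>2^(-2sj)\<close>, summable because 0 < s. The factor
  \<open>r powr (- 2 * s)\<close> is what scaling leaves over.\<close>

lemma frac_kernel_truncated_integral:
  assumes s: "0 < s" "s < 1"
  obtains C where "0 < C"
    and "\<And>r. 0 < r \<Longrightarrow> (\<integral>\<^sup>+h. ennreal ((min 1 (norm h / r))\<^sup>2 * frac_kernel s (h::'a::euclidean_space)) \<partial>lborel)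
      \<le> ennreal (C * r powr (- 2 * s))"
proof -
  let ?N = "real DIM('a)" and ?\<omega> = "unit_ball_vol (real DIM('a))"
  define a where "a = ?N + 2 * s"
  define A where "A = ?\<omega> * 2 powr a"
  define B where "B = ?\<omega> * 2 powr ?N"
  define C where "C = A / (1 - 2 powr (- (2 - 2 * s))) + B / (1 - 2 powr (- (2 * s)))"
  have lt: "2 powr (- (2 - 2 * s)) < (1::real)" "2 powr (- (2 * s)) < (1::real)"
    using s by (auto intro!: powr_less_one)
  have AB: "A > 0" "B > 0" by (auto simp: A_def B_def)
  then have Cpos: "C > 0" unfolding C_def using lt by (intro add_pos_pos divide_pos_pos) auto
  have main: "(\<integral>\<^sup>+h. ennreal ((min 1 (norm h / r))\<^sup>2 * frac_kernel s (h::'a)) \<partial>lborel)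
    \<le> ennreal (C * r powr (- 2 * s))" if r: "r > 0" for r :: real
  proof -
    define a1 where "a1 j = 2 powr (- 2 * real j) * (r * 2 powr (- real j - 1)) powr (- a)" for j :: nat
    define b1 where "b1 j = (r * 2 powr (real j)) powr (- a)" for j :: nat
    define F where "F j h = ennreal (a1 j) * indicator (cball 0 (r * 2 powr (- real j))) h" for j and h :: 'a
    define G where "G j h = ennreal (b1 j) * indicator (cball 0 (r * 2 powr (real j + 1))) h" for j and h :: 'a
    have [measurable]: "cball (0::'a) t \<in> sets borel" for t by (intro borel_closed closed_cball)
    have [measurable]: "F j \<in> borel_measurable borel" "G j \<in> borel_measurable borel" for j
      unfolding F_def G_def by measurable
    have pt: "ennreal ((min 1 (norm h / r))\<^sup>2 * frac_kernel s h) \<le> (\<Sum>j. F j h) + (\<Sum>j. G j h)" for h :: 'a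
    proof (cases "h = 0")
      case True then show ?thesis by (simp add: frac_kernel_def)
    next
      case False
      then have "norm h > 0" by simp
      then show ?thesis using r
      proof (cases rule: dyadic_scale[of "norm h" r])
        case (1 j)
        have "min 1 (norm h / r) \<le> 2 powr (- real j)" using 1(2) r
          by (simp add: field_simps min_le_iff_disj)
        then have "(min 1 (norm h / r))\<^sup>2 \<le> (2 powr (- real j))\<^sup>2" 
          using r by (intro power_mono) auto
        also have "\<dots> = 2 powr (- 2 * real j)" by (simp add: powr_powr mult.commute flip: powr_numeral)
        finally have "(min 1 (norm h / r))\<^sup>2 * frac_kernel s h \<le> a1 j"
          unfolding a1_def a_def using s r 1(1) by (intro mult_mono frac_kernel_upper) auto
        moreover have "h \<in> cball 0 (r * 2 powr (- real j))" using 1 by simp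
        ultimately have "ennreal ((min 1 (norm h / r))\<^sup>2 * frac_kernel s h) \<le> F j h"
          by (simp add: F_def ennreal_leI)
        also have "\<dots> = (\<Sum>i\<in>{j}. F i h)" by simp
        also have "\<dots> \<le> (\<Sum>j. F j h)" by (intro sum_le_suminf) auto
        finally show ?thesis by (rule order_trans) simp
      next
        case (2 j)
        have "(min 1 (norm h / r))\<^sup>2 \<le> 1^2" using r by (intro power_mono) auto
        then have "(min 1 (norm h / r))\<^sup>2 * frac_kernel s h \<le> 1 * b1 j"
          unfolding b1_def a_def using s r 2(1) by (intro mult_mono frac_kernel_upper) auto
        moreover have "h \<in> cball 0 (r * 2 powr (real j + 1))" using 2 by simp
        ultimately have "ennreal ((min 1 (norm h / r))\<^sup>2 * frac_kernel s h) \<le> G j h"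
          by (simp add: G_def ennreal_leI)
        also have "\<dots> = (\<Sum>i\<in>{j}. G i h)" by simp
        also have "\<dots> \<le> (\<Sum>j. G j h)" by (intro sum_le_suminf) auto
        finally show ?thesis by (rule order_trans) simp
      qed
    qed
    have vol: "emeasure lborel (cball (0::'a) t) = ennreal (?\<omega> * t powr ?N)" if "t > 0" for t
      using that by (simp add: emeasure_cball powr_realpow)
    have F: "(\<integral>\<^sup>+h. F j h \<partial>lborel) = ennreal (A * r powr (- 2 * s) * 2 powr (- ((2 - 2 * s) * real j)))" for j
    proof -
      have "(\<integral>\<^sup>+h. F j h \<partial>lborel) = ennreal (a1 j) * ennreal (?\<omega> * (r * 2 powr (- real j)) powr ?N)"
        unfolding F_def using r by (simp add: nn_integral_cmult vol)
      also have "\<dots> = ennreal (a1 j * (?\<omega> * (r * 2 powr (- real j)) powr ?N))"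
        by (simp add: ennreal_mult' a1_def)
      also have "a1 j * (?\<omega> * (r * 2 powr (- real j)) powr ?N) = A * r powr (- 2 * s) * 2 powr (- ((2 - 2 * s) * real j))"
      proof -
        have "a1 j * (?\<omega> * (r * 2 powr (- real j)) powr ?N) = ?\<omega> * (r powr (- a) * r powr ?N)
            * (2 powr (- 2 * real j) * (2 powr ((- real j - 1) * (- a)) * 2 powr (- real j * ?N)))"
          using r by (simp add: a1_def powr_mult powr_powr mult_ac)
        also have "r powr (- a) * r powr ?N = r powr (- 2 * s)"
          by (simp add: a_def flip: powr_add)
        also have "2 powr (- 2 * real j) * (2 powr ((- real j - 1) * (- a)) * 2 powr (- real j * ?N))
            = 2 powr a * 2 powr (- ((2 - 2 * s) * real j))"
          unfolding powr_add[symmetric] by (rule arg_cong[where f="(powr) 2"]) (simp add: a_def algebra_simps)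
        finally show ?thesis by (simp add: A_def mult_ac)
      qed
      finally show ?thesis .
    qed
    have G: "(\<integral>\<^sup>+h. G j h \<partial>lborel) = ennreal (B * r powr (- 2 * s) * 2 powr (- (2 * s * real j)))" for j
    proof -
      have "(\<integral>\<^sup>+h. G j h \<partial>lborel) = ennreal (b1 j) * ennreal (?\<omega> * (r * 2 powr (real j + 1)) powr ?N)"
        unfolding G_def using r by (simp add: nn_integral_cmult vol)
      also have "\<dots> = ennreal (b1 j * (?\<omega> * (r * 2 powr (real j + 1)) powr ?N))"
        by (simp add: ennreal_mult' b1_def)
      also have "b1 j * (?\<omega> * (r * 2 powr (real j + 1)) powr ?N) = B * r powr (- 2 * s) * 2 powr (- (2 * s * real j))"
      proof -
        have "b1 j * (?\<omega> * (r * 2 powr (real j + 1)) powr ?N) = ?\<omega> * (r powr (- a) * r powr ?N)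
            * (2 powr (real j * (- a)) * 2 powr ((real j + 1) * ?N))"
          using r by (simp add: b1_def powr_mult powr_powr mult_ac)
        also have "r powr (- a) * r powr ?N = r powr (- 2 * s)"
          by (simp add: a_def flip: powr_add)
        also have "2 powr (real j * (- a)) * 2 powr ((real j + 1) * ?N)
            = 2 powr ?N * 2 powr (- (2 * s * real j))"
          unfolding powr_add[symmetric] by (rule arg_cong[where f="(powr) 2"]) (simp add: a_def algebra_simps)
        finally show ?thesis by (simp add: B_def mult_ac)
      qed
      finally show ?thesis .
    qed
    have "(\<integral>\<^sup>+h. ennreal ((min 1 (norm h / r))\<^sup>2 * frac_kernel s (h::'a)) \<partial>lborel)
      \<le> (\<integral>\<^sup>+h. (\<Sum>j. F j h) + (\<Sum>j. G j h) \<partial>lborel)"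
      by (intro nn_integral_mono pt)
    also have "\<dots> = (\<Sum>j. \<integral>\<^sup>+h. F j h \<partial>lborel) + (\<Sum>j. \<integral>\<^sup>+h. G j h \<partial>lborel)"
      by (simp add: nn_integral_add nn_integral_suminf)
    also have "\<dots> = ennreal (A * r powr (- 2 * s) / (1 - 2 powr (- (2 - 2 * s))))
        + ennreal (B * r powr (- 2 * s) / (1 - 2 powr (- (2 * s))))"
      unfolding F G using s AB by (subst (1 2) suminf_ennreal_geometric) auto
    also have "\<dots> = ennreal (C * r powr (- 2 * s))"
      using AB lt unfolding C_def by (subst ennreal_plus[symmetric]) (auto simp: distrib_right intro!: divide_nonneg_nonneg)
    finally show ?thesis .
  qed
  show ?thesis by (rule that[OF Cpos main])
qed

section \<open>Invariance of the Lebesgue measure\<close>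

lemma nn_integral_lborel_translate:
  fixes f :: "'a::euclidean_space \<Rightarrow> ennreal"
  assumes [measurable]: "f \<in> borel_measurable borel"
  shows "(\<integral>\<^sup>+x. f (a + x) \<partial>lborel) = (\<integral>\<^sup>+x. f x \<partial>lborel)"
  by (subst (2) lborel_distr_plus[of a, symmetric]) (simp add: nn_integral_distr)

lemma integral_lborel_translate:
  fixes f :: "'a::euclidean_space \<Rightarrow> real"
  assumes [measurable]: "f \<in> borel_measurable borel"
  shows "(LINT x|lborel. f (x + a)) = (LINT x|lborel. f x)"
  by (subst (2) lborel_distr_plus[of a, symmetric]) (simp add: integral_distr add.commute)

lemma integrable_lborel_translate:
  fixes f :: "'a::euclidean_space \<Rightarrow> real"
  assumes "integrable lborel f"
  shows "integrable lborel (\<lambda>x. f (x + a))"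
proof -
  have [measurable]: "f \<in> borel_measurable borel" using assms by auto
  have "integrable (distr lborel borel ((+) a)) f" using assms by (simp add: lborel_distr_plus)
  then show ?thesis by (simp add: integrable_distr_eq add.commute)
qed

lemma AE_lborel_translate:
  fixes a :: "'a::euclidean_space"
  assumes "AE x in lborel. P x"
  shows "AE x in lborel. P (x + a)"
proof -
  have "AE x in distr lborel borel ((+) a). P x" unfolding lborel_distr_plus by (rule assms)
  then have "AE x in lborel. P (a + x)" by (rule AE_distrD[rotated]) simp
  then show ?thesis by (simp add: add.commute)
qed

abbreviation lborel2 :: "('a::euclidean_space \<times> 'a) measure" where
  "lborel2 \<equiv> lborel \<Otimes>\<^sub>M lborel"

text \<open>Reads a pair as a shift and a base point. In these coordinates the kernel depends on the
  shift alone, and for each fixed shift the base point can be translated freely. Tonelli reduces the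
  claim to translation invariance of the inner integral.\<close>

lemma lborel2_shear:
  "distr lborel2 lborel2 (\<lambda>p. (snd p + fst p, snd p)) = (lborel2 :: ('a::euclidean_space \<times> 'a) measure)"
proof (rule measure_eqI)
  fix A :: "('a \<times> 'a) set"
  assume "A \<in> sets (distr lborel2 lborel2 (\<lambda>p. (snd p + fst p, snd p)))"
  then have A[measurable]: "A \<in> sets lborel2" by simp
  have "emeasure (distr lborel2 lborel2 (\<lambda>p. (snd p + fst p, snd p))) A
      = (\<integral>\<^sup>+p. indicator A p \<partial>distr lborel2 lborel2 (\<lambda>p. (snd p + fst p, snd p)))"
    using A by (subst nn_integral_indicator) (simp_all only: sets_distr)
  also have "\<dots> = (\<integral>\<^sup>+p. indicator A (snd p + fst p, snd p) \<partial>lborel2)"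
    by (subst nn_integral_distr) auto
  also have "\<dots> = (\<integral>\<^sup>+y. \<integral>\<^sup>+x. indicator A (y + x, y) \<partial>lborel \<partial>lborel)"
    by (subst lborel_pair.nn_integral_snd[symmetric]) auto
  also have "\<dots> = (\<integral>\<^sup>+y. \<integral>\<^sup>+x. indicator A (x, y) \<partial>lborel \<partial>lborel)"
    by (intro nn_integral_cong nn_integral_lborel_translate[of "\<lambda>x. indicator A (x, _)"]) simp
  also have "\<dots> = (\<integral>\<^sup>+p. indicator A p \<partial>lborel2)"
    by (subst lborel_pair.nn_integral_snd[symmetric]) auto
  finally show "emeasure (distr lborel2 lborel2 (\<lambda>p. (snd p + fst p, snd p))) A = emeasure lborel2 A"
    unfolding nn_integral_indicator[OF A] .
qed simp

lemma lborel2_diagonal_translate: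
  fixes a :: "'a::euclidean_space"
  shows "distr lborel2 lborel2 (\<lambda>p. (fst p + a, snd p + a)) = (lborel2 :: ('a \<times> 'a) measure)"
proof -
  have "distr lborel borel ((+) (a, a)) = (lborel :: ('a \<times> 'a) measure)"
    by (rule lborel_distr_plus)
  moreover have "((+) (a, a)) = (\<lambda>p. (fst p + a, snd p + a))"
    by (auto simp: fun_eq_iff add.commute)
  ultimately show ?thesis unfolding lborel_prod
    by (metis (no_types, lifting) distr_cong sets_lborel)
qed

lemma lborel2_swap:
  "distr lborel2 lborel2 (\<lambda>p. (snd p, fst p)) = (lborel2 :: ('a::euclidean_space \<times> 'a) measure)"
  using lborel_pair.distr_pair_swap[where 'a='a and 'b='a] by (simp add: case_prod_beta')

text \<open>The predicate need not be measurable, so it is first replaced by the complement of a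
  Borel null set, to which Fubini applies.\<close>

lemma AE_lborel2_fst:
  fixes P :: "'a::euclidean_space \<Rightarrow> bool"
  assumes "AE x in lborel. P x"
  shows "AE p in lborel2. P (fst p)"
proof -
  obtain N where N: "N \<in> null_sets lborel" "{x. \<not> P x} \<subseteq> N"
    using assms unfolding eventually_ae_filter by auto
  have [measurable]: "N \<in> sets borel" using N(1) by (auto dest: null_setsD2)
  have "AE x in lborel. AE y in lborel. x \<notin> N"
    using N(1) by (auto intro: AE_mp[OF AE_not_in[OF N(1)]])
  then have *: "AE x in lborel. AE y in (lborel::'a measure). fst (x, y) \<notin> N" by simp
  have "AE p in lborel2. fst p \<notin> N"
    by (rule lborel_pair.AE_pair_measure[OF _ *]) measurable
  then show ?thesis by (rule AE_mp) (use N(2) in auto)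
qed

lemma AE_lborel2_snd:
  fixes P :: "'a::euclidean_space \<Rightarrow> bool"
  assumes "AE x in lborel. P x"
  shows "AE p in lborel2. P (snd p)"
proof -
  have "AE p in distr lborel2 lborel2 (\<lambda>p. (snd p, fst p)). P (fst p)"
    unfolding lborel2_swap by (rule AE_lborel2_fst[OF assms])
  then show ?thesis using AE_distrD[of "\<lambda>p. (snd p, fst p)" lborel2 lborel2] by fastforce
qed

lemma integrable_lborel2_tensor:
  fixes f g :: "'a::euclidean_space \<Rightarrow> real"
  assumes "integrable lborel f" "integrable lborel g"
  shows "integrable lborel2 (\<lambda>p. f (fst p) * g (snd p))"
proof -
  have [measurable]: "f \<in> borel_measurable borel" "g \<in> borel_measurable borel" using assms by auto
  show ?thesis
  proof (rule lborel_pair.Fubini_integrable)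
    have "(\<lambda>x. LINT y|lborel. norm (f (fst (x, y)) * g (snd (x, y)))) = (\<lambda>x. \<bar>f x\<bar> * (LINT y|lborel. \<bar>g y\<bar>))"
      by (simp add: abs_mult)
    then show "integrable lborel (\<lambda>x. LINT y|lborel. norm (f (fst (x, y)) * g (snd (x, y))))"
      using assms by simp
  qed (use assms in auto)
qed

lemma integral_lborel2_tensor:
  fixes f g :: "'a::euclidean_space \<Rightarrow> real"
  assumes "integrable lborel f" "integrable lborel g"
  shows "(LINT p|lborel2. f (fst p) * g (snd p)) = (LINT x|lborel. f x) * (LINT y|lborel. g y)"
  using lborel_pair.integral_fst'[OF integrable_lborel2_tensor[OF assms]] by simp

section \<open>The energy space of Borel functions and its bilinear algebra\<close>

section \<open>The Gagliardo form\<close>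

definition incr :: "('a \<Rightarrow> real) \<Rightarrow> 'a \<times> 'a \<Rightarrow> real" where
  "incr u p = u (fst p) - u (snd p)"

definition pair_kernel :: "real \<Rightarrow> 'a::euclidean_space \<times> 'a \<Rightarrow> real" where
  "pair_kernel s p = frac_kernel s (fst p - snd p)"

definition gagliardo :: "real \<Rightarrow> ('a::euclidean_space \<Rightarrow> real) \<Rightarrow> ('a \<Rightarrow> real) \<Rightarrow> real" where
  "gagliardo s u v = (LINT p|lborel2. incr u p * incr v p * pair_kernel s p)"

text \<open>Borel measurability is built in, so that increments are measurable for the product of
  two copies of \<open>lborel\<close> and Fubini applies directly; a merely Lebesgue measurable
  function would only be measurable for a completion.\<close>

definition Hs :: "real \<Rightarrow> ('a::euclidean_space \<Rightarrow> real) set" where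
  "Hs s = {u \<in> borel_measurable borel. integrable lborel (\<lambda>x. (u x)\<^sup>2) \<and>
     integrable lborel2 (\<lambda>p. (incr u p)\<^sup>2 * pair_kernel s p)}"

definition H0 :: "real \<Rightarrow> 'a::euclidean_space set \<Rightarrow> ('a \<Rightarrow> real) set" where
  "H0 s \<Omega> = {u \<in> Hs s. AE x in lborel. x \<notin> \<Omega> \<longrightarrow> u x = 0}"

lemma incr_measurable [measurable]:
  assumes [measurable]: "u \<in> borel_measurable borel"
  shows "incr u \<in> borel_measurable lborel2"
  unfolding incr_def by measurable

lemma pair_kernel_measurable [measurable]: "pair_kernel s \<in> borel_measurable lborel2"
  unfolding pair_kernel_def by measurable

lemma pair_kernel_nonneg [simp]: "0 \<le> pair_kernel s p"
  by (simp add: pair_kernel_def)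

lemma Hs_measurable [measurable_dest]: "u \<in> Hs s \<Longrightarrow> u \<in> borel_measurable borel"
  by (simp add: Hs_def)

lemma Hs_integrable_square: "u \<in> Hs s \<Longrightarrow> integrable lborel (\<lambda>x. (u x)\<^sup>2)"
  by (simp add: Hs_def)

lemma Hs_integrable_energy: "u \<in> Hs s \<Longrightarrow> integrable lborel2 (\<lambda>p. (incr u p)\<^sup>2 * pair_kernel s p)"
  by (simp add: Hs_def)

lemma H0_Hs: "u \<in> H0 s \<Omega> \<Longrightarrow> u \<in> Hs s"
  by (simp add: H0_def)

lemma H0_zero: "u \<in> H0 s \<Omega> \<Longrightarrow> AE x in lborel. x \<notin> \<Omega> \<longrightarrow> u x = 0"
  by (simp add: H0_def)

lemma abs_mult_le_squares: "\<bar>a * b\<bar> \<le> a\<^sup>2 + (b::real)\<^sup>2"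
proof -
  have "2 * (\<bar>a\<bar> * \<bar>b\<bar>) \<le> a\<^sup>2 + b\<^sup>2" using sum_squares_bound[of "\<bar>a\<bar>" "\<bar>b\<bar>"] by simp
  moreover have "0 \<le> \<bar>a\<bar> * \<bar>b\<bar>" by simp
  ultimately show ?thesis unfolding abs_mult by linarith
qed

lemma Hs_gagliardo_integrable:
  assumes "u \<in> Hs s" "v \<in> Hs s"
  shows "integrable lborel2 (\<lambda>p. incr u p * incr v p * pair_kernel s p)"
proof (rule Bochner_Integration.integrable_bound)
  show "integrable lborel2 (\<lambda>p. (incr u p)\<^sup>2 * pair_kernel s p + (incr v p)\<^sup>2 * pair_kernel s p)"
    using assms by (auto intro!: Hs_integrable_energy)
  show "AE p in lborel2. norm (incr u p * incr v p * pair_kernel s p)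
      \<le> norm ((incr u p)\<^sup>2 * pair_kernel s p + (incr v p)\<^sup>2 * pair_kernel s p)"
  proof (rule AE_I2)
    fix p
    have "\<bar>incr u p * incr v p\<bar> * pair_kernel s p \<le> ((incr u p)\<^sup>2 + (incr v p)\<^sup>2) * pair_kernel s p"
      by (intro mult_right_mono abs_mult_le_squares) auto
    then show "norm (incr u p * incr v p * pair_kernel s p)
      \<le> norm ((incr u p)\<^sup>2 * pair_kernel s p + (incr v p)\<^sup>2 * pair_kernel s p)"
      by (simp add: abs_mult distrib_right)
  qed
qed (use Hs_measurable[OF assms(1)] Hs_measurable[OF assms(2)] in \<open>simp_all add: borel_measurable_times incr_measurable\<close>)

text \<open>From \<open>(a + b)^2 <= 2 a^2 + 2 b^2\<close>, for values and increments alike. Sums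
  are an instance, truncations are the case \<open>v = 0\<close>, and so are the test functions that
  combine a solution with a bump.\<close>

lemma Hs_dominated:
  assumes u: "u \<in> Hs s" and v: "v \<in> Hs s" and [measurable]: "w \<in> borel_measurable borel"
    and le: "\<And>x. \<bar>w x\<bar> \<le> \<bar>u x\<bar> + \<bar>v x\<bar>"
    and lei: "\<And>x y. \<bar>w x - w y\<bar> \<le> \<bar>u x - u y\<bar> + \<bar>v x - v y\<bar>"
  shows "w \<in> Hs s"
proof -
  note [measurable] = Hs_measurable[OF u] Hs_measurable[OF v]
  have sq: "c\<^sup>2 \<le> 2 * a\<^sup>2 + 2 * b\<^sup>2" if "\<bar>c\<bar> \<le> \<bar>a\<bar> + \<bar>b\<bar>" for a b c :: real
  proof -
    have "c\<^sup>2 \<le> (\<bar>a\<bar> + \<bar>b\<bar>)\<^sup>2" using that by (intro power2_le_iff_abs_le[THEN iffD2]) auto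
    also have "\<dots> \<le> 2 * a\<^sup>2 + 2 * b\<^sup>2"
      using sum_squares_bound[of "\<bar>a\<bar>" "\<bar>b\<bar>"] by (simp add: power2_sum)
    finally show ?thesis .
  qed
  have "integrable lborel (\<lambda>x. (w x)\<^sup>2)"
  proof (rule Bochner_Integration.integrable_bound)
    show "integrable lborel (\<lambda>x. 2 * (u x)\<^sup>2 + 2 * (v x)\<^sup>2)"
      using u v by (auto intro!: Hs_integrable_square)
    show "AE x in lborel. norm ((w x)\<^sup>2) \<le> norm (2 * (u x)\<^sup>2 + 2 * (v x)\<^sup>2)"
      using sq[OF le] by simp
  qed measurable
  moreover have "integrable lborel2 (\<lambda>p. (incr w p)\<^sup>2 * pair_kernel s p)"
  proof (rule Bochner_Integration.integrable_bound)
    show "integrable lborel2 (\<lambda>p. 2 * ((incr u p)\<^sup>2 * pair_kernel s p) + 2 * ((incr v p)\<^sup>2 * pair_kernel s p))"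
      using u v by (auto intro!: Hs_integrable_energy)
    show "AE p in lborel2. norm ((incr w p)\<^sup>2 * pair_kernel s p)
        \<le> norm (2 * ((incr u p)\<^sup>2 * pair_kernel s p) + 2 * ((incr v p)\<^sup>2 * pair_kernel s p))"
    proof (rule AE_I2)
      fix p
      have "(incr w p)\<^sup>2 * pair_kernel s p \<le> (2 * (incr u p)\<^sup>2 + 2 * (incr v p)\<^sup>2) * pair_kernel s p"
        unfolding incr_def by (intro mult_right_mono sq lei) auto
      then show "norm ((incr w p)\<^sup>2 * pair_kernel s p)
        \<le> norm (2 * ((incr u p)\<^sup>2 * pair_kernel s p) + 2 * ((incr v p)\<^sup>2 * pair_kernel s p))"
        by (simp add: algebra_simps)
    qed
  qed measurable
  ultimately show ?thesis by (simp add: Hs_def)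
qed

lemma Hs_zero [simp]: "(\<lambda>x. 0) \<in> Hs s"
  by (simp add: Hs_def incr_def)

lemma Hs_contraction:
  assumes "u \<in> Hs s" "w \<in> borel_measurable borel"
    and "\<And>x. \<bar>w x\<bar> \<le> \<bar>u x\<bar>" "\<And>x y. \<bar>w x - w y\<bar> \<le> \<bar>u x - u y\<bar>"
  shows "w \<in> Hs s"
  using Hs_dominated[OF assms(1) Hs_zero assms(2)] assms(3,4) by simp

lemma Hs_add:
  assumes "u \<in> Hs s" "v \<in> Hs s" shows "(\<lambda>x. u x + v x) \<in> Hs s"
  using assms by (intro Hs_dominated[OF assms]) (auto intro: Hs_measurable borel_measurable_add)

lemma Hs_cmult:
  assumes "u \<in> Hs s" shows "(\<lambda>x. c * u x) \<in> Hs s"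
proof -
  have "incr (\<lambda>x. c * u x) = (\<lambda>p. c * incr u p)" by (auto simp: incr_def algebra_simps)
  then show ?thesis using assms by (simp add: Hs_def power_mult_distrib mult.assoc borel_measurable_times)
qed

lemma Hs_uminus: "u \<in> Hs s \<Longrightarrow> (\<lambda>x. - u x) \<in> Hs s"
  using Hs_cmult[of u s "-1"] by simp

lemma Hs_diff:
  assumes "u \<in> Hs s" "v \<in> Hs s" shows "(\<lambda>x. u x - v x) \<in> Hs s"
  using Hs_add[OF assms(1) Hs_uminus[OF assms(2)]] by simp

lemma H0_add: "u \<in> H0 s \<Omega> \<Longrightarrow> v \<in> H0 s \<Omega> \<Longrightarrow> (\<lambda>x. u x + v x) \<in> H0 s \<Omega>"
  unfolding H0_def by (auto intro: Hs_add)

lemma H0_cmult: "u \<in> H0 s \<Omega> \<Longrightarrow> (\<lambda>x. c * u x) \<in> H0 s \<Omega>"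
  unfolding H0_def by (auto intro: Hs_cmult)

lemma H0_diff: "u \<in> H0 s \<Omega> \<Longrightarrow> v \<in> H0 s \<Omega> \<Longrightarrow> (\<lambda>x. u x - v x) \<in> H0 s \<Omega>"
  unfolding H0_def by (auto intro: Hs_diff)

lemma H0_uminus: "u \<in> H0 s \<Omega> \<Longrightarrow> (\<lambda>x. - u x) \<in> H0 s \<Omega>"
  using H0_cmult[of u s \<Omega> "-1"] by simp

lemma gagliardo_commute: "gagliardo s u v = gagliardo s v u"
  unfolding gagliardo_def by (simp add: mult_ac)

lemma gagliardo_add_left:
  assumes "u \<in> Hs s" "v \<in> Hs s" "w \<in> Hs s"
  shows "gagliardo s (\<lambda>x. u x + v x) w = gagliardo s u w + gagliardo s v w"
proof -
  have "incr (\<lambda>x. u x + v x) p * incr w p * pair_kernel s p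
      = incr u p * incr w p * pair_kernel s p + incr v p * incr w p * pair_kernel s p" for p
    by (simp add: incr_def algebra_simps)
  then show ?thesis unfolding gagliardo_def
    by (simp add: Hs_gagliardo_integrable assms)
qed

lemma gagliardo_cmult_left: "gagliardo s (\<lambda>x. c * u x) w = c * gagliardo s u w"
proof -
  have "incr (\<lambda>x. c * u x) p * incr w p * pair_kernel s p
      = c * (incr u p * incr w p * pair_kernel s p)" for p
    by (simp add: incr_def algebra_simps)
  then show ?thesis unfolding gagliardo_def by (simp only: integral_mult_right_zero)
qed

lemma gagliardo_uminus_left: "gagliardo s (\<lambda>x. - u x) w = - gagliardo s u w"
  using gagliardo_cmult_left[of s "-1" u w] by simp

lemma gagliardo_diff_left:
  assumes "u \<in> Hs s" "v \<in> Hs s" "w \<in> Hs s"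
  shows "gagliardo s (\<lambda>x. u x - v x) w = gagliardo s u w - gagliardo s v w"
  using gagliardo_add_left[OF assms(1) Hs_uminus[OF assms(2)] assms(3)]
  by (simp add: gagliardo_uminus_left)

lemma gagliardo_nonneg: "0 \<le> gagliardo s u u"
  unfolding gagliardo_def by (intro integral_nonneg_AE AE_I2) simp

text \<open>With \<open>t = 1\<close> and \<open>t = -1\<close> this gives the parallelogram law;
  with small \<open>t\<close> of both signs, nonnegativity of the left side bounds
  \<open>gagliardo s u v\<close> in the manner of Cauchy-Schwarz.\<close>

lemma gagliardo_square:
  assumes "u \<in> Hs s" "v \<in> Hs s"
  shows "gagliardo s (\<lambda>x. u x + t * v x) (\<lambda>x. u x + t * v x)
    = gagliardo s u u + 2 * t * gagliardo s u v + t\<^sup>2 * gagliardo s v v"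
proof -
  note tv = Hs_cmult[OF assms(2), of t]
  note uv = Hs_add[OF assms(1) tv]
  have "gagliardo s (\<lambda>x. u x + t * v x) (\<lambda>x. u x + t * v x)
     = gagliardo s u (\<lambda>x. u x + t * v x) + t * gagliardo s v (\<lambda>x. u x + t * v x)"
    using gagliardo_add_left[OF assms(1) tv uv] by (simp add: gagliardo_cmult_left)
  moreover have "gagliardo s w (\<lambda>x. u x + t * v x) = gagliardo s w u + t * gagliardo s w v" if "w \<in> Hs s" for w
    using gagliardo_add_left[OF assms(1) tv that] 
    by (simp add: gagliardo_cmult_left gagliardo_commute[of s w])
  ultimately show ?thesis using assms
    by (simp add: gagliardo_commute[of s v u] power2_eq_square algebra_simps)
qed

lemma distr_lborel2_translate_integral:
  fixes f :: "'a::euclidean_space \<times> 'a \<Rightarrow> real"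
  assumes [measurable]: "f \<in> borel_measurable lborel2"
  shows "integrable lborel2 (\<lambda>p. f (fst p + a, snd p + a)) \<longleftrightarrow> integrable lborel2 f"
    and "(LINT p|lborel2. f (fst p + a, snd p + a)) = (LINT p|lborel2. f p)"
proof -
  have "integrable (distr lborel2 lborel2 (\<lambda>p. (fst p + a, snd p + a))) f \<longleftrightarrow>
      integrable lborel2 (\<lambda>p. f (fst p + a, snd p + a))"
    by (rule integrable_distr_eq) auto
  then show "integrable lborel2 (\<lambda>p. f (fst p + a, snd p + a)) \<longleftrightarrow> integrable lborel2 f"
    by (simp add: lborel2_diagonal_translate)
  have "integral\<^sup>L (distr lborel2 lborel2 (\<lambda>p. (fst p + a, snd p + a))) f =
      (LINT p|lborel2. f (fst p + a, snd p + a))"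
    by (rule integral_distr) auto
  then show "(LINT p|lborel2. f (fst p + a, snd p + a)) = (LINT p|lborel2. f p)"
    by (simp add: lborel2_diagonal_translate)
qed

lemma Hs_translate:
  assumes "u \<in> Hs s" shows "(\<lambda>x. u (x + a)) \<in> Hs s"
proof -
  note [measurable] = Hs_measurable[OF assms]
  have "integrable lborel2 (\<lambda>p. (incr u (fst p + a, snd p + a))\<^sup>2 * pair_kernel s (fst p + a, snd p + a))"
    by (subst distr_lborel2_translate_integral(1)[of "\<lambda>p. (incr u p)\<^sup>2 * pair_kernel s p"])
      (use Hs_integrable_energy[OF assms] in auto)
  then have "integrable lborel2 (\<lambda>p. (incr (\<lambda>x. u (x + a)) p)\<^sup>2 * pair_kernel s p)"
    by (simp add: incr_def pair_kernel_def)
  then show ?thesis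
    using integrable_lborel_translate[OF Hs_integrable_square[OF assms], of a]
    by (simp add: Hs_def)
qed

lemma gagliardo_translate:
  assumes [measurable]: "u \<in> borel_measurable borel" "v \<in> borel_measurable borel"
  shows "gagliardo s (\<lambda>x. u (x + a)) (\<lambda>x. v (x + a)) = gagliardo s u v"
proof -
  have "(LINT p|lborel2. incr u (fst p + a, snd p + a) * incr v (fst p + a, snd p + a)
      * pair_kernel s (fst p + a, snd p + a)) = gagliardo s u v"
    unfolding gagliardo_def
    by (subst distr_lborel2_translate_integral(2)[of "\<lambda>p. incr u p * incr v p * pair_kernel s p"]) auto
  then show ?thesis by (simp add: gagliardo_def incr_def pair_kernel_def)
qed

lemma gagliardo_nn_integral:
  assumes "u \<in> Hs s"
  shows "ennreal (gagliardo s u u) = (\<integral>\<^sup>+x. \<integral>\<^sup>+y. ennreal ((u x - u y)\<^sup>2 * frac_kernel s (x - y)) \<partial>lborel \<partial>lborel)"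
proof -
  note [measurable] = Hs_measurable[OF assms]
  have "ennreal (gagliardo s u u) = (\<integral>\<^sup>+p. ennreal ((incr u p)\<^sup>2 * pair_kernel s p) \<partial>lborel2)"
    unfolding gagliardo_def power2_eq_square[symmetric]
    by (rule nn_integral_eq_integral[symmetric]) (use Hs_integrable_energy[OF assms] in auto)
  also have "\<dots> = (\<integral>\<^sup>+x. \<integral>\<^sup>+y. ennreal ((incr u (x, y))\<^sup>2 * pair_kernel s (x, y)) \<partial>lborel \<partial>lborel)"
    by (subst lborel.nn_integral_fst) auto
  finally show ?thesis by (simp add: incr_def pair_kernel_def)
qed

section \<open>From energy estimates to pointwise bounds\<close>

section \<open>The fractional Faber-Krahn inequality\<close>

lemma faber_krahn:
  assumes s: "0 < s"
  obtains C where "0 < C"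
    and "\<And>A w. A \<in> sets borel \<Longrightarrow> emeasure lborel (A :: 'a::euclidean_space set) < \<infinity> \<Longrightarrow> w \<in> Hs s \<Longrightarrow>
      AE x in lborel. x \<notin> A \<longrightarrow> w x = 0 \<Longrightarrow>
      (LINT x|lborel. (w x)\<^sup>2) \<le> C * measure lborel A powr (2 * s / real DIM('a)) * gagliardo s w w"
proof -
  let ?N = "real DIM('a)" and ?\<omega> = "unit_ball_vol (real DIM('a))"
  define a where "a = ?N + 2 * s"
  \<comment> \<open>The value for which the ball of volume \<open>2 * m\<close>, with
    \<open>m = measure lborel A\<close>, has a radius satisfying
    \<open>r powr (- a) * m = 1 / (C * m powr (2 * s / N))\<close>.\<close>
  define C where "C = (2 / ?\<omega>) powr (1 + 2 * s / ?N)"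
  have om: "?\<omega> > 0" by simp
  then have om0: "?\<omega> \<noteq> 0" by linarith
  then have C: "C > 0" unfolding C_def by (simp add: om0)
  have main: "(LINT x|lborel. (w x)\<^sup>2) \<le> C * measure lborel A powr (2 * s / ?N) * gagliardo s w w"
    if A[measurable]: "A \<in> sets borel" and fin: "emeasure lborel (A :: 'a set) < \<infinity>" and w: "w \<in> Hs s"
      and zero: "AE x in lborel. x \<notin> A \<longrightarrow> w x = 0" for A w
  proof -
    note [measurable] = Hs_measurable[OF w]
    define m where "m = measure lborel A"
    have emA: "emeasure lborel A = ennreal m"
      using fin by (simp add: m_def emeasure_eq_ennreal_measure)
    show ?thesis
    proof (cases "m = 0")
      case True
      then have "AE x in lborel. x \<notin> A"
        using emA by (intro AE_not_in) auto
      with zero have "AE x in lborel. (w x)\<^sup>2 = 0" by eventually_elim auto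
      then have "(LINT x|lborel. (w x)\<^sup>2) = 0" by (rule integral_eq_zero_AE)
      then show ?thesis using C by (simp add: gagliardo_nonneg)
    next
      case False
      then have m: "m > 0" by (simp add: m_def zero_less_measure_iff)
      define r where "r = (2 * m / ?\<omega>) powr (1 / ?N)"
      have r: "r > 0" using m by (simp add: r_def om0)
      have rN: "?\<omega> * r ^ DIM('a) = 2 * m"
        using m r by (simp add: r_def powr_powr om0 flip: powr_realpow)
      have ra: "r powr (- a) * m = 1 / (C * m powr (2 * s / ?N))"
      proof -
        have "r powr a = (2 * m / ?\<omega>) powr (1 + 2 * s / ?N)"
          by (simp add: r_def a_def powr_powr add_divide_distrib)
        also have "\<dots> = C * m powr (1 + 2 * s / ?N)"
          using m om unfolding C_def by (simp add: powr_mult[symmetric])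
        also have "\<dots> = C * m powr (2 * s / ?N) * m"
          using m by (simp add: powr_add)
        finally show ?thesis using m C by (simp add: powr_minus field_simps)
      qed
      \<comment> \<open>The ball has volume \<open>2 * m\<close> and \<open>A\<close> has volume
        \<open>m\<close>: wherever the ball is centred, at least \<open>m\<close> of it lies where
        \<open>w\<close> vanishes.\<close>
      have vol: "ennreal m \<le> emeasure lborel (ball x r - A)" for x :: 'a
      proof -
        have "ennreal m + ennreal m = emeasure lborel (ball x r)"
          using r rN m by (simp add: emeasure_ball flip: ennreal_plus)
        also have "\<dots> \<le> emeasure lborel ((ball x r - A) \<union> A)"
          by (rule emeasure_mono) auto
        also have "\<dots> \<le> emeasure lborel (ball x r - A) + emeasure lborel A"
          by (rule emeasure_subadditive) auto
        finally show ?thesis by (simp add: emA add.commute)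
      qed
      have inner: "ennreal ((w x)\<^sup>2 * r powr (- a)) * ennreal m
          \<le> (\<integral>\<^sup>+y. ennreal ((w x - w y)\<^sup>2 * frac_kernel s (x - y)) \<partial>lborel)" for x
      proof -
        have "ennreal ((w x)\<^sup>2 * r powr (- a)) * ennreal m \<le> ennreal ((w x)\<^sup>2 * r powr (- a)) * emeasure lborel (ball x r - A)"
          by (intro mult_left_mono vol) auto
        also have "\<dots> = (\<integral>\<^sup>+y. ennreal ((w x)\<^sup>2 * r powr (- a)) * indicator (ball x r - A) y \<partial>lborel)"
          by (subst nn_integral_cmult_indicator) auto
        also have "\<dots> \<le> (\<integral>\<^sup>+y. ennreal ((w x - w y)\<^sup>2 * frac_kernel s (x - y)) \<partial>lborel)"
        proof (rule nn_integral_mono_AE)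
          have "AE y in lborel. y \<noteq> x" by (rule AE_lborel_singleton)
          with zero show "AE y in lborel. ennreal ((w x)\<^sup>2 * r powr (- a)) * indicator (ball x r - A) y
            \<le> ennreal ((w x - w y)\<^sup>2 * frac_kernel s (x - y))"
          proof eventually_elim
            case (elim y)
            show ?case
            proof (cases "y \<in> ball x r - A")
              case True
              then have "r powr (- a) \<le> frac_kernel s (x - y)"
                unfolding a_def using s elim by (intro frac_kernel_lower) (auto simp: dist_norm)
              then show ?thesis using True elim by (simp add: ennreal_leI mult_left_mono)
            qed simp
          qed
        qed
        finally show ?thesis .
      qed
      have "ennreal ((LINT x|lborel. (w x)\<^sup>2) * (r powr (- a) * m)) = (\<integral>\<^sup>+x. ennreal ((w x)\<^sup>2) \<partial>lborel) * ennreal (r powr (- a) * m)"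
        using m by (subst nn_integral_eq_integral) (auto simp: ennreal_mult Hs_integrable_square[OF w])
      also have "\<dots> = (\<integral>\<^sup>+x. ennreal ((w x)\<^sup>2 * r powr (- a)) * ennreal m \<partial>lborel)"
        using m by (subst nn_integral_multc[symmetric]) (auto simp: ennreal_mult mult_ac)
      also have "\<dots> \<le> ennreal (gagliardo s w w)"
        unfolding gagliardo_nn_integral[OF w] by (intro nn_integral_mono inner)
      finally have "(LINT x|lborel. (w x)\<^sup>2) * (r powr (- a) * m) \<le> gagliardo s w w"
        by (simp add: gagliardo_nonneg)
      then show ?thesis unfolding ra using C m by (simp add: m_def[symmetric] field_simps)
    qed
  qed
  show ?thesis by (rule that[OF C main])
qed

section \<open>Stampacchia truncation\<close>

text \<open>The truncation that keeps what a value exceeds \<open>k\<close> by, up to height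
  \<open>j\<close>. The cap makes the resulting test functions bounded, so that an equation with
  merely integrable datum can be tested with them.\<close>

definition slice :: "real \<Rightarrow> real \<Rightarrow> real \<Rightarrow> real" where
  "slice k j t = min (max (t - k) 0) j"

lemma slice_measurable [measurable]: "slice k j \<in> borel_measurable borel"
  unfolding slice_def by measurable

lemma slice_bounds: "0 \<le> j \<Longrightarrow> 0 \<le> slice k j t" "slice k j t \<le> j"
  by (auto simp: slice_def)

text \<open>Truncation is nondecreasing and 1-Lipschitz. Multiplied by the kernel and integrated,
  the inequality bounds the energy of a slice of \<open>z\<close> by the form evaluated at
  \<open>z\<close> and that slice.\<close>

lemma slice_incr_mult: "(slice k j t - slice k j t')\<^sup>2 \<le> (t - t') * (slice k j t - slice k j t')"
proof -
  have "(0 \<le> slice k j t - slice k j t' \<and> slice k j t - slice k j t' \<le> t - t') \<or>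
    (0 \<le> slice k j t' - slice k j t \<and> slice k j t' - slice k j t \<le> t' - t)"
    by (auto simp: slice_def min_def max_def)
  then show ?thesis
  proof
    assume "0 \<le> slice k j t - slice k j t' \<and> slice k j t - slice k j t' \<le> t - t'"
    then show ?thesis unfolding power2_eq_square by (intro mult_right_mono) auto
  next
    assume *: "0 \<le> slice k j t' - slice k j t \<and> slice k j t' - slice k j t \<le> t' - t"
    then have "(slice k j t' - slice k j t) * (slice k j t' - slice k j t) \<le> (t' - t) * (slice k j t' - slice k j t)"
      by (intro mult_right_mono) auto
    then show ?thesis unfolding power2_eq_square by (simp add: algebra_simps)
  qed
qed

lemma Hs_slice:
  assumes "z \<in> Hs s" "0 \<le> k" "0 \<le> j"
  shows "(\<lambda>x. slice k j (z x)) \<in> Hs s"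
proof (rule Hs_contraction[OF assms(1)])
  note [measurable] = Hs_measurable[OF assms(1)]
  show "(\<lambda>x. slice k j (z x)) \<in> borel_measurable borel" by measurable
qed (use assms in \<open>auto simp: slice_def min_def max_def abs_if\<close>)

text \<open>The height \<open>j\<close> enters to the first power because a slice of height
  \<open>j\<close> produces \<open>j^2\<close> on the left and \<open>j\<close> on the right. The
  levels approach \<open>k0 + d\<close> with increments \<open>d 2^(-n-1)\<close>, the values at
  them decay geometrically, and the superlinear power \<open>\<beta>\<close> pays for the division
  by ever smaller increments.\<close>

lemma stampacchia_iteration:
  fixes a :: "real \<Rightarrow> real"
  assumes nonneg: "\<And>k. 0 \<le> a k" and anti: "\<And>k l. k0 \<le> k \<Longrightarrow> k \<le> l \<Longrightarrow> a l \<le> a k"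
    and le: "a k0 \<le> b" and \<beta>: "1 < \<beta>" and C: "0 \<le> C"
    and step: "\<And>k j. k0 \<le> k \<Longrightarrow> 0 < j \<Longrightarrow> j * a (k + j) \<le> C * a k powr \<beta>"
    and d: "C * b powr (\<beta> - 1) * 2 powr (\<beta> / (\<beta> - 1)) < d"
  shows "a (k0 + d) = 0"
proof -
  have b: "0 \<le> b" using nonneg le by (meson order_trans)
  have d0: "0 < d" using d C by (smt (verit) mult_nonneg_nonneg powr_ge_zero)
  \<comment> \<open>Chosen so that \<open>\<alpha> * \<beta> = 1 + \<alpha>\<close>: raising
    \<open>2 powr (- n * \<alpha>)\<close> to the power \<open>\<beta>\<close> gains a further
    factor \<open>2 powr (- n)\<close>, which is what dividing by the n-th increment loses.\<close>
  define \<alpha> where "\<alpha> = 1 / (\<beta> - 1)"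
  have \<alpha>: "\<alpha> > 0" using \<beta> by (simp add: \<alpha>_def)
  have ab: "\<alpha> * \<beta> = 1 + \<alpha>" using \<beta> by (simp add: \<alpha>_def field_simps)
  define kk where "kk n = k0 + d * (1 - 2 powr (- real n))" for n :: nat
  have kk0: "k0 \<le> kk n" "kk n \<le> k0 + d" for n
    using d0 powr_mono[of "- real n" 0 2] by (auto simp: kk_def intro!: mult_left_le)
  have kkS: "kk (Suc n) = kk n + d * 2 powr (- real n - 1)" for n
    by (simp add: kk_def algebra_simps powr_diff powr_minus_divide powr_add)
  have claim: "a (kk n) \<le> b * 2 powr (- real n * \<alpha>)" for n
  proof (induction n)
    case 0 then show ?case using le by (simp add: kk_def)
  next
    case (Suc n)
    define j where "j = d * 2 powr (- real n - 1)"
    have j: "j > 0" using d0 by (simp add: j_def)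
    have "j * a (kk (Suc n)) \<le> C * a (kk n) powr \<beta>"
      unfolding kkS j_def[symmetric] by (intro step kk0 j)
    also have "\<dots> \<le> C * (b * 2 powr (- real n * \<alpha>)) powr \<beta>"
      using Suc C nonneg \<beta> by (intro mult_left_mono powr_mono2) auto
    also have "\<dots> = C * b powr (\<beta> - 1) * b * 2 powr (- real n * (1 + \<alpha>))"
    proof -
      have "b powr \<beta> = b powr (\<beta> - 1) * b"
        using b powr_add[of b "\<beta> - 1" 1] by (cases "b = 0") auto
      then show ?thesis using b by (simp add: powr_mult powr_powr mult.assoc ab)
    qed
    also have "\<dots> \<le> (d * 2 powr (- (1 + \<alpha>))) * b * 2 powr (- real n * (1 + \<alpha>))"
    proof -
      have "C * b powr (\<beta> - 1) * 2 powr (1 + \<alpha>) \<le> d" 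
        using d \<beta> unfolding ab[symmetric] by (simp add: \<alpha>_def)
      then have "C * b powr (\<beta> - 1) * 2 powr (1 + \<alpha>) * 2 powr (- (1 + \<alpha>)) \<le> d * 2 powr (- (1 + \<alpha>))"
        by (intro mult_right_mono) auto
      then have "C * b powr (\<beta> - 1) \<le> d * 2 powr (- (1 + \<alpha>))"
        by (simp add: mult.assoc flip: powr_add)
      then show ?thesis using b by (intro mult_right_mono) auto
    qed
    also have "\<dots> = j * (b * 2 powr (- real (Suc n) * \<alpha>))"
    proof -
      have "2 powr (- (1 + \<alpha>)) * 2 powr (- real n * (1 + \<alpha>)) = 2 powr (- real n - 1) * 2 powr (- real (Suc n) * \<alpha>)"
        unfolding powr_add[symmetric] by (rule arg_cong[where f="(powr) 2"]) (simp add: algebra_simps)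
      then show ?thesis by (simp add: j_def mult_ac)
    qed
    finally show ?case using j by simp
  qed
  have "a (k0 + d) \<le> b * 2 powr (- real n * \<alpha>)" for n
    using anti[OF kk0(1)[of n] kk0(2)] claim[of n] by simp
  moreover have "(\<lambda>n. b * 2 powr (- real n * \<alpha>)) \<longlonglongrightarrow> b * 0"
  proof (intro tendsto_intros)
    have "(2::real) powr (- real n * \<alpha>) = (2 powr (- \<alpha>)) ^ n" for n
      by (simp add: powr_powr mult.commute flip: powr_realpow)
    moreover have "(\<lambda>n. (2 powr (- \<alpha>)) ^ n) \<longlonglongrightarrow> (0::real)"
      using \<alpha> by (intro LIMSEQ_realpow_zero powr_less_one) auto
    ultimately show "(\<lambda>n. (2::real) powr (- real n * \<alpha>)) \<longlonglongrightarrow> 0" by simp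
  qed
  ultimately have "a (k0 + d) \<le> b * 0" by (intro LIMSEQ_le_const) auto
  then show ?thesis using nonneg[of "k0 + d"] by simp
qed

text \<open>A slice of height \<open>j\<close> above level \<open>k\<close> vanishes off
  \<open>A k\<close> and equals \<open>j\<close> on \<open>A (k + j)\<close>. Faber-Krahn bounds
  \<open>j^2 |A (k + j)|\<close> by \<open>|A k|^(2s/N)\<close> times its energy, and the hypothesis
  bounds that energy by \<open>j F |A k|^\<gamma>\<close>: a recursion with exponent
  \<open>\<gamma> + 2s/N > 1\<close>. The base level \<open>k0\<close> is there for differences of
  translates, which outside the set are small but not zero.\<close>

lemma stampacchia:
  fixes \<Omega> :: "'a::euclidean_space set"
  assumes s: "0 < s" and \<Omega>[measurable]: "\<Omega> \<in> sets borel" and fin: "emeasure lborel \<Omega> < \<infinity>"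
    and \<gamma>: "1 < \<gamma> + 2 * s / real DIM('a)"
  obtains C where "0 \<le> C"
    and "\<And>z k0 F. z \<in> Hs s \<Longrightarrow> 0 \<le> k0 \<Longrightarrow> 0 \<le> F \<Longrightarrow> AE x in lborel. x \<notin> \<Omega> \<longrightarrow> z x \<le> k0 \<Longrightarrow>
      (\<And>k j. k0 \<le> k \<Longrightarrow> 0 < j \<Longrightarrow>
        gagliardo s z (\<lambda>x. slice k j (z x)) \<le> j * F * measure lborel {x\<in>\<Omega>. k < z x} powr \<gamma>) \<Longrightarrow>
      AE x in lborel. z x \<le> k0 + C * F"
proof -
  let ?N = "real DIM('a)"
  obtain C1 where C1: "C1 > 0"
    and FK: "\<And>A w. A \<in> sets borel \<Longrightarrow> emeasure lborel (A :: 'a set) < \<infinity> \<Longrightarrow> w \<in> Hs s \<Longrightarrow>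
      AE x in lborel. x \<notin> A \<longrightarrow> w x = 0 \<Longrightarrow>
      (LINT x|lborel. (w x)\<^sup>2) \<le> C1 * measure lborel A powr (2 * s / ?N) * gagliardo s w w"
    by (rule faber_krahn[OF s, where 'a='a]) (rule that)
  define \<beta> where "\<beta> = \<gamma> + 2 * s / ?N"
  define C where "C = C1 * measure lborel \<Omega> powr (\<beta> - 1) * 2 powr (\<beta> / (\<beta> - 1))"
  have C: "C \<ge> 0" using C1 by (simp add: C_def)
  have main: "AE x in lborel. z x \<le> k0 + C * F"
    if z: "z \<in> Hs s" and k0: "0 \<le> k0" and F: "0 \<le> F" and out: "AE x in lborel. x \<notin> \<Omega> \<longrightarrow> z x \<le> k0"
    and test: "\<And>k j. k0 \<le> k \<Longrightarrow> 0 < j \<Longrightarrow>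
       gagliardo s z (\<lambda>x. slice k j (z x)) \<le> j * F * measure lborel {x\<in>\<Omega>. k < z x} powr \<gamma>" for z k0 F
  proof -
    note [measurable] = Hs_measurable[OF z]
    define A where "A k = {x\<in>\<Omega>. k < z x}" for k
    have A[measurable]: "A k \<in> sets borel" for k unfolding A_def by measurable
    have Afin: "emeasure lborel (A k) < \<infinity>" for k
      using fin by (intro le_less_trans[OF emeasure_mono[of "A k" \<Omega>]]) (auto simp: A_def)
    define a where "a k = measure lborel (A k)" for k
    have mono: "a l \<le> a k" if "k \<le> l" for k l
      unfolding a_def using that Afin[of k]
      by (intro measure_mono_fmeasurable fmeasurableI) (auto simp: A_def)
    have step: "j * a (k + j) \<le> C1 * F * a k powr \<beta>" if "k0 \<le> k" "0 < j" for k j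
    proof -
      define w where "w x = slice k j (z x)" for x
      have w: "w \<in> Hs s" unfolding w_def using that k0 by (intro Hs_slice z) auto
      note [measurable] = Hs_measurable[OF w]
      have w0: "AE x in lborel. x \<notin> A k \<longrightarrow> w x = 0"
        using out by eventually_elim (use that in \<open>auto simp: A_def w_def slice_def\<close>)
      have "gagliardo s w w \<le> gagliardo s z w"
        unfolding gagliardo_def
      proof (rule integral_mono[OF Hs_gagliardo_integrable[OF w w] Hs_gagliardo_integrable[OF z w]])
        fix p
        show "incr w p * incr w p * pair_kernel s p \<le> incr z p * incr w p * pair_kernel s p"
          unfolding incr_def w_def
          by (rule mult_right_mono[OF _ pair_kernel_nonneg])
            (use slice_incr_mult[of k j "z (fst p)" "z (snd p)"] in \<open>simp add: power2_eq_square\<close>)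
      qed
      also have "\<dots> \<le> j * F * a k powr \<gamma>"
        using test[OF that] unfolding w_def a_def A_def .
      finally have E: "gagliardo s w w \<le> j * F * a k powr \<gamma>" .
      have "j\<^sup>2 * a (k + j) = (LINT x|lborel. j\<^sup>2 * indicator (A (k + j)) x)"
        using Afin[of "k+j"] by (simp add: a_def)
      also have "\<dots> \<le> (LINT x|lborel. (w x)\<^sup>2)"
      proof (rule integral_mono)
        show "integrable lborel (\<lambda>x. j\<^sup>2 * indicator (A (k + j)) x)"
          using Afin[of "k+j"] by (simp add: integrable_indicator_iff)
        show "integrable lborel (\<lambda>x. (w x)\<^sup>2)" by (rule Hs_integrable_square[OF w])
        show "j\<^sup>2 * indicator (A (k + j)) x \<le> (w x)\<^sup>2" for x
          using that by (auto simp: indicator_def A_def w_def slice_def)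
      qed
      also have "\<dots> \<le> C1 * a k powr (2 * s / ?N) * gagliardo s w w"
        unfolding a_def by (rule FK[OF A Afin w w0])
      also have "\<dots> \<le> C1 * a k powr (2 * s / ?N) * (j * F * a k powr \<gamma>)"
        using C1 by (intro mult_left_mono E) auto
      also have "\<dots> = j * (C1 * F * a k powr \<beta>)"
        by (simp add: \<beta>_def powr_add mult_ac)
      finally have "j * (j * a (k + j)) \<le> j * (C1 * F * a k powr \<beta>)"
        by (simp add: power2_eq_square mult_ac)
      then show ?thesis using that by simp
    qed
    have zero: "a (k0 + d) = 0" if "C * F < d" for d
    proof (rule stampacchia_iteration[where C="C1 * F" and \<beta>=\<beta> and b="measure lborel \<Omega>"])
      show "a k0 \<le> measure lborel \<Omega>" unfolding a_def using fin
        by (intro measure_mono_fmeasurable fmeasurableI) (auto simp: A_def)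
      show "C1 * F * measure lborel \<Omega> powr (\<beta> - 1) * 2 powr (\<beta> / (\<beta> - 1)) < d"
        using that by (simp add: C_def mult_ac)
    qed (use mono step C1 F \<gamma> in \<open>auto simp: a_def \<beta>_def\<close>)
    \<comment> \<open>The iteration needs a strict inequality, so the level
      \<open>k0 + C * F\<close> is only reached in the limit.\<close>
    have "AE x in lborel. z x \<le> k0 + (C * F + 1 / real (Suc n))" for n
    proof -
      have "a (k0 + (C * F + 1 / real (Suc n))) = 0" by (rule zero) simp
      then have "emeasure lborel (A (k0 + (C * F + 1 / real (Suc n)))) = 0"
        using emeasure_eq_ennreal_measure[OF less_imp_neq[OF Afin[of "k0 + (C * F + 1 / real (Suc n))", unfolded infinity_ennreal_def]]]
        by (simp only: a_def ennreal_0)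
      then have "AE x in lborel. x \<notin> A (k0 + (C * F + 1 / real (Suc n)))"
        by (intro AE_not_in) auto
      with out show ?thesis
      proof eventually_elim
        case (elim x)
        show ?case
        proof (cases "x \<in> \<Omega>")
          case False
          then show ?thesis using elim C F mult_nonneg_nonneg[OF C F]
            by (smt (verit) divide_nonneg_nonneg of_nat_0_le_iff)
        qed (use elim in \<open>auto simp: A_def\<close>)
      qed
    qed
    then have "AE x in lborel. \<forall>n. z x \<le> k0 + (C * F + 1 / real (Suc n))"
      by (simp add: AE_all_countable)
    then show ?thesis
    proof eventually_elim
      case (elim x)
      have "z x - (k0 + C * F) \<le> 0"
      proof (rule LIMSEQ_le_const[OF LIMSEQ_inverse_real_of_nat], intro exI allI impI)
        show "z x - (k0 + C * F) \<le> inverse (real (Suc n))" for n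
          using elim[rule_format, of n] by (simp add: inverse_eq_divide)
      qed
      then show ?case by simp
    qed
  qed
  show ?thesis by (rule that[OF C main])
qed

section \<open>The direct method in the energy space\<close>

section \<open>Existence of weak solutions\<close>

text \<open>Fatou's lemma in the form that sends one index of a Cauchy estimate to infinity: the
  bound is required from index \<open>n\<close> on only.\<close>

lemma nn_integral_fatou_bound:
  fixes f :: "nat \<Rightarrow> 'b \<Rightarrow> real"
  assumes [measurable]: "\<And>j. f j \<in> borel_measurable M"
    and lim: "AE x in M. (\<lambda>j. f j x) \<longlonglongrightarrow> g x"
    and bound: "\<And>j. n \<le> j \<Longrightarrow> (\<integral>\<^sup>+x. ennreal (f j x) \<partial>M) \<le> B"
  shows "(\<integral>\<^sup>+x. ennreal (g x) \<partial>M) \<le> B"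
proof -
  have "(\<integral>\<^sup>+x. ennreal (g x) \<partial>M) = (\<integral>\<^sup>+x. liminf (\<lambda>j. ennreal (f j x)) \<partial>M)"
  proof (rule nn_integral_cong_AE)
    show "AE x in M. ennreal (g x) = liminf (\<lambda>j. ennreal (f j x))"
      using lim
    proof eventually_elim
      case (elim x)
      then have "(\<lambda>j. ennreal (f j x)) \<longlonglongrightarrow> ennreal (g x)" by (rule tendsto_ennrealI)
      then show ?case by (metis lim_imp_Liminf sequentially_bot)
    qed
  qed
  also have "\<dots> \<le> liminf (\<lambda>j. \<integral>\<^sup>+x. ennreal (f j x) \<partial>M)"
    by (rule nn_integral_liminf) measurable
  also have "\<dots> \<le> B"
    by (rule Liminf_le) (use bound in \<open>auto intro!: eventually_sequentiallyI[of n]\<close>)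
  finally show ?thesis .
qed

lemma integrable_mult_squares:
  fixes f g :: "'b \<Rightarrow> real"
  assumes [measurable]: "f \<in> borel_measurable M" "g \<in> borel_measurable M"
    and "integrable M (\<lambda>x. (f x)\<^sup>2)" "integrable M (\<lambda>x. (g x)\<^sup>2)"
  shows "integrable M (\<lambda>x. f x * g x)"
proof (rule Bochner_Integration.integrable_bound)
  show "integrable M (\<lambda>x. (f x)\<^sup>2 + (g x)\<^sup>2)" using assms by auto
  show "AE x in M. norm (f x * g x) \<le> norm ((f x)\<^sup>2 + (g x)\<^sup>2)"
    using abs_mult_le_squares by simp
qed measurable

text \<open>With increments \<open>D n\<close>, Young's inequality gives
  \<open>|D n| <= 2^n (D n)^2 + 2^(-n)\<close>. The integrals of \<open>2^n (D n)^2\<close> are at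
  most \<open>B 2^(-n)\<close>, so at almost every point the increments are absolutely
  summable.\<close>

lemma AE_convergent_of_fast_L2:
  fixes v :: "nat \<Rightarrow> 'a::euclidean_space \<Rightarrow> real"
  assumes [measurable]: "\<And>n. v n \<in> borel_measurable borel"
    and B: "0 \<le> B"
    and le: "\<And>n. (\<integral>\<^sup>+x. ennreal ((v (Suc n) x - v n x)\<^sup>2) \<partial>lborel) \<le> ennreal (B * (1/4) ^ n)"
  shows "AE x in lborel. convergent (\<lambda>n. v n x)"
proof -
  define D where "D n x = v (Suc n) x - v n x" for n x
  have [measurable]: "D n \<in> borel_measurable borel" for n unfolding D_def by measurable
  have "(\<integral>\<^sup>+x. (\<Sum>n. ennreal (2 ^ n * (D n x)\<^sup>2)) \<partial>lborel) = (\<Sum>n. \<integral>\<^sup>+x. ennreal (2 ^ n * (D n x)\<^sup>2) \<partial>lborel)"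
    by (rule nn_integral_suminf) measurable
  also have "\<dots> \<le> (\<Sum>n. ennreal (B * (1/2) ^ n))"
  proof (intro suminf_le allI)
    fix n
    have "(\<integral>\<^sup>+x. ennreal (2 ^ n * (D n x)\<^sup>2) \<partial>lborel) = ennreal (2 ^ n) * (\<integral>\<^sup>+x. ennreal ((D n x)\<^sup>2) \<partial>lborel)"
      by (subst nn_integral_cmult[symmetric]) (auto simp: ennreal_mult)
    also have "\<dots> \<le> ennreal (2 ^ n) * ennreal (B * (1/4) ^ n)"
      unfolding D_def by (intro mult_left_mono le) auto
    also have "\<dots> = ennreal (2 ^ n * (B * (1/4) ^ n))" using B by (simp add: ennreal_mult)
    also have "2 ^ n * (B * (1/4) ^ n) = B * (1/2) ^ n"
      by (simp only: mult.left_commute[of _ B] power_mult_distrib[symmetric]) simp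
    finally show "(\<integral>\<^sup>+x. ennreal (2 ^ n * (D n x)\<^sup>2) \<partial>lborel) \<le> ennreal (B * (1/2) ^ n)" .
  qed auto
  also have "\<dots> = ennreal (\<Sum>n. B * (1/2) ^ n)"
    using B by (intro suminf_ennreal2) (auto intro!: summable_mult summable_geometric)
  finally have "(\<integral>\<^sup>+x. (\<Sum>n. ennreal (2 ^ n * (D n x)\<^sup>2)) \<partial>lborel) \<noteq> \<infinity>"
    by (auto simp: top_unique)
  then have "AE x in lborel. (\<Sum>n. ennreal (2 ^ n * (D n x)\<^sup>2)) \<noteq> \<infinity>"
    by (intro nn_integral_PInf_AE) auto
  then show ?thesis
  proof eventually_elim
    case (elim x)
    then have "summable (\<lambda>n. 2 ^ n * (D n x)\<^sup>2)"
      by (intro summable_suminf_not_top) auto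
    then have "summable (\<lambda>n. (2 ^ n * (D n x)\<^sup>2 + (1/2) ^ n))"
      by (intro summable_add summable_geometric) auto
    then have "summable (\<lambda>n. D n x)"
    proof (rule summable_comparison_test[rotated], intro exI allI impI)
      fix n
      have "0 \<le> 2 ^ n * (\<bar>D n x\<bar> - (1/2) ^ n)\<^sup>2" by simp
      also have "\<dots> = 2 ^ n * (D n x)\<^sup>2 - 2 * \<bar>D n x\<bar> * (2 ^ n * (1/2) ^ n) + (2 ^ n * (1/2) ^ n) * (1/2) ^ n"
        by (simp add: power2_diff algebra_simps power2_eq_square)
      also have "(2::real) ^ n * (1/2) ^ n = 1" by (simp flip: power_mult_distrib)
      finally show "norm (D n x) \<le> 2 ^ n * (D n x)\<^sup>2 + (1/2) ^ n" by simp
    qed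
    then have "(\<lambda>n. \<Sum>i<n. D i x) \<longlonglongrightarrow> (\<Sum>n. D n x)" by (rule summable_LIMSEQ)
    then have "(\<lambda>n. v 0 x + (\<Sum>i<n. D i x)) \<longlonglongrightarrow> v 0 x + (\<Sum>n. D n x)" by (intro tendsto_intros)
    moreover have "v 0 x + (\<Sum>i<n. D i x) = v n x" for n
      unfolding D_def by (subst sum_lessThan_telescope) simp
    ultimately show ?case by (auto simp: convergent_def)
  qed
qed

lemma Hs_of_nn_integral:
  assumes [measurable]: "u \<in> borel_measurable borel"
    and "(\<integral>\<^sup>+x. ennreal ((u x)\<^sup>2) \<partial>lborel) < \<infinity>"
    and "(\<integral>\<^sup>+p. ennreal ((incr u p)\<^sup>2 * pair_kernel s p) \<partial>lborel2) < \<infinity>"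
  shows "u \<in> Hs s"
  using assms unfolding Hs_def by (auto simp: integrable_iff_bounded)

lemma gagliardo_cmult_right: "gagliardo s w (\<lambda>x. c * u x) = c * gagliardo s w u"
  using gagliardo_cmult_left[of s c u w] by (simp only: gagliardo_commute[of s w])

text \<open>Minimises \<open>J w = E(w, w) - 2 L w\<close>. A minimising sequence with defect
  \<open>4^(-n)\<close> is Cauchy by the parallelogram law and converges almost everywhere; Fatou
  puts the limit in the space, with an energy distance of order \<open>4^(-n)\<close>. The
  Euler-Lagrange equation holds for \<open>v n\<close> up to an error of order \<open>2^(-n)\<close>
  and survives in the limit.\<close>

lemma weak_solution_exists:
  fixes \<Omega> :: "'a::euclidean_space set"
  assumes s: "0 < s" and \<Omega>[measurable]: "\<Omega> \<in> sets borel" and fin: "emeasure lborel \<Omega> < \<infinity>"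
    and g[measurable]: "g \<in> borel_measurable borel" and gM: "\<And>x. \<bar>g x\<bar> \<le> M" and g0: "\<And>x. x \<notin> \<Omega> \<Longrightarrow> g x = 0"
  obtains v where "v \<in> H0 s \<Omega>" "\<And>w. w \<in> H0 s \<Omega> \<Longrightarrow> gagliardo s v w = (LINT x|lborel. g x * w x)"
proof -
  obtain C1 where C1: "C1 > 0"
    and FK: "\<And>A w. A \<in> sets borel \<Longrightarrow> emeasure lborel (A :: 'a set) < \<infinity> \<Longrightarrow> w \<in> Hs s \<Longrightarrow>
      AE x in lborel. x \<notin> A \<longrightarrow> w x = 0 \<Longrightarrow>
      (LINT x|lborel. (w x)\<^sup>2) \<le> C1 * measure lborel A powr (2 * s / real DIM('a)) * gagliardo s w w"
    by (rule faber_krahn[OF s, where 'a='a]) (rule that)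
  \<comment> \<open>The summand 1 keeps the constant positive when \<open>\<Omega>\<close> is a null
    set; it is divided by below.\<close>
  define Cp where "Cp = C1 * measure lborel \<Omega> powr (2 * s / real DIM('a)) + 1"
  have Cp: "Cp > 0" using C1 unfolding Cp_def by (intro add_nonneg_pos) auto
  have poincare: "(LINT x|lborel. (w x)\<^sup>2) \<le> Cp * gagliardo s w w" if "w \<in> H0 s \<Omega>" for w
  proof -
    have "(LINT x|lborel. (w x)\<^sup>2) \<le> C1 * measure lborel \<Omega> powr (2 * s / real DIM('a)) * gagliardo s w w"
      using that by (intro FK \<Omega> fin) (auto simp: H0_def)
    also have "\<dots> \<le> Cp * gagliardo s w w"
      by (intro mult_right_mono gagliardo_nonneg) (simp add: Cp_def)
    finally show ?thesis .
  qed
  have g2: "integrable lborel (\<lambda>x. (g x)\<^sup>2)"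
  proof (rule Bochner_Integration.integrable_bound)
    show "integrable lborel (\<lambda>x. M\<^sup>2 * indicator \<Omega> x :: real)"
      using fin by (simp add: integrable_indicator_iff)
    have "(g x)\<^sup>2 \<le> M\<^sup>2" for x using gM[of x] by (simp add: abs_le_square_iff[symmetric])
    then show "AE x in lborel. norm ((g x)\<^sup>2) \<le> norm (M\<^sup>2 * indicator \<Omega> x :: real)"
      using g0 by (auto simp: indicator_def)
  qed measurable
  define L where "L w = (LINT x|lborel. g x * w x)" for w
  have gint: "integrable lborel (\<lambda>x. g x * w x)" if "w \<in> Hs s" for w
    using that g2 by (intro integrable_mult_squares) (auto dest: Hs_integrable_square Hs_measurable)
  define J where "J w = gagliardo s w w - 2 * L w" for w
  have J_add: "J (\<lambda>x. v x + t * w x) = J v + 2 * t * (gagliardo s v w - L w) + t\<^sup>2 * gagliardo s w w"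
    if "v \<in> Hs s" "w \<in> Hs s" for v w t
  proof -
    have "L (\<lambda>x. v x + t * w x) = L v + t * L w"
      using gint[OF that(1)] gint[OF that(2)] unfolding L_def
      by (simp add: distrib_left mult.left_commute[of _ t])
    then show ?thesis using gagliardo_square[OF that, of t] by (simp add: J_def algebra_simps)
  qed
  have J_bound: "- Cp * (LINT x|lborel. (g x)\<^sup>2) \<le> J w" if w: "w \<in> H0 s \<Omega>" for w
  proof -
    \<comment> \<open>Young's inequality with weight \<open>Cp\<close>: the Poincare inequality then
      absorbs the quadratic term in \<open>w\<close> into the energy exactly.\<close>
    have "2 * L w = (LINT x|lborel. 2 * (g x * w x))" by (simp add: L_def)
    also have "\<dots> \<le> (LINT x|lborel. Cp * (g x)\<^sup>2 + (w x)\<^sup>2 / Cp)"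
    proof (rule integral_mono)
      show "integrable lborel (\<lambda>x. 2 * (g x * w x))" using gint w by (auto dest: H0_Hs)
      show "integrable lborel (\<lambda>x. Cp * (g x)\<^sup>2 + (w x)\<^sup>2 / Cp)"
        using g2 w by (auto intro!: Hs_integrable_square H0_Hs)
      have "0 \<le> (Cp * g x - w x)\<^sup>2 / Cp" for x using Cp by simp
      then show "2 * (g x * w x) \<le> Cp * (g x)\<^sup>2 + (w x)\<^sup>2 / Cp" for x
        using Cp by (simp add: power2_diff field_simps power2_eq_square)
    qed
    also have "\<dots> = Cp * (LINT x|lborel. (g x)\<^sup>2) + (LINT x|lborel. (w x)\<^sup>2) / Cp"
      using g2 w by (subst Bochner_Integration.integral_add) (auto intro!: Hs_integrable_square H0_Hs)
    also have "(LINT x|lborel. (w x)\<^sup>2) / Cp \<le> gagliardo s w w"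
      using poincare[OF w] Cp by (simp add: field_simps)
    finally show ?thesis by (simp add: J_def)
  qed
  define m where "m = Inf (J ` H0 s \<Omega>)"
  have zero_mem: "(\<lambda>x. 0) \<in> H0 s \<Omega>" by (simp add: H0_def)
  have bdd: "bdd_below (J ` H0 s \<Omega>)" using J_bound by (intro bdd_belowI2) auto
  have m_le: "m \<le> J w" if "w \<in> H0 s \<Omega>" for w
    unfolding m_def using that by (intro cInf_lower bdd) auto
  define e where "e n = (1/4 :: real) ^ n" for n :: nat
  have e: "e n > 0" for n by (simp add: e_def)
  have e_mono: "e j \<le> e n" if "n \<le> j" for n j
    unfolding e_def using that by (intro power_decreasing) auto
  have "\<exists>v\<in>H0 s \<Omega>. J v < m + e n" for n
  proof -
    have "Inf (J ` H0 s \<Omega>) < m + e n" using e by (simp add: m_def)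
    then show ?thesis using zero_mem by (subst (asm) cInf_less_iff[OF _ bdd]) auto
  qed
  then obtain v where v: "\<And>n. v n \<in> H0 s \<Omega>" and Jv: "\<And>n. J (v n) < m + e n" by metis
  note vH = H0_Hs[OF v]
  note [measurable] = Hs_measurable[OF vH]
  have cauchy: "gagliardo s (\<lambda>x. v i x - v j x) (\<lambda>x. v i x - v j x) \<le> 2 * e i + 2 * e j" for i j
  proof -
    \<comment> \<open>The midpoint is admissible, so \<open>J\<close> is at least \<open>m\<close>
      there, while at both ends it is nearly \<open>m\<close>: the energy of the difference can only
      be small. The factor \<open>1 *\<close> is \<open>t = 1\<close> in the expansion of the form
      along \<open>u + t v\<close>.\<close>
    have "m \<le> J (\<lambda>x. (1/2) * (v i x + 1 * v j x))" by (intro m_le H0_cmult H0_add) (auto intro: v)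
    also have "\<dots> = (1/4) * gagliardo s (\<lambda>x. v i x + 1 * v j x) (\<lambda>x. v i x + 1 * v j x) - L (\<lambda>x. v i x + 1 * v j x)"
    proof -
      have LL: "L (\<lambda>x. (1/2) * U x) = (1/2) * L U" for U
        unfolding L_def by (simp only: mult.left_commute[of _ "1/2"] integral_mult_right_zero)
      show ?thesis unfolding J_def gagliardo_cmult_left gagliardo_cmult_right LL by linarith
    qed
    also have "L (\<lambda>x. v i x + 1 * v j x) = L (v i) + L (v j)"
      using gint[OF vH] by (simp add: L_def distrib_left)
    finally have "4 * m \<le> gagliardo s (\<lambda>x. v i x + 1 * v j x) (\<lambda>x. v i x + 1 * v j x) - 4 * L (v i) - 4 * L (v j)"
      by simp
    then show ?thesis
      using gagliardo_square[OF vH[of i] vH[of j], of 1] gagliardo_square[OF vH[of i] vH[of j], of "-1"] Jv[of i] Jv[of j]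
      by (simp add: J_def)
  qed
  have L2: "(LINT x|lborel. (v i x - v j x)\<^sup>2) \<le> Cp * (2 * e i + 2 * e j)" for i j
    using Cp by (intro order_trans[OF poincare[OF H0_diff[OF v v]]] mult_left_mono cauchy) simp
  have L2n: "(\<integral>\<^sup>+x. ennreal ((v i x - v j x)\<^sup>2) \<partial>lborel) \<le> ennreal (Cp * (2 * e i + 2 * e j))" for i j
    by (subst nn_integral_eq_integral) (auto intro!: ennreal_leI L2 Hs_integrable_square Hs_diff vH)
  have conv: "AE x in lborel. convergent (\<lambda>n. v n x)"
  proof (rule AE_convergent_of_fast_L2[where B = "Cp * 4"])
    fix n
    have "Cp * (2 * e (Suc n) + 2 * e n) \<le> Cp * 4 * (1/4) ^ n"
      using Cp by (simp add: e_def)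
    then show "(\<integral>\<^sup>+x. ennreal ((v (Suc n) x - v n x)\<^sup>2) \<partial>lborel) \<le> ennreal (Cp * 4 * (1/4) ^ n)"
      by (intro order_trans[OF L2n] ennreal_leI)
  qed (use Cp in auto)
  define u where "u x = lim (\<lambda>n. v n x)" for x
  have [measurable]: "u \<in> borel_measurable borel"
    unfolding u_def by (intro borel_measurable_lim_metric) measurable
  have lim: "AE x in lborel. (\<lambda>n. v n x) \<longlonglongrightarrow> u x"
    using conv by eventually_elim (simp add: u_def convergent_LIMSEQ_iff)
  have close: "(\<lambda>x. u x - v n x) \<in> Hs s \<and> gagliardo s (\<lambda>x. u x - v n x) (\<lambda>x. u x - v n x) \<le> 4 * e n" for n
  proof -
    have 1: "(\<integral>\<^sup>+x. ennreal ((u x - v n x)\<^sup>2) \<partial>lborel) \<le> ennreal (Cp * (4 * e n))"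
    proof (rule nn_integral_fatou_bound)
      show "AE x in lborel. (\<lambda>j. (v j x - v n x)\<^sup>2) \<longlonglongrightarrow> (u x - v n x)\<^sup>2"
        using lim by eventually_elim (intro tendsto_intros)
      show "(\<integral>\<^sup>+x. ennreal ((v j x - v n x)\<^sup>2) \<partial>lborel) \<le> ennreal (Cp * (4 * e n))" if "n \<le> j" for j
        using Cp e_mono[OF that] by (intro order_trans[OF L2n] ennreal_leI mult_left_mono) auto
    qed measurable
    have 2: "(\<integral>\<^sup>+p. ennreal ((incr (\<lambda>x. u x - v n x) p)\<^sup>2 * pair_kernel s p) \<partial>lborel2) \<le> ennreal (4 * e n)"
    proof (rule nn_integral_fatou_bound)
      show "AE p in lborel2. (\<lambda>j. (incr (\<lambda>x. v j x - v n x) p)\<^sup>2 * pair_kernel s p) \<longlonglongrightarrow>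
          (incr (\<lambda>x. u x - v n x) p)\<^sup>2 * pair_kernel s p"
        using AE_lborel2_fst[OF lim] AE_lborel2_snd[OF lim] unfolding incr_def
        by eventually_elim (intro tendsto_intros)
      show "(\<integral>\<^sup>+p. ennreal ((incr (\<lambda>x. v j x - v n x) p)\<^sup>2 * pair_kernel s p) \<partial>lborel2) \<le> ennreal (4 * e n)" 
        if "n \<le> j" for j
      proof -
        have "(\<integral>\<^sup>+p. ennreal ((incr (\<lambda>x. v j x - v n x) p)\<^sup>2 * pair_kernel s p) \<partial>lborel2)
          = ennreal (gagliardo s (\<lambda>x. v j x - v n x) (\<lambda>x. v j x - v n x))"
          unfolding gagliardo_def power2_eq_square[symmetric]
          by (intro nn_integral_eq_integral Hs_integrable_energy Hs_diff vH) auto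
        also have "\<dots> \<le> ennreal (4 * e n)"
          using cauchy[of j n] e_mono[OF that] by (intro ennreal_leI) simp
        finally show ?thesis .
      qed
    qed measurable
    have H: "(\<lambda>x. u x - v n x) \<in> Hs s"
    proof (rule Hs_of_nn_integral)
      show "(\<integral>\<^sup>+x. ennreal ((u x - v n x)\<^sup>2) \<partial>lborel) < \<infinity>" using 1 by (rule le_less_trans) simp
      show "(\<integral>\<^sup>+p. ennreal ((incr (\<lambda>x. u x - v n x) p)\<^sup>2 * pair_kernel s p) \<partial>lborel2) < \<infinity>"
        using 2 by (rule le_less_trans) simp
    qed measurable
    have "ennreal (gagliardo s (\<lambda>x. u x - v n x) (\<lambda>x. u x - v n x)) \<le> ennreal (4 * e n)"
      using 2 unfolding gagliardo_def power2_eq_square[symmetric]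
      by (subst (asm) nn_integral_eq_integral) (auto intro!: Hs_integrable_energy H)
    then show ?thesis using H e[of n] by (simp add: ennreal_le_iff)
  qed
  have "(\<lambda>x. (u x - v 0 x) + v 0 x) \<in> Hs s" using close[of 0] by (intro Hs_add vH) auto
  then have uHs: "u \<in> Hs s" by simp
  have "AE x in lborel. \<forall>n. x \<notin> \<Omega> \<longrightarrow> v n x = 0"
    unfolding AE_all_countable using H0_zero[OF v] by auto
  with lim have "AE x in lborel. x \<notin> \<Omega> \<longrightarrow> u x = 0"
  proof eventually_elim
    case (elim x) then show ?case by (auto simp: LIMSEQ_const_iff)
  qed
  with uHs have u: "u \<in> H0 s \<Omega>" by (simp add: H0_def)
  have "gagliardo s u w = L w" if w: "w \<in> H0 s \<Omega>" for w
  proof -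
    note wH = H0_Hs[OF w]
    define G where "G = gagliardo s w w"
    have bound: "\<bar>gagliardo s u w - L w\<bar> \<le> (5 + 2 * G) / 2 * (1/2) ^ n" for n
    proof -
      \<comment> \<open>The square root of the defect \<open>e n\<close>. Perturbing by
        \<open>t * w\<close> and \<open>- t * w\<close> changes the quadratic part by order
        \<open>t\<^sup>2\<close>, which balances the defect and leaves a first variation of order
        \<open>t\<close>.\<close>
      define t where "t = (1/2 :: real) ^ n"
      have t: "t > 0" "t\<^sup>2 = e n" by (auto simp: t_def e_def power2_eq_square simp flip: power_mult_distrib)
      have "m \<le> J (\<lambda>x. v n x + r * w x)" for r by (intro m_le H0_add H0_cmult v w)
      from this[of t] this[of "-t"] have A: "2 * t * \<bar>gagliardo s (v n) w - L w\<bar> \<le> t\<^sup>2 * (1 + G)"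
        using Jv[of n] t unfolding J_add[OF vH wH] G_def by (auto simp: abs_if algebra_simps)
      define a where "a = (\<lambda>x. u x - v n x)"
      have aH: "a \<in> Hs s" and ga: "gagliardo s a a \<le> 4 * t\<^sup>2" using close[of n] t by (auto simp: a_def)
      have "0 \<le> gagliardo s a a + 2 * r * gagliardo s a w + r\<^sup>2 * G" for r
        using gagliardo_nonneg[of s "\<lambda>x. a x + r * w x"] gagliardo_square[OF aH wH, of r] by (simp add: G_def)
      from this[of t] this[of "-t"] have B: "2 * t * \<bar>gagliardo s a w\<bar> \<le> t\<^sup>2 * (4 + G)"
        using ga t by (auto simp: abs_if algebra_simps)
      have "gagliardo s a w = gagliardo s u w - gagliardo s (v n) w"
        unfolding a_def by (intro gagliardo_diff_left uHs vH wH)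
      then have "2 * t * \<bar>gagliardo s u w - L w\<bar> \<le> 2 * t * (\<bar>gagliardo s a w\<bar> + \<bar>gagliardo s (v n) w - L w\<bar>)"
        using t by (intro mult_left_mono) auto
      also have "\<dots> \<le> 2 * t * ((5 + 2 * G) / 2 * t)"
        using A B by (simp add: algebra_simps power2_eq_square)
      finally show ?thesis using t unfolding t_def by simp
    qed
    have "(\<lambda>n. (5 + 2 * G) / 2 * (1/2) ^ n) \<longlonglongrightarrow> (5 + 2 * G) / 2 * 0"
      by (intro tendsto_intros LIMSEQ_realpow_zero) auto
    then have "\<bar>gagliardo s u w - L w\<bar> \<le> (5 + 2 * G) / 2 * 0"
      by (rule LIMSEQ_le_const) (use bound in auto)
    then show ?thesis by simp
  qed
  then show ?thesis using that[OF u] by (simp add: L_def)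
qed

section \<open>A barrier argument at the frontier\<close>

section \<open>A semiconvex bump function\<close>

text \<open>The positive part of the paraboloid
  \<open>1 - (norm (x - z) / r)\<^sup>2\<close>.\<close>

definition bump :: "'a::euclidean_space \<Rightarrow> real \<Rightarrow> 'a \<Rightarrow> real" where
  "bump z r x = 1 - (min 1 (norm (x - z) / r))\<^sup>2"

lemma bump_measurable [measurable]: "bump z r \<in> borel_measurable borel"
  unfolding bump_def by measurable

lemma bump_bounds:
  assumes "0 < r" shows "0 \<le> bump z r x" "bump z r x \<le> 1"
proof -
  have "(min 1 (norm (x - z) / r))\<^sup>2 \<le> 1\<^sup>2" using assms by (intro power_mono) auto
  then show "0 \<le> bump z r x" by (simp add: bump_def)
qed (simp add: bump_def)

lemma bump_outside:
  assumes "0 < r" "x \<notin> ball z r" shows "bump z r x = 0"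
proof -
  have "min 1 (norm (x - z) / r) = 1"
    using assms by (simp add: dist_norm norm_minus_commute min_def field_simps)
  then show ?thesis by (simp add: bump_def)
qed

lemma bump_ge_three_quarters:
  assumes "0 < r" "x \<in> ball z (r / 2)" shows "3 / 4 \<le> bump z r x"
proof -
  have "(min 1 (norm (x - z) / r))\<^sup>2 \<le> (1 / 2)\<^sup>2"
    using assms by (intro power_mono) (auto simp: dist_norm norm_minus_commute min_le_iff_disj field_simps)
  then show ?thesis by (simp add: bump_def power_divide)
qed

text \<open>A difference of squares of a quantity in [0, 1] that is Lipschitz with constant
  \<open>1 / r\<close>. The truncation at 1 is kept so that the square of the bound is integrable
  against the kernel.\<close>

lemma bump_lipschitz:
  assumes r: "0 < r" shows "\<bar>bump z r x - bump z r y\<bar> \<le> 2 * min 1 (norm (x - y) / r)"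
proof -
  define m where "m u = min 1 (norm (u - z) / r)" for u
  have m: "0 \<le> m u" "m u \<le> 1" for u using r by (auto simp: m_def)
  have *: "m u \<le> m u' + norm (u - u') / r" for u u'
  proof -
    have "norm (u - z) \<le> norm (u' - z) + norm (u - u')"
      using norm_triangle_ineq[of "u' - z" "u - u'"] by simp
    then have "norm (u - z) / r \<le> norm (u' - z) / r + norm (u - u') / r"
      using r by (simp add: divide_right_mono flip: add_divide_distrib)
    moreover have "0 \<le> norm (u - u') / r" using r by simp
    ultimately show ?thesis unfolding m_def by linarith
  qed
  have "\<bar>m x - m y\<bar> \<le> norm (x - y) / r"
    using *[of x y] *[of y x] by (simp add: norm_minus_commute abs_le_iff)
  then have d: "\<bar>m x - m y\<bar> \<le> min 1 (norm (x - y) / r)" using m[of x] m[of y] by auto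
  have "bump z r x - bump z r y = - ((m x - m y) * (m x + m y))"
    by (simp add: bump_def m_def power2_eq_square algebra_simps)
  then have "\<bar>bump z r x - bump z r y\<bar> = \<bar>m x - m y\<bar> * \<bar>m x + m y\<bar>"
    by (simp add: abs_mult)
  also have "\<dots> \<le> min 1 (norm (x - y) / r) * 2"
    using m[of x] m[of y] r by (intro mult_mono d) auto
  finally show ?thesis by simp
qed

text \<open>For \<open>norm h \<ge> r\<close> the bounds 0 and 1 suffice. Off the ball the bump is 0
  at \<open>x\<close> and nonnegative at both neighbours. Inside, it equals the paraboloid at
  \<open>x\<close> and lies above it at the neighbours, and the parallelogram law computes the
  second difference of the paraboloid.\<close>

lemma bump_semiconvex:
  assumes r: "0 < r"
  shows "2 * bump z r x - bump z r (x - h) - bump z r (x + h) \<le> 2 * (min 1 (norm h / r))\<^sup>2"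
proof (cases "norm h \<ge> r")
  case True
  then have "min 1 (norm h / r) = 1" using r by (simp add: min_def field_simps)
  then show ?thesis
    using bump_bounds[OF r, of z x] bump_bounds[OF r, of z "x - h"] bump_bounds[OF r, of z "x + h"] by simp
next
  case False
  have ge: "1 - (norm (u - z))\<^sup>2 / r\<^sup>2 \<le> bump z r u" for u
  proof -
    have "(min 1 (norm (u - z) / r))\<^sup>2 \<le> (norm (u - z) / r)\<^sup>2" using r by (intro power_mono) auto
    then show ?thesis by (simp add: bump_def power_divide)
  qed
  have h: "min 1 (norm h / r) = norm h / r" using False r by (simp add: min_def field_simps)
  show ?thesis
  proof (cases "x \<in> ball z r")
    case False
    then show ?thesis
      using bump_outside[OF r False] bump_bounds(1)[OF r, of z "x - h"] bump_bounds(1)[OF r, of z "x + h"]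
      by (smt (verit) zero_le_power2)
  next
    case True
    then have "min 1 (norm (x - z) / r) = norm (x - z) / r"
      using r by (simp add: dist_norm norm_minus_commute min_def field_simps)
    then have "2 * bump z r x - bump z r (x - h) - bump z r (x + h)
      \<le> ((norm (x - h - z))\<^sup>2 + (norm (x + h - z))\<^sup>2 - 2 * (norm (x - z))\<^sup>2) / r\<^sup>2"
      using ge[of "x - h"] ge[of "x + h"]
      by (simp add: bump_def[of z r x] power_divide add_divide_distrib diff_divide_distrib)
    also have "(norm (x - h - z))\<^sup>2 + (norm (x + h - z))\<^sup>2 - 2 * (norm (x - z))\<^sup>2 = 2 * (norm h)\<^sup>2"
      by (simp add: power2_norm_eq_inner inner_diff inner_add inner_commute algebra_simps)
    finally show ?thesis by (simp add: h power_divide)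
  qed
qed

text \<open>Increments vanish unless one of the two points is in the ball. The energy is therefore
  at most twice the volume of the ball times the truncated kernel integral, up to the factor
  4.\<close>

lemma bump_Hs:
  assumes s: "0 < s" "s < 1" and r: "0 < r"
  shows "bump (z::'a::euclidean_space) r \<in> Hs s"
proof (rule Hs_of_nn_integral)
  obtain C where C: "0 < C" and CK: "\<And>r. 0 < r \<Longrightarrow>
      (\<integral>\<^sup>+h. ennreal ((min 1 (norm h / r))\<^sup>2 * frac_kernel s (h::'a)) \<partial>lborel) \<le> ennreal (C * r powr (- 2 * s))"
    by (rule frac_kernel_truncated_integral[OF s, where 'a='a]) (rule that)
  let ?B = "ball z r"
  have fin: "emeasure lborel ?B < \<infinity>" using r by (simp add: emeasure_ball)
  show "(\<integral>\<^sup>+x. ennreal ((bump z r x)\<^sup>2) \<partial>lborel) < \<infinity>"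
  proof -
    have "(\<integral>\<^sup>+x. ennreal ((bump z r x)\<^sup>2) \<partial>lborel) \<le> (\<integral>\<^sup>+x. indicator ?B x \<partial>lborel)"
    proof (rule nn_integral_mono)
      fix x show "ennreal ((bump z r x)\<^sup>2) \<le> indicator ?B x"
        using bump_bounds[OF r, of z x] bump_outside[OF r, of x z]
        by (cases "x \<in> ?B") (auto simp: ennreal_le_1 power_le_one)
    qed
    also have "\<dots> < \<infinity>" using fin by simp
    finally show ?thesis .
  qed
  define k where "k h = ennreal (4 * ((min 1 (norm h / r))\<^sup>2 * frac_kernel s h))" for h :: 'a
  have [measurable]: "k \<in> borel_measurable borel" unfolding k_def by measurable
  have [measurable]: "?B \<in> sets borel" by simp
  have [measurable]: "(\<lambda>p. k (fst p - snd p)) \<in> borel_measurable lborel2"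
    by (rule measurable_compose[of _ _ borel]) measurable
  have kfin: "(\<integral>\<^sup>+h. k h \<partial>lborel) < \<infinity>"
  proof -
    have "(\<integral>\<^sup>+h. k h \<partial>lborel) = 4 * (\<integral>\<^sup>+h. ennreal ((min 1 (norm h / r))\<^sup>2 * frac_kernel s (h::'a)) \<partial>lborel)"
      unfolding k_def by (subst nn_integral_cmult[symmetric]) (auto simp: ennreal_mult)
    also have "\<dots> \<le> 4 * ennreal (C * r powr (- 2 * s))" by (intro mult_left_mono CK r) auto
    also have "\<dots> < \<infinity>" by (simp add: ennreal_mult_less_top)
    finally show ?thesis .
  qed
  have ktr: "(\<integral>\<^sup>+x. k (x - y) \<partial>lborel) = (\<integral>\<^sup>+h. k h \<partial>lborel)" for y
    using nn_integral_lborel_translate[of k "- y"] by simp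
  have ksym: "k (x - y) = k (y - x)" for x y
    by (simp add: k_def norm_minus_commute[of x y] frac_kernel_commute[of s x y])
  have "(\<integral>\<^sup>+p. ennreal ((incr (bump z r) p)\<^sup>2 * pair_kernel s p) \<partial>lborel2)
    \<le> (\<integral>\<^sup>+p. indicator ?B (fst p) * k (fst p - snd p) + indicator ?B (snd p) * k (fst p - snd p) \<partial>lborel2)"
  proof (rule nn_integral_mono)
    fix p :: "'a \<times> 'a"
    obtain x y where p: "p = (x, y)" by fastforce
    show "ennreal ((incr (bump z r) p)\<^sup>2 * pair_kernel s p)
      \<le> indicator ?B (fst p) * k (fst p - snd p) + indicator ?B (snd p) * k (fst p - snd p)"
    proof (cases "x \<in> ?B \<or> y \<in> ?B")
      case True
      have "(bump z r x - bump z r y)\<^sup>2 \<le> (2 * min 1 (norm (x - y) / r))\<^sup>2"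
        using bump_lipschitz[OF r, of z x y] r by (subst power2_le_iff_abs_le) auto
      then have "(bump z r x - bump z r y)\<^sup>2 * frac_kernel s (x - y)
          \<le> (2 * min 1 (norm (x - y) / r))\<^sup>2 * frac_kernel s (x - y)"
        by (intro mult_right_mono) auto
      then have "ennreal ((bump z r x - bump z r y)\<^sup>2 * frac_kernel s (x - y)) \<le> k (x - y)"
        unfolding k_def by (intro ennreal_leI) (simp add: power_mult_distrib)
      also have "\<dots> \<le> indicator ?B x * k (x - y) + indicator ?B y * k (x - y)"
        using True by (auto simp: indicator_def)
      finally show ?thesis by (simp add: p incr_def pair_kernel_def)
    next
      case False
      then have "bump z r x = 0" "bump z r y = 0" using bump_outside[OF r] by blast+
      then show ?thesis by (simp add: p incr_def)
    qed
  qed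
  also have "\<dots> = (\<integral>\<^sup>+p. indicator ?B (fst p) * k (fst p - snd p) \<partial>lborel2)
      + (\<integral>\<^sup>+p. indicator ?B (snd p) * k (fst p - snd p) \<partial>lborel2)"
    by (rule nn_integral_add) measurable
  also have "(\<integral>\<^sup>+p. indicator ?B (fst p) * k (fst p - snd p) \<partial>lborel2)
      = (\<integral>\<^sup>+x. \<integral>\<^sup>+y. indicator ?B x * k (y - x) \<partial>lborel \<partial>lborel)"
    by (subst lborel.nn_integral_fst[symmetric]) (auto simp: ksym)
  also have "\<dots> = emeasure lborel ?B * (\<integral>\<^sup>+h. k h \<partial>lborel)"
    by (simp add: nn_integral_cmult nn_integral_multc ktr)
  also have "(\<integral>\<^sup>+p. indicator ?B (snd p) * k (fst p - snd p) \<partial>lborel2)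
      = (\<integral>\<^sup>+y. \<integral>\<^sup>+x. indicator ?B y * k (x - y) \<partial>lborel \<partial>lborel)"
    by (subst lborel_pair.nn_integral_snd[symmetric]) auto
  also have "\<dots> = emeasure lborel ?B * (\<integral>\<^sup>+h. k h \<partial>lborel)"
    by (simp add: nn_integral_cmult nn_integral_multc ktr)
  also have "emeasure lborel ?B * (\<integral>\<^sup>+h. k h \<partial>lborel) + emeasure lborel ?B * (\<integral>\<^sup>+h. k h \<partial>lborel) < \<infinity>"
    using kfin fin by (simp add: ennreal_mult_less_top)
  finally show "(\<integral>\<^sup>+p. ennreal ((incr (bump z r) p)\<^sup>2 * pair_kernel s p) \<partial>lborel2) < \<infinity>" .
qed measurable

lemma integrable_mult_bounded:
  fixes f g :: "'b \<Rightarrow> real"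
  assumes g: "integrable M g" and [measurable]: "f \<in> borel_measurable M" and "\<And>x. \<bar>f x\<bar> \<le> B"
  shows "integrable M (\<lambda>x. f x * g x)"
proof (rule Bochner_Integration.integrable_bound)
  show "integrable M (\<lambda>x. B * g x)" using g by simp
  show "AE x in M. norm (f x * g x) \<le> norm (B * g x)"
    using assms(3) by (auto simp: abs_mult intro!: mult_right_mono order_trans[OF assms(3)])
qed (use borel_measurable_integrable[OF g] in measurable)

text \<open>For each fixed shift \<open>h\<close> of the kernel variable, a discrete summation by parts moves the
  second difference onto the bump. Since \<open>w \<ge> 0\<close>, only its one-sided bound is needed, so that
  the kink of the bump at the sphere does no harm.\<close>

lemma gagliardo_bump_le:
  assumes s: "0 < s" "s < 1"
  obtains C where "0 < C"
    and "\<And>(z::'a::euclidean_space) r w. 0 < r \<Longrightarrow> w \<in> Hs s \<Longrightarrow> (\<And>x. 0 \<le> w x) \<Longrightarrow> integrable lborel w \<Longrightarrow>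
      gagliardo s (bump z r) w \<le> C * r powr (- 2 * s) * (LINT x|lborel. w x)"
proof -
  obtain C where C: "0 < C" and CK: "\<And>r. 0 < r \<Longrightarrow>
      (\<integral>\<^sup>+h. ennreal ((min 1 (norm h / r))\<^sup>2 * frac_kernel s (h::'a)) \<partial>lborel) \<le> ennreal (C * r powr (- 2 * s))"
    by (rule frac_kernel_truncated_integral[OF s, where 'a='a]) (rule that)
  have main: "gagliardo s (bump z r) w \<le> (2 * C) * r powr (- 2 * s) * (LINT x|lborel. w x)"
    if r: "0 < r" and w: "w \<in> Hs s" and w0: "\<And>x. 0 \<le> w x" and wi: "integrable lborel w" for z :: 'a and r w
  proof -
    note [measurable] = Hs_measurable[OF w]
    define \<eta> where "\<eta> = bump z r"
    have \<eta>: "\<eta> \<in> Hs s" unfolding \<eta>_def by (rule bump_Hs[OF s r])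
    have [measurable]: "\<eta> \<in> borel_measurable borel" by (simp add: \<eta>_def)
    have eb: "\<bar>\<eta> x\<bar> \<le> 1" for x using bump_bounds[OF r, of z x] by (simp add: \<eta>_def)
    define W where "W = (LINT x|lborel. w x)"
    have W: "W \<ge> 0" unfolding W_def using w0 by simp
    define \<Phi> where "\<Phi> p = incr \<eta> p * incr w p * pair_kernel s p" for p
    have [measurable]: "\<Phi> \<in> borel_measurable lborel2" unfolding \<Phi>_def by measurable
    have "integrable (distr lborel2 lborel2 (\<lambda>p. (snd p + fst p, snd p))) \<Phi>"
      unfolding lborel2_shear \<Phi>_def by (rule Hs_gagliardo_integrable[OF \<eta> w])
    then have int: "integrable lborel2 (\<lambda>p. \<Phi> (snd p + fst p, snd p))"
      by (subst (asm) integrable_distr_eq) auto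
    have "gagliardo s \<eta> w = integral\<^sup>L (distr lborel2 lborel2 (\<lambda>p. (snd p + fst p, snd p))) \<Phi>"
      unfolding lborel2_shear gagliardo_def \<Phi>_def ..
    also have "\<dots> = (LINT p|lborel2. \<Phi> (snd p + fst p, snd p))"
      by (rule integral_distr) auto
    also have "\<dots> = (LINT h|lborel. LINT y|lborel. \<Phi> (y + h, y))"
      using lborel_pair.integral_fst'[OF int] by simp
    also have "\<dots> \<le> (LINT h|lborel. 2 * W * ((min 1 (norm (h::'a) / r))\<^sup>2 * frac_kernel s h))"
    proof (rule integral_mono)
      show "integrable lborel (\<lambda>h. LINT y|lborel. \<Phi> (y + h, y))"
        using lborel_pair.integrable_fst'[OF int] by simp
      have "integrable lborel (\<lambda>h::'a. (min 1 (norm h / r))\<^sup>2 * frac_kernel s h)"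
        using CK[OF r] by (intro integrableI_bounded) (auto intro: le_less_trans)
      then show "integrable lborel (\<lambda>h::'a. 2 * W * ((min 1 (norm h / r))\<^sup>2 * frac_kernel s h))" by simp
      fix h :: 'a
      have i1: "integrable lborel (\<lambda>y. \<eta> (y + a) * w (y + b))" for a b
        by (rule integrable_mult_bounded[where B=1]) (auto intro!: integrable_lborel_translate wi eb)
      have "(LINT y|lborel. \<Phi> (y + h, y)) = (LINT y|lborel. (\<eta> (y + h) - \<eta> y) * (w (y + h) - w y) * frac_kernel s h)"
        by (simp add: \<Phi>_def incr_def pair_kernel_def)
      also have "\<dots> = (LINT y|lborel. (\<eta> (y + h) - \<eta> y) * (w (y + h) - w y)) * frac_kernel s h"
        by simp
      also have "(LINT y|lborel. (\<eta> (y + h) - \<eta> y) * (w (y + h) - w y))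
          = (LINT y|lborel. \<eta> (y + h) * w (y + h) + \<eta> (y + 0) * w (y + 0) - \<eta> (y + 0) * w (y + h) - \<eta> (y + h) * w (y + 0))"
        by (simp add: algebra_simps)
      also have "\<dots> = (LINT y|lborel. \<eta> (y + h) * w (y + h)) + (LINT y|lborel. \<eta> (y + 0) * w (y + 0))
          - (LINT y|lborel. \<eta> (y + 0) * w (y + h)) - (LINT y|lborel. \<eta> (y + h) * w (y + 0))"
        using i1[of h h] i1[of 0 0] i1[of 0 h] i1[of h 0] by (simp only: Bochner_Integration.integral_diff Bochner_Integration.integral_add Bochner_Integration.integrable_add Bochner_Integration.integrable_diff)
      also have "(LINT y|lborel. \<eta> (y + h) * w (y + h)) = (LINT y|lborel. \<eta> (y + 0) * w (y + 0))"
        using integral_lborel_translate[of "\<lambda>y. \<eta> y * w y" h] by simp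
      also have "(LINT y|lborel. \<eta> (y + 0) * w (y + h)) = (LINT y|lborel. \<eta> (y + - h) * w (y + 0))"
        using integral_lborel_translate[of "\<lambda>y. \<eta> (y - h) * w y" h] by simp
      also have "(LINT y|lborel. \<eta> (y + 0) * w (y + 0)) + (LINT y|lborel. \<eta> (y + 0) * w (y + 0))
          - (LINT y|lborel. \<eta> (y + - h) * w (y + 0)) - (LINT y|lborel. \<eta> (y + h) * w (y + 0))
          = (LINT y|lborel. \<eta> (y + 0) * w (y + 0) + \<eta> (y + 0) * w (y + 0) - \<eta> (y + - h) * w (y + 0) - \<eta> (y + h) * w (y + 0))"
        using i1[of "-h" 0] i1[of 0 0] i1[of h 0] by (simp only: Bochner_Integration.integral_diff Bochner_Integration.integral_add Bochner_Integration.integrable_add Bochner_Integration.integrable_diff)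
      also have "\<dots> = (LINT y|lborel. (2 * \<eta> y - \<eta> (y - h) - \<eta> (y + h)) * w y)"
        by (simp add: algebra_simps)
      also have "\<dots> \<le> (LINT y|lborel. (2 * (min 1 (norm h / r))\<^sup>2) * w y)"
      proof (rule integral_mono)
        show "integrable lborel (\<lambda>y. (2 * \<eta> y - \<eta> (y - h) - \<eta> (y + h)) * w y)"
        proof (rule integrable_mult_bounded[where B=4])
          show "\<bar>2 * \<eta> y - \<eta> (y - h) - \<eta> (y + h)\<bar> \<le> 4" for y
            using eb[of y] eb[of "y - h"] eb[of "y + h"] by linarith
        qed (use wi in auto)
        show "integrable lborel (\<lambda>y. (2 * (min 1 (norm h / r))\<^sup>2) * w y)" using wi by simp
        show "(2 * \<eta> y - \<eta> (y - h) - \<eta> (y + h)) * w y \<le> (2 * (min 1 (norm h / r))\<^sup>2) * w y" for y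
          unfolding \<eta>_def by (intro mult_right_mono bump_semiconvex r w0)
      qed
      also have "\<dots> = 2 * (min 1 (norm h / r))\<^sup>2 * W" by (simp add: W_def)
      finally show "(LINT y|lborel. \<Phi> (y + h, y)) \<le> 2 * W * ((min 1 (norm h / r))\<^sup>2 * frac_kernel s h)"
        by (simp add: mult_right_mono mult_ac)
    qed
    also have "\<dots> = 2 * W * (LINT h|lborel. (min 1 (norm (h::'a) / r))\<^sup>2 * frac_kernel s h)" by simp
    also have "\<dots> \<le> 2 * W * (C * r powr (- 2 * s))"
    proof (intro mult_left_mono)
      have "ennreal (LINT h|lborel. (min 1 (norm (h::'a) / r))\<^sup>2 * frac_kernel s h)
          \<le> ennreal (C * r powr (- 2 * s))"
        using CK[OF r] by (subst nn_integral_eq_integral[symmetric]) 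
          (auto intro!: integrableI_bounded intro: le_less_trans)
      then show "(LINT h|lborel. (min 1 (norm (h::'a) / r))\<^sup>2 * frac_kernel s h) \<le> C * r powr (- 2 * s)"
        using C by (subst (asm) ennreal_le_iff) auto
    qed (use W in auto)
    finally show ?thesis by (simp add: \<eta>_def W_def mult_ac)
  qed
  show ?thesis by (rule that[of "2 * C"]) (use C main in auto)
qed

section \<open>Decay at the boundary\<close>

definition weak_sol :: "real \<Rightarrow> 'a::euclidean_space set \<Rightarrow> ('a \<Rightarrow> real) \<Rightarrow> ('a \<Rightarrow> real) \<Rightarrow> bool" where
  "weak_sol s \<Omega> v g \<longleftrightarrow> v \<in> H0 s \<Omega> \<and>
     (\<forall>w\<in>H0 s \<Omega>. (\<exists>B. \<forall>x. \<bar>w x\<bar> \<le> B) \<longrightarrow> gagliardo s v w = (LINT x|lborel. g x * w x))"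

text \<open>The ratio \<open>\<rho>\<close> is the same at all small scales. This uniformity makes
  the gain of each step of the boundary argument independent of the radius reached so far.\<close>

definition exterior_ball_at :: "real \<Rightarrow> 'a::euclidean_space set \<Rightarrow> 'a \<Rightarrow> bool" where
  "exterior_ball_at \<rho> \<Omega> z \<longleftrightarrow> (\<exists>r0>0. \<forall>r. 0 < r \<longrightarrow> r < r0 \<longrightarrow> (\<exists>c. ball c (\<rho> * r) \<subseteq> ball z r - \<Omega>))"

text \<open>The factor \<open>\<theta>\<close> is fixed before the set, the solution,
  \<open>\<Lambda>\<close> and \<open>r1\<close>, so that the step can be iterated; only the new
  radius depends on them. The proof shows that \<open>min (v x) \<Lambda>\<close> stays below the
  barrier \<open>\<Lambda> * (1 - \<theta> * \<eta> x)\<close>. Since the bump is at least 3/4 on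
  the half ball, the factor obtained is three quarters of the one used inside.\<close>

lemma boundary_improvement:
  assumes s: "0 < s" "s < 1" and \<rho>: "0 < \<rho>"
  obtains \<theta> where "0 < \<theta>" "\<theta> < 1"
    and "\<And>\<Omega> (z::'a::euclidean_space) v f M B \<Lambda> r1. \<Omega> \<in> sets borel \<Longrightarrow> emeasure lborel \<Omega> < \<infinity> \<Longrightarrow> exterior_ball_at \<rho> \<Omega> z \<Longrightarrow>
      weak_sol s \<Omega> v f \<Longrightarrow> f \<in> borel_measurable borel \<Longrightarrow> (\<And>x. \<bar>f x\<bar> \<le> M) \<Longrightarrow> (AE x in lborel. v x \<le> B) \<Longrightarrow>
      0 < \<Lambda> \<Longrightarrow> 0 < r1 \<Longrightarrow> (AE x in lborel. x \<in> ball z r1 \<longrightarrow> v x \<le> \<Lambda>) \<Longrightarrow>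
      \<exists>r>0. AE x in lborel. x \<in> ball z r \<longrightarrow> v x \<le> \<Lambda> * (1 - \<theta>)"
proof -
  let ?N = "real DIM('a)" and ?\<omega> = "unit_ball_vol (real DIM('a))"
  define a where "a = ?N + 2 * s"
  obtain C where C: "0 < C" and Cb: "\<And>(z::'a) r w. 0 < r \<Longrightarrow> w \<in> Hs s \<Longrightarrow> (\<And>x. 0 \<le> w x) \<Longrightarrow> integrable lborel w \<Longrightarrow>
      gagliardo s (bump z r) w \<le> C * r powr (- 2 * s) * (LINT x|lborel. w x)"
    by (rule gagliardo_bump_le[OF s, where 'a='a]) (rule that; blast)
  \<comment> \<open>Volume of the missing ball of radius \<open>\<rho> * r\<close> times the kernel
    at distance \<open>2 * r\<close>, with the scale \<open>r powr (- 2 * s)\<close> split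
    off.\<close>
  define \<kappa> where "\<kappa> = ?\<omega> * \<rho> powr ?N * 2 powr (- a)"
  have \<kappa>: "\<kappa> > 0" unfolding \<kappa>_def using \<rho> by (intro mult_pos_pos) auto
  \<comment> \<open>The second bound gives \<open>\<theta> * C \<le> \<kappa> / 2\<close>, so that
    the energy of the bump consumes at most half of the gain; the bound 1/2 gives
    \<open>2 * (1 - \<theta>) \<ge> 1\<close>.\<close>
  define \<theta> where "\<theta> = min (1/2) (\<kappa> / (2 * C))"
  have \<theta>: "0 < \<theta>" "\<theta> \<le> 1/2" using \<kappa> C by (auto simp: \<theta>_def)
  have \<theta>C: "\<theta> * C \<le> \<kappa> / 2" using C by (simp add: \<theta>_def min_def field_simps)
  have main: "\<exists>r>0. AE x in lborel. x \<in> ball z r \<longrightarrow> v x \<le> \<Lambda> * (1 - 3 * \<theta> / 4)"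
    if \<Omega>[measurable]: "\<Omega> \<in> sets borel" and fin: "emeasure lborel \<Omega> < \<infinity>" and ext: "exterior_ball_at \<rho> \<Omega> z"
      and sol: "weak_sol s \<Omega> v f" and [measurable]: "f \<in> borel_measurable borel" and fM: "\<And>x. \<bar>f x\<bar> \<le> M"
      and vB': "AE x in lborel. v x \<le> B'" and \<Lambda>: "0 < \<Lambda>" and r1: "0 < r1"
      and near: "AE x in lborel. x \<in> ball z r1 \<longrightarrow> v x \<le> \<Lambda>" for \<Omega> and z :: 'a and v f M B' \<Lambda> r1
  proof -
    define B where "B = max B' 0"
    have B: "B \<ge> 0" and vB: "AE x in lborel. v x \<le> B" using vB' by (auto simp: B_def)
    have v: "v \<in> Hs s" and vz: "AE x in lborel. x \<notin> \<Omega> \<longrightarrow> v x = 0"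
      using sol by (auto simp: weak_sol_def H0_def)
    note [measurable] = Hs_measurable[OF v]
    obtain r0 where r0: "r0 > 0" and ball: "\<And>r. 0 < r \<Longrightarrow> r < r0 \<Longrightarrow> \<exists>c. ball c (\<rho> * r) \<subseteq> ball z r - \<Omega>"
      using ext by (auto simp: exterior_ball_at_def)
    define \<kappa>2 where "\<kappa>2 = B * (r1 / 2) powr (- a)"
    have \<kappa>2: "\<kappa>2 \<ge> 0" using B by (simp add: \<kappa>2_def)
    define T where "T = \<bar>M\<bar> + 2 * \<kappa>2 * measure lborel \<Omega>"
    have T: "T \<ge> 0" using \<kappa>2 by (simp add: T_def)
    \<comment> \<open>With \<open>q \<le> r powr (- 2 * s)\<close>, half of the gain is at least
      \<open>T + 1\<close>, where \<open>T\<close> collects the datum and the tail. The surplus 1 is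
      what forces the test function to vanish.\<close>
    define q where "q = 2 * (T + 1) / (\<Lambda> * \<kappa>)"
    have q: "q > 0" using T \<Lambda> \<kappa> by (simp add: q_def)
    define r where "r = min (min (r0 / 2) (r1 / 4)) (q powr (- 1 / (2 * s)))"
    have r: "0 < r" "r < r0" "r \<le> r1 / 4" "r \<le> q powr (- 1 / (2 * s))"
      using r0 r1 q by (auto simp: r_def)
    have rq: "q \<le> r powr (- 2 * s)"
    proof -
      have "q = (q powr (- 1 / (2 * s))) powr (- 2 * s)"
        using q s by (simp add: powr_powr)
      also have "\<dots> \<le> r powr (- 2 * s)" using r s by (intro powr_mono2') auto
      finally show ?thesis .
    qed
    obtain c where D: "ball c (\<rho> * r) \<subseteq> ball z r - \<Omega>" using ball[OF r(1,2)] by blast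
    define D where "D = ball c (\<rho> * r)"
    have [measurable]: "D \<in> sets borel" by (simp add: D_def)
    have Dsub: "D \<subseteq> ball z r" "D \<inter> \<Omega> = {}" using D by (auto simp: D_def)
    have Dm: "measure lborel D = ?\<omega> * (\<rho> * r) powr ?N"
      using \<rho> r by (simp add: D_def content_ball powr_realpow)
    have Dfin: "emeasure lborel D < \<infinity>" using \<rho> r by (simp add: D_def emeasure_ball)
    define \<kappa>1 where "\<kappa>1 = \<Lambda> * (1 - \<theta>) * (2 * r) powr (- a)"
    have \<kappa>1: "\<kappa>1 \<ge> 0" using \<Lambda> \<theta> by (simp add: \<kappa>1_def)
    have \<kappa>1D: "\<kappa>1 * measure lborel D = \<Lambda> * (1 - \<theta>) * \<kappa> * r powr (- 2 * s)"
    proof -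
      have "\<kappa>1 * measure lborel D = \<Lambda> * (1 - \<theta>) * \<kappa> * (r powr (- a) * r powr ?N)"
        unfolding \<kappa>1_def Dm \<kappa>_def using r \<rho> by (simp add: powr_mult mult_ac)
      also have "r powr (- a) * r powr ?N = r powr (- 2 * s)"
        by (simp add: a_def flip: powr_add)
      finally show ?thesis .
    qed
    define \<eta> where "\<eta> = bump z r"
    have \<eta>H: "\<eta> \<in> Hs s" unfolding \<eta>_def by (rule bump_Hs[OF s r(1)])
    have [measurable]: "\<eta> \<in> borel_measurable borel" by (simp add: \<eta>_def)
    have \<eta>b: "0 \<le> \<eta> x" "\<eta> x \<le> 1" for x using bump_bounds[OF r(1), of z x] by (auto simp: \<eta>_def)
    have \<eta>0: "\<eta> x = 0" if "x \<notin> ball z r" for x using bump_outside[OF r(1) that] by (simp add: \<eta>_def)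
    have \<theta>\<eta>: "\<theta> * \<Lambda> * \<eta> x \<le> \<theta> * \<Lambda>" "0 \<le> \<theta> * \<Lambda> * \<eta> x" for x
      using \<eta>b[of x] \<theta> \<Lambda> by (auto intro!: mult_left_le)
    \<comment> \<open>The excess of \<open>min (v x) \<Lambda>\<close> over the barrier; its
      positive part \<open>w\<close> is the test function. Off the ball the bump is 0 and the excess
      is nonpositive, so \<open>w\<close> is supported in \<open>ball z r\<close>.\<close>
    define \<zeta> where "\<zeta> x = min (v x) \<Lambda> - \<Lambda> + \<theta> * \<Lambda> * \<eta> x" for x
    \<comment> \<open>The part of \<open>v\<close> above \<open>\<Lambda>\<close>. It vanishes
      almost everywhere in \<open>ball z r1\<close>, so it meets the support of \<open>w\<close>
      only across a distance of at least \<open>r1 / 2\<close>: this is the tail, and it does not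
      grow as \<open>r\<close> shrinks.\<close>
    define t where "t x = max (v x - \<Lambda>) 0" for x
    define w where "w x = max 0 (\<zeta> x)" for x
    have vsplit: "v x = \<zeta> x + t x + \<Lambda> - \<theta> * \<Lambda> * \<eta> x" for x
      by (simp add: \<zeta>_def t_def min_def max_def)
    have [measurable]: "\<zeta> \<in> borel_measurable borel" "t \<in> borel_measurable borel" "w \<in> borel_measurable borel"
      unfolding \<zeta>_def t_def w_def by measurable
    have w0: "0 \<le> w x" for x by (simp add: w_def)
    have wle: "w x \<le> \<theta> * \<Lambda> * \<eta> x" for x using \<theta>\<eta>[of x] by (auto simp: w_def \<zeta>_def)
    have wH: "w \<in> Hs s"
    proof (rule Hs_dominated[OF v Hs_cmult[OF \<eta>H, of "\<theta> * \<Lambda>"]])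
      show "\<bar>w x\<bar> \<le> \<bar>v x\<bar> + \<bar>\<theta> * \<Lambda> * \<eta> x\<bar>" for x using wle[of x] w0[of x] by linarith
      show "\<bar>w x - w y\<bar> \<le> \<bar>v x - v y\<bar> + \<bar>\<theta> * \<Lambda> * \<eta> x - \<theta> * \<Lambda> * \<eta> y\<bar>" for x y
        unfolding w_def \<zeta>_def by (auto simp: min_def max_def)
    qed measurable
    have wi: "integrable lborel w"
    proof (rule Bochner_Integration.integrable_bound)
      show "integrable lborel (\<lambda>x. \<theta> * \<Lambda> * indicator (ball z r) x)"
        using r by (simp add: integrable_indicator_iff emeasure_ball)
      show "AE x in lborel. norm (w x) \<le> norm (\<theta> * \<Lambda> * indicator (ball z r) x)"
      proof (rule AE_I2)
        fix x show "norm (w x) \<le> norm (\<theta> * \<Lambda> * indicator (ball z r) x)"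
          using wle[of x] w0[of x] \<theta>\<eta>[of x] \<eta>0[of x] by (cases "x \<in> ball z r") auto
      qed
    qed measurable
    have wz: "AE x in lborel. x \<notin> \<Omega> \<longrightarrow> w x = 0"
      using vz
    proof eventually_elim
      case (elim x)
      have "\<theta> * \<Lambda> \<le> \<Lambda>" using \<theta> \<Lambda> by simp
      then have "\<theta> * \<Lambda> * \<eta> x \<le> \<Lambda>" using \<theta>\<eta>(1)[of x] by linarith
      then show ?case using elim \<Lambda> by (auto simp: w_def \<zeta>_def)
    qed
    have wH0: "w \<in> H0 s \<Omega>" using wH wz by (simp add: H0_def)
    define W where "W = (LINT x|lborel. w x)"
    have W: "W \<ge> 0" unfolding W_def using w0 by simp
    define good where "good x \<longleftrightarrow> (x \<notin> \<Omega> \<longrightarrow> v x = 0) \<and> (x \<in> ball z r1 \<longrightarrow> v x \<le> \<Lambda>) \<and> v x \<le> B" for x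
    have good: "AE x in lborel. good x" using vz near vB by eventually_elim (simp add: good_def)
    have wball: "x \<in> ball z r" if "w x \<noteq> 0" for x
      using that wle[of x] w0[of x] \<eta>0[of x] by force
    have mono\<zeta>: "0 \<le> (\<zeta> x - \<zeta> y) * (w x - w y)" for x y
      unfolding w_def by (auto simp: max_def zero_le_mult_iff)
    \<comment> \<open>Here the decay originates. On the missing ball \<open>v\<close> is 0, hence
      \<open>\<zeta>\<close> is at most \<open>- \<Lambda> * (1 - \<theta>)\<close> there, and each
      point where \<open>w\<close> is positive gains from every point of \<open>D\<close>.\<close>
    have P: "\<kappa>1 * w x \<le> (\<zeta> x - \<zeta> y) * (w x - w y) * frac_kernel s (x - y)" and wD: "w y = 0"
      if "good x" "good y" "y \<in> D" for x y
    proof -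
      have "v y = 0" using that Dsub by (auto simp: good_def)
      then have zy: "\<zeta> y \<le> - (\<Lambda> * (1 - \<theta>))"
        using \<theta>\<eta>[of y] \<Lambda> by (simp add: \<zeta>_def algebra_simps)
      moreover have "0 < \<Lambda> * (1 - \<theta>)" using \<Lambda> \<theta> by simp
      ultimately show wy: "w y = 0" by (simp add: w_def)
      show "\<kappa>1 * w x \<le> (\<zeta> x - \<zeta> y) * (w x - w y) * frac_kernel s (x - y)"
      proof (cases "w x = 0")
        case True then show ?thesis using wy by simp
      next
        case False
        then have zx: "\<zeta> x = w x" "w x > 0" by (auto simp: w_def max_def split: if_splits)
        have "norm (x - y) \<le> 2 * r"
          using wball[OF False] that(3) Dsub(1) norm_triangle_ineq4[of "x - z" "y - z"]
          by (auto simp: dist_norm norm_minus_commute subset_iff)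
        moreover have "x - y \<noteq> 0" using False wy by auto
        ultimately have K: "(2 * r) powr (- a) \<le> frac_kernel s (x - y)"
          unfolding a_def using s by (intro frac_kernel_lower) auto
        have "\<Lambda> * (1 - \<theta>) * w x \<le> (\<zeta> x - \<zeta> y) * (w x - w y)"
          using zy zx wy \<Lambda> by (simp add: mult_right_mono)
        then have "\<Lambda> * (1 - \<theta>) * w x * (2 * r) powr (- a) \<le> (\<zeta> x - \<zeta> y) * (w x - w y) * frac_kernel s (x - y)"
          by (rule mult_mono[OF _ K mono\<zeta>]) simp
        then show ?thesis by (simp add: \<kappa>1_def mult_ac)
      qed
    qed
    have Psum: "\<kappa>1 * (w x * indicator D y + indicator D x * w y) \<le> (\<zeta> x - \<zeta> y) * (w x - w y) * frac_kernel s (x - y)"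
      if "good x" "good y" for x y
    proof -
      have sym: "(\<zeta> x - \<zeta> y) * (w x - w y) * frac_kernel s (x - y) = (\<zeta> y - \<zeta> x) * (w y - w x) * frac_kernel s (y - x)"
        by (simp add: frac_kernel_commute[of s x y] algebra_simps)
      consider "y \<in> D" | "y \<notin> D" "x \<in> D" | "y \<notin> D" "x \<notin> D" by blast
      then show ?thesis
      proof cases
        case 1 then show ?thesis using P[OF that 1] wD[OF that 1] by simp
      next
        case 2 then show ?thesis using P[OF that(2,1) 2(2)] wD[OF that(2,1) 2(2)] unfolding sym by simp
      next
        case 3 then show ?thesis using mono\<zeta>[of x y] by simp
      qed
    qed
    have Q: "t y * w x * frac_kernel s (x - y) \<le> \<kappa>2 * (w x * indicator \<Omega> y)"
      if "good x" "good y" for x y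
    proof (cases "w x = 0 \<or> t y = 0")
      case True then show ?thesis using \<kappa>2 w0[of x] by (auto simp: indicator_def)
    next
      case False
      then have ty: "v y > \<Lambda>" "t y \<le> B" "0 \<le> t y" using that \<Lambda> by (auto simp: t_def max_def good_def split: if_splits)
      then have "y \<in> \<Omega>" "y \<notin> ball z r1" using that \<Lambda> by (auto simp: good_def)
      have "x \<in> ball z r" using wball False by auto
      then have "r1 / 2 \<le> norm (x - y)"
        using \<open>y \<notin> ball z r1\<close> r(3) r1 dist_triangle[of z y x] by (simp add: dist_norm)
      then have K: "frac_kernel s (x - y) \<le> (r1 / 2) powr (- a)"
        unfolding a_def using s r1 by (intro frac_kernel_upper) auto
      have "t y * frac_kernel s (x - y) * w x \<le> B * (r1 / 2) powr (- a) * w x"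
        using ty B w0 K by (intro mult_right_mono mult_mono) auto
      then show ?thesis using \<open>y \<in> \<Omega>\<close> by (simp add: \<kappa>2_def mult_ac)
    qed
    have Qsum: "- \<kappa>2 * (w x * indicator \<Omega> y + indicator \<Omega> x * w y) \<le> (t x - t y) * (w x - w y) * frac_kernel s (x - y)"
      if "good x" "good y" for x y
    proof -
      have K: "frac_kernel s (y - x) = frac_kernel s (x - y)" by (rule frac_kernel_commute)
      have "(t x - t y) * (w x - w y) * frac_kernel s (x - y) = (t x * w x + t y * w y) * frac_kernel s (x - y)
         - t y * w x * frac_kernel s (x - y) - t x * w y * frac_kernel s (x - y)"
        by (simp add: algebra_simps)
      moreover have "0 \<le> (t x * w x + t y * w y) * frac_kernel s (x - y)"
        using w0 by (simp add: t_def)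
      moreover have "- \<kappa>2 * (w x * indicator \<Omega> y + indicator \<Omega> x * w y)
          = - (\<kappa>2 * (w x * indicator \<Omega> y)) - \<kappa>2 * (w y * indicator \<Omega> x)"
        by (simp add: algebra_simps)
      ultimately show ?thesis using Q[OF that] Q[OF that(2,1), unfolded K] by linarith
    qed
    \<comment> \<open>A lower bound for the integrand of the form at \<open>v\<close> and
      \<open>w\<close> consisting of products and of the bump term, all integrated explicitly: gain
      from \<open>D\<close>, loss from the tail, loss from the bump. Both orders of each pair occur,
      hence the factors 2.\<close>
    define low where "low p = \<kappa>1 * (w (fst p) * indicator D (snd p) + indicator D (fst p) * w (snd p))
        - \<kappa>2 * (w (fst p) * indicator \<Omega> (snd p) + indicator \<Omega> (fst p) * w (snd p))
        - \<theta> * \<Lambda> * (incr \<eta> p * incr w p * pair_kernel s p)" for p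
    have iD: "integrable lborel (indicator D :: 'a \<Rightarrow> real)" and i\<Omega>: "integrable lborel (indicator \<Omega> :: 'a \<Rightarrow> real)"
      using Dfin fin by (simp_all add: integrable_indicator_iff)
    note T1 = integrable_lborel2_tensor[OF wi iD] integrable_lborel2_tensor[OF iD wi]
      integrable_lborel2_tensor[OF wi i\<Omega>] integrable_lborel2_tensor[OF i\<Omega> wi] Hs_gagliardo_integrable[OF \<eta>H wH]
    have low_int: "integrable lborel2 low" unfolding low_def
      by (intro Bochner_Integration.integrable_diff Bochner_Integration.integrable_add integrable_mult_right T1)
    have "integral\<^sup>L lborel2 low = \<kappa>1 * (W * measure lborel D + measure lborel D * W)
        - \<kappa>2 * (W * measure lborel \<Omega> + measure lborel \<Omega> * W) - \<theta> * \<Lambda> * gagliardo s \<eta> w"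
      unfolding low_def using T1
      by (simp add: integral_lborel2_tensor[OF wi iD] integral_lborel2_tensor[OF iD wi]
        integral_lborel2_tensor[OF wi i\<Omega>] integral_lborel2_tensor[OF i\<Omega> wi] gagliardo_def W_def)
    then have "integral\<^sup>L lborel2 low = \<kappa>1 * (2 * (W * measure lborel D))
        - \<kappa>2 * (2 * (W * measure lborel \<Omega>)) - \<theta> * \<Lambda> * gagliardo s \<eta> w"
      by (simp add: algebra_simps)
    moreover have "integral\<^sup>L lborel2 low \<le> gagliardo s v w"
      unfolding gagliardo_def
    proof (rule integral_mono_AE[OF low_int Hs_gagliardo_integrable[OF v wH]])
      show "AE p in lborel2. low p \<le> incr v p * incr w p * pair_kernel s p"
        using AE_lborel2_fst[OF good] AE_lborel2_snd[OF good]
      proof eventually_elim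
        case (elim p)
        obtain x y where p: "p = (x, y)" by fastforce
        have "incr v p * incr w p * pair_kernel s p = (\<zeta> x - \<zeta> y) * (w x - w y) * frac_kernel s (x - y)
            + (t x - t y) * (w x - w y) * frac_kernel s (x - y)
            - \<theta> * \<Lambda> * (incr \<eta> p * incr w p * pair_kernel s p)"
          unfolding p incr_def pair_kernel_def fst_conv snd_conv vsplit by (simp add: algebra_simps)
        then show ?case using Psum[of x y] Qsum[of x y] elim by (simp add: low_def p)
      qed
    qed
    moreover have "gagliardo s v w \<le> \<bar>M\<bar> * W"
    proof -
      have wb: "\<bar>w x\<bar> \<le> \<theta> * \<Lambda>" for x using wle[of x] w0[of x] \<theta>\<eta>[of x] by simp
      then have "gagliardo s v w = (LINT x|lborel. f x * w x)"
        using sol wH0 unfolding weak_sol_def by blast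
      also have "\<dots> \<le> (LINT x|lborel. \<bar>M\<bar> * w x)"
      proof (rule integral_mono)
        show "integrable lborel (\<lambda>x. f x * w x)" by (rule integrable_mult_bounded[OF wi _ fM]) measurable
        show "f x * w x \<le> \<bar>M\<bar> * w x" for x using fM[of x] w0[of x] by (intro mult_right_mono) auto
      qed (use wi in auto)
      finally show ?thesis by (simp add: W_def)
    qed
    moreover have "gagliardo s \<eta> w \<le> C * r powr (- 2 * s) * W"
      unfolding \<eta>_def W_def by (rule Cb[OF r(1) wH w0 wi])
    then have "\<theta> * \<Lambda> * gagliardo s \<eta> w \<le> \<theta> * \<Lambda> * (C * r powr (- 2 * s) * W)"
      using \<theta> \<Lambda> by (intro mult_left_mono) auto
    moreover have "\<theta> * \<Lambda> * (C * r powr (- 2 * s) * W) \<le> \<kappa> / 2 * (\<Lambda> * r powr (- 2 * s) * W)"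
      using mult_right_mono[OF \<theta>C, of "\<Lambda> * r powr (- 2 * s) * W"] \<Lambda> W by (simp add: mult_ac)
    moreover have "\<kappa>1 * (2 * (W * measure lborel D)) \<ge> \<kappa> * (\<Lambda> * r powr (- 2 * s) * W)"
    proof -
      have "\<kappa>1 * (2 * (W * measure lborel D)) = 2 * (1 - \<theta>) * (\<kappa> * (\<Lambda> * r powr (- 2 * s) * W))"
      proof -
        have "\<kappa>1 * (2 * (W * measure lborel D)) = 2 * W * (\<kappa>1 * measure lborel D)" by (simp only: mult_ac)
        also have "\<dots> = 2 * (1 - \<theta>) * (\<kappa> * (\<Lambda> * r powr (- 2 * s) * W))"
          unfolding \<kappa>1D by (simp only: mult_ac)
        finally show ?thesis .
      qed
      moreover have "1 * (\<kappa> * (\<Lambda> * r powr (- 2 * s) * W)) \<le> 2 * (1 - \<theta>) * (\<kappa> * (\<Lambda> * r powr (- 2 * s) * W))"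
        using \<theta> \<kappa> \<Lambda> W by (intro mult_right_mono) auto
      ultimately show ?thesis by (simp only: mult_1)
    qed
    ultimately have "\<kappa> / 2 * (\<Lambda> * r powr (- 2 * s) * W) \<le> T * W"
      by (simp add: T_def algebra_simps)
    moreover have "(T + 1) * W \<le> \<kappa> / 2 * (\<Lambda> * r powr (- 2 * s) * W)"
    proof -
      have "T + 1 = \<kappa> / 2 * (\<Lambda> * q)" using \<kappa> \<Lambda> by (simp add: q_def field_simps)
      also have "\<dots> \<le> \<kappa> / 2 * (\<Lambda> * r powr (- 2 * s))" using rq \<kappa> \<Lambda> by (intro mult_left_mono) auto
      finally have "T + 1 \<le> \<kappa> / 2 * (\<Lambda> * r powr (- 2 * s))" .
      from mult_right_mono[OF this W] show ?thesis by (simp only: mult.assoc)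
    qed
    \<comment> \<open>The two estimates combine to \<open>(T + 1) * W \<le> T * W\<close>.\<close>
    ultimately have "W \<le> 0" by (simp add: algebra_simps)
    then have "W = 0" using W by simp
    then have "AE x in lborel. w x = 0"
      unfolding W_def using integral_nonneg_eq_0_iff_AE[OF wi] w0 by simp
    then have "AE x in lborel. x \<in> ball z (r / 2) \<longrightarrow> v x \<le> \<Lambda> * (1 - 3 * \<theta> / 4)"
    proof eventually_elim
      case (elim x)
      show ?case
      proof
        assume "x \<in> ball z (r / 2)"
        then have "3 / 4 \<le> \<eta> x" unfolding \<eta>_def by (rule bump_ge_three_quarters[OF r(1)])
        then have *: "\<theta> * \<Lambda> * (3 / 4) \<le> \<theta> * \<Lambda> * \<eta> x" using \<theta> \<Lambda> by (intro mult_left_mono) auto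
        moreover have "\<zeta> x \<le> 0" using elim by (simp add: w_def)
        moreover have "0 < \<theta> * \<Lambda>" using \<theta> \<Lambda> by simp
        ultimately show "v x \<le> \<Lambda> * (1 - 3 * \<theta> / 4)" by (simp add: \<zeta>_def min_def algebra_simps split: if_splits)
      qed
    qed
    then show ?thesis using r(1) by (intro exI[of _ "r / 2"]) auto
  qed
  show ?thesis
  proof (rule that[of "3 * \<theta> / 4"])
    show "0 < 3 * \<theta> / 4" "3 * \<theta> / 4 < 1" using \<theta> by auto
  qed (rule main)
qed

text \<open>The radii shrink in an uncontrolled way, but the factor \<open>1 - \<theta>\<close> is
  the same at every step, so the bound tends to 0; no rate is obtained.\<close>

lemma boundary_decay:
  assumes s: "0 < s" "s < 1" and \<rho>: "0 < \<rho>"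
    and \<Omega>: "\<Omega> \<in> sets borel" "emeasure lborel \<Omega> < \<infinity>" and ext: "exterior_ball_at \<rho> \<Omega> (z::'a::euclidean_space)"
    and sol: "weak_sol s \<Omega> v f" and f: "f \<in> borel_measurable borel" "\<And>x. \<bar>f x\<bar> \<le> M"
    and vB: "AE x in lborel. v x \<le> B" and \<epsilon>: "0 < \<epsilon>"
  shows "\<exists>r>0. AE x in lborel. x \<in> ball z r \<longrightarrow> v x \<le> \<epsilon>"
proof -
  obtain \<theta> where \<theta>: "0 < \<theta>" "\<theta> < 1"
    and step: "\<And>\<Omega> (z::'a) v f M B \<Lambda> r1. \<Omega> \<in> sets borel \<Longrightarrow> emeasure lborel \<Omega> < \<infinity> \<Longrightarrow> exterior_ball_at \<rho> \<Omega> z \<Longrightarrow>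
      weak_sol s \<Omega> v f \<Longrightarrow> f \<in> borel_measurable borel \<Longrightarrow> (\<And>x. \<bar>f x\<bar> \<le> M) \<Longrightarrow> (AE x in lborel. v x \<le> B) \<Longrightarrow>
      0 < \<Lambda> \<Longrightarrow> 0 < r1 \<Longrightarrow> (AE x in lborel. x \<in> ball z r1 \<longrightarrow> v x \<le> \<Lambda>) \<Longrightarrow>
      \<exists>r>0. AE x in lborel. x \<in> ball z r \<longrightarrow> v x \<le> \<Lambda> * (1 - \<theta>)"
    by (rule boundary_improvement[OF s \<rho>, where 'a='a]) (rule that; blast)
  \<comment> \<open>The iteration needs a positive starting level.\<close>
  define B' where "B' = max B 1"
  have B': "B' > 0" by (simp add: B'_def)
  have iter: "\<exists>r>0. AE x in lborel. x \<in> ball z r \<longrightarrow> v x \<le> B' * (1 - \<theta>) ^ n" for n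
  proof (induction n)
    case 0
    show ?case using vB by (intro exI[of _ 1]) (auto simp: B'_def)
  next
    case (Suc n)
    then obtain r1 where "r1 > 0" "AE x in lborel. x \<in> ball z r1 \<longrightarrow> v x \<le> B' * (1 - \<theta>) ^ n" by blast
    from step[OF \<Omega> ext sol f vB _ this] B' \<theta> show ?case by (simp add: mult_ac)
  qed
  have "(\<lambda>n. B' * (1 - \<theta>) ^ n) \<longlonglongrightarrow> B' * 0"
    using \<theta> by (intro tendsto_intros LIMSEQ_realpow_zero) auto
  then have "\<forall>\<^sub>F n in sequentially. B' * (1 - \<theta>) ^ n < \<epsilon>"
    using \<epsilon> by (intro order_tendstoD(2)) auto
  then obtain n where n: "B' * (1 - \<theta>) ^ n < \<epsilon>" by (auto simp: eventually_sequentially)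
  from iter[of n] obtain r where "r > 0" "AE x in lborel. x \<in> ball z r \<longrightarrow> v x \<le> B' * (1 - \<theta>) ^ n" by blast
  then show ?thesis using n by (intro exI[of _ r]) (auto elim!: eventually_mono)
qed

section \<open>Applications of truncation: sup bounds and translation estimates\<close>

section \<open>Bounds for weak solutions\<close>

lemma weak_sol_H0: "weak_sol s \<Omega> v f \<Longrightarrow> v \<in> H0 s \<Omega>"
  by (simp add: weak_sol_def)

lemma weak_sol_test:
  assumes "weak_sol s \<Omega> v f" "w \<in> H0 s \<Omega>" "\<And>x. \<bar>w x\<bar> \<le> B"
  shows "gagliardo s v w = (LINT x|lborel. f x * w x)"
  using assms unfolding weak_sol_def by blast

lemma weak_sol_uminus:
  assumes "weak_sol s \<Omega> v f" shows "weak_sol s \<Omega> (\<lambda>x. - v x) (\<lambda>x. - f x)"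
  using assms unfolding weak_sol_def by (auto intro: H0_uminus simp: gagliardo_uminus_left)

lemma weak_sol_diff:
  assumes v: "weak_sol s \<Omega> v f" and u: "weak_sol s \<Omega> u g" and f: "integrable lborel f" and g: "integrable lborel g"
  shows "weak_sol s \<Omega> (\<lambda>x. v x - u x) (\<lambda>x. f x - g x)"
  unfolding weak_sol_def
proof (intro conjI ballI impI)
  show "(\<lambda>x. v x - u x) \<in> H0 s \<Omega>" using u v by (intro H0_diff) (auto dest: weak_sol_H0)
  fix w assume w: "w \<in> H0 s \<Omega>" and "\<exists>B. \<forall>x. \<bar>w x\<bar> \<le> B"
  then obtain B where B: "\<And>x. \<bar>w x\<bar> \<le> B" by blast
  have wm: "w \<in> borel_measurable borel" using w by (auto dest: H0_Hs Hs_measurable)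
  have "integrable lborel (\<lambda>x. w x * f x)" "integrable lborel (\<lambda>x. w x * g x)"
    using B wm f g by (auto intro!: integrable_mult_bounded[where B=B])
  then have "integrable lborel (\<lambda>x. f x * w x)" "integrable lborel (\<lambda>x. g x * w x)"
    by (simp_all add: mult.commute)
  then have "(LINT x|lborel. (f x - g x) * w x) = (LINT x|lborel. f x * w x) - (LINT x|lborel. g x * w x)"
    by (simp add: left_diff_distrib)
  moreover have "gagliardo s (\<lambda>x. v x - u x) w = gagliardo s v w - gagliardo s u w"
    using u v w by (intro gagliardo_diff_left) (auto dest: weak_sol_H0 H0_Hs)
  ultimately show "gagliardo s (\<lambda>x. v x - u x) w = (LINT x|lborel. (f x - g x) * w x)"
    using weak_sol_test[OF v w B] weak_sol_test[OF u w B] by simp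
qed

lemma slice_abs_le: "0 \<le> j \<Longrightarrow> \<bar>slice k j t\<bar> \<le> j"
  by (auto simp: slice_def)

text \<open>The size of the datum is measured by its integrals over subsets of
  \<open>\<Omega>\<close>, which treats three cases together: \<open>\<gamma> = 1\<close> for
  bounded data, \<open>\<gamma> = 1 - 1 / p\<close> for p-integrable data by Hoelder, and
  \<open>F = 0\<close> for nonpositive data, where the conclusion is the maximum principle.\<close>

lemma weak_sol_le:
  fixes \<Omega> :: "'a::euclidean_space set"
  assumes s: "0 < s" and \<Omega>[measurable]: "\<Omega> \<in> sets borel" and fin: "emeasure lborel \<Omega> < \<infinity>"
    and \<gamma>: "1 < \<gamma> + 2 * s / real DIM('a)"
  obtains C where "0 \<le> C"
    and "\<And>v f F. weak_sol s \<Omega> v f \<Longrightarrow> integrable lborel f \<Longrightarrow> 0 \<le> F \<Longrightarrow>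
      \<forall>A\<in>sets borel. A \<subseteq> \<Omega> \<longrightarrow> (LINT x|lborel. indicator A x * max (f x) 0) \<le> F * measure lborel A powr \<gamma> \<Longrightarrow>
      AE x in lborel. v x \<le> C * F"
proof -
  obtain C where C: "0 \<le> C" and S: "\<And>z k0 F. z \<in> Hs s \<Longrightarrow> 0 \<le> k0 \<Longrightarrow> 0 \<le> F \<Longrightarrow> AE x in lborel. x \<notin> \<Omega> \<longrightarrow> z x \<le> k0 \<Longrightarrow>
      (\<And>k j. k0 \<le> k \<Longrightarrow> 0 < j \<Longrightarrow>
        gagliardo s z (\<lambda>x. slice k j (z x)) \<le> j * F * measure lborel {x\<in>\<Omega>. k < z x} powr \<gamma>) \<Longrightarrow>
      AE x in lborel. z x \<le> k0 + C * F"
    by (rule stampacchia[OF s \<Omega> fin \<gamma>]) (rule that; blast)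
  have main: "AE x in lborel. v x \<le> C * F"
    if sol: "weak_sol s \<Omega> v f" and fi: "integrable lborel f" and F: "0 \<le> F"
      and le: "\<forall>A\<in>sets borel. A \<subseteq> \<Omega> \<longrightarrow> (LINT x|lborel. indicator A x * max (f x) 0) \<le> F * measure lborel A powr \<gamma>" for v f F
  proof -
    have v: "v \<in> Hs s" and vz: "AE x in lborel. x \<notin> \<Omega> \<longrightarrow> v x = 0"
      using sol by (auto simp: weak_sol_def H0_def)
    note [measurable] = Hs_measurable[OF v] borel_measurable_integrable[OF fi]
    have "AE x in lborel. v x \<le> 0 + C * F"
    proof (rule S[OF v order_refl F])
      show "AE x in lborel. x \<notin> \<Omega> \<longrightarrow> v x \<le> 0" using vz by eventually_elim auto
      fix k j :: real assume k: "0 \<le> k" and j: "0 < j"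
      define A where "A = {x\<in>\<Omega>. k < v x}"
      have [measurable]: "A \<in> sets borel" unfolding A_def by measurable
      define w where "w x = slice k j (v x)" for x
      have wz: "AE x in lborel. x \<notin> A \<longrightarrow> w x = 0"
        using vz by eventually_elim (use k j in \<open>auto simp: A_def w_def slice_def\<close>)
      have wH: "w \<in> Hs s" unfolding w_def using k j by (intro Hs_slice v) auto
      note [measurable] = Hs_measurable[OF wH]
      have w: "w \<in> H0 s \<Omega>" using wH wz unfolding H0_def by (auto simp: A_def elim!: eventually_mono)
      have wb: "\<bar>w x\<bar> \<le> j" for x using j by (simp add: w_def slice_abs_le)
      have "gagliardo s v w = (LINT x|lborel. f x * w x)" by (rule weak_sol_test[OF sol w wb])
      also have "\<dots> \<le> (LINT x|lborel. j * (indicator A x * max (f x) 0))"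
      proof (rule integral_mono_AE)
        show "integrable lborel (\<lambda>x. f x * w x)"
          using integrable_mult_bounded[OF fi _ wb] by (simp add: mult.commute)
        have "integrable lborel (\<lambda>x. indicator A x * max (f x) 0)"
          using fi by (intro integrable_mult_bounded[where B=1] integrable_max) (auto simp: indicator_def)
        then show "integrable lborel (\<lambda>x. j * (indicator A x * max (f x) 0))" by simp
        show "AE x in lborel. f x * w x \<le> j * (indicator A x * max (f x) 0)"
          using wz
        proof eventually_elim
          case (elim x)
          show ?case
          proof (cases "x \<in> A")
            case True
            have "f x * w x \<le> max (f x) 0 * w x"
              using j slice_bounds(1)[of j k "v x"] by (intro mult_right_mono) (auto simp: w_def)
            also have "\<dots> \<le> max (f x) 0 * j" using wb[of x] by (intro mult_left_mono) auto
            finally show ?thesis using True by (simp add: mult.commute)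
          qed (use elim in auto)
        qed
      qed
      also have "\<dots> \<le> j * (F * measure lborel A powr \<gamma>)"
        using le[rule_format, of A] j by (simp add: A_def)
      finally show "gagliardo s v (\<lambda>x. slice k j (v x)) \<le> j * F * measure lborel {x\<in>\<Omega>. k < v x} powr \<gamma>"
        by (simp add: w_def[abs_def] A_def mult.assoc)
    qed
    then show ?thesis by simp
  qed
  show ?thesis by (rule that[OF C main])
qed

lemma integrable_bounded_support:
  fixes g :: "'a::euclidean_space \<Rightarrow> real"
  assumes [measurable]: "\<Omega> \<in> sets borel" "g \<in> borel_measurable borel" and fin: "emeasure lborel \<Omega> < \<infinity>"
    and "AE x in lborel. \<bar>g x\<bar> \<le> M" "AE x in lborel. x \<notin> \<Omega> \<longrightarrow> g x = 0"
  shows "integrable lborel g"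
proof (rule Bochner_Integration.integrable_bound)
  show "integrable lborel (\<lambda>x. M * indicator \<Omega> x :: real)" using fin by (simp add: integrable_indicator_iff)
  show "AE x in lborel. norm (g x) \<le> norm (M * indicator \<Omega> x :: real)"
    using assms(4,5) by eventually_elim (auto simp: indicator_def)
qed measurable

lemma weak_sol_bounded:
  fixes \<Omega> :: "'a::euclidean_space set"
  assumes s: "0 < s" and \<Omega>[measurable]: "\<Omega> \<in> sets borel" and fin: "emeasure lborel \<Omega> < \<infinity>"
    and sol: "weak_sol s \<Omega> v g" and [measurable]: "g \<in> borel_measurable borel"
    and gM: "\<And>x. \<bar>g x\<bar> \<le> M" and g0: "\<And>x. x \<notin> \<Omega> \<Longrightarrow> g x = 0"
  obtains B where "0 \<le> B" "AE x in lborel. \<bar>v x\<bar> \<le> B"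
proof -
  have "1 < 1 + 2 * s / real DIM('a)" using s by simp
  then obtain C where C: "0 \<le> C" and L: "\<And>v f F. weak_sol s \<Omega> v f \<Longrightarrow> integrable lborel f \<Longrightarrow> 0 \<le> F \<Longrightarrow>
      \<forall>A\<in>sets borel. A \<subseteq> \<Omega> \<longrightarrow> (LINT x|lborel. indicator A x * max (f x) 0) \<le> F * measure lborel A powr 1 \<Longrightarrow>
      AE x in lborel. v x \<le> C * F"
    by (rule weak_sol_le[OF s \<Omega> fin]) (rule that)
  have M: "M \<ge> 0" using gM[of undefined] by linarith
  have *: "(LINT x|lborel. indicator A x * max (f x) 0) \<le> M * measure lborel A powr 1"
    if [measurable]: "A \<in> sets borel" "f \<in> borel_measurable borel" and A: "A \<subseteq> \<Omega>" and f: "\<And>x. \<bar>f x\<bar> \<le> M" for A f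
  proof -
    have Af: "emeasure lborel A < \<infinity>" using fin A by (auto intro: le_less_trans[OF emeasure_mono])
    have "(LINT x|lborel. indicator A x * max (f x) 0) \<le> (LINT x|lborel. M * indicator A x)"
    proof (rule integral_mono)
      show "integrable lborel (\<lambda>x. indicator A x * max (f x) 0)"
        by (rule integrable_bounded_support[OF _ _ Af, of _ M])
          (use f M in \<open>auto simp: indicator_def abs_le_iff intro: order_trans\<close>)
      show "integrable lborel (\<lambda>x. M * indicator A x)" using Af by (simp add: integrable_indicator_iff)
      show "indicator A x * max (f x) 0 \<le> M * indicator A x" for x
        using f[of x] M by (auto simp: indicator_def)
    qed
    also have "\<dots> = M * measure lborel A powr 1" by simp
    finally show ?thesis .
  qed
  have gi: "integrable lborel g" by (rule integrable_bounded_support[OF \<Omega> _ fin, of _ M]) (use gM g0 in auto)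
  have "AE x in lborel. v x \<le> C * M" by (rule L[OF sol gi M]) (use * gM in auto)
  moreover have "AE x in lborel. - v x \<le> C * M" 
    by (rule L[OF weak_sol_uminus[OF sol] _ M]) (use * gM gi in auto)
  ultimately have "AE x in lborel. \<bar>v x\<bar> \<le> C * M" by eventually_elim auto
  then show ?thesis using that[of "C * M"] C M by simp
qed

text \<open>Slices of \<open>v (x + h) - v x\<close> above the level \<open>\<epsilon>\<close>
  vanish off the intersection of \<open>\<Omega>\<close> and \<open>\<Omega> - h\<close>. So both
  the slice and its translate by \<open>h\<close> are admissible, and testing with them compares the
  equation with its translate; only \<open>g (x + h) - g x\<close> on that intersection
  enters.\<close>

lemma weak_sol_translate_le:
  fixes \<Omega> :: "'a::euclidean_space set"
  assumes s: "0 < s" and \<Omega>[measurable]: "\<Omega> \<in> sets borel" and fin: "emeasure lborel \<Omega> < \<infinity>"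
    and sol: "weak_sol s \<Omega> v g" and g[measurable]: "g \<in> borel_measurable borel"
    and gM: "\<And>x. \<bar>g x\<bar> \<le> M"
  obtains C where "0 \<le> C"
    and "\<And>h \<epsilon> \<sigma>. 0 \<le> \<epsilon> \<Longrightarrow> 0 \<le> \<sigma> \<Longrightarrow> AE x in lborel. x \<notin> \<Omega> \<or> x + h \<notin> \<Omega> \<longrightarrow> v (x + h) - v x \<le> \<epsilon> \<Longrightarrow>
      \<forall>x. x \<in> \<Omega> \<longrightarrow> x + h \<in> \<Omega> \<longrightarrow> g (x + h) - g x \<le> \<sigma> \<Longrightarrow> AE x in lborel. v (x + h) - v x \<le> \<epsilon> + C * \<sigma>"
proof -
  have \<gamma>: "1 < 1 + 2 * s / real DIM('a)" using s by simp
  obtain C where C: "0 \<le> C" and S: "\<And>z k0 F. z \<in> Hs s \<Longrightarrow> 0 \<le> k0 \<Longrightarrow> 0 \<le> F \<Longrightarrow> AE x in lborel. x \<notin> \<Omega> \<longrightarrow> z x \<le> k0 \<Longrightarrow>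
      (\<And>k j. k0 \<le> k \<Longrightarrow> 0 < j \<Longrightarrow>
        gagliardo s z (\<lambda>x. slice k j (z x)) \<le> j * F * measure lborel {x\<in>\<Omega>. k < z x} powr 1) \<Longrightarrow>
      AE x in lborel. z x \<le> k0 + C * F"
    by (rule stampacchia[OF s \<Omega> fin \<gamma>]) (rule that; blast)
  have v: "v \<in> Hs s" using sol by (auto simp: weak_sol_def H0_def)
  note [measurable] = Hs_measurable[OF v]
  have main: "AE x in lborel. v (x + h) - v x \<le> \<epsilon> + C * \<sigma>"
    if \<epsilon>: "0 \<le> \<epsilon>" and \<sigma>: "0 \<le> \<sigma>" and out: "AE x in lborel. x \<notin> \<Omega> \<or> x + h \<notin> \<Omega> \<longrightarrow> v (x + h) - v x \<le> \<epsilon>"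
      and gs: "\<forall>x. x \<in> \<Omega> \<longrightarrow> x + h \<in> \<Omega> \<longrightarrow> g (x + h) - g x \<le> \<sigma>" for h \<epsilon> \<sigma>
  proof -
    define z where "z x = v (x + h) - v x" for x
    have z: "z \<in> Hs s" unfolding z_def by (intro Hs_diff Hs_translate v)
    note [measurable] = Hs_measurable[OF z]
    have "AE x in lborel. z x \<le> \<epsilon> + C * \<sigma>"
    proof (rule S[OF z \<epsilon> \<sigma>])
      show "AE x in lborel. x \<notin> \<Omega> \<longrightarrow> z x \<le> \<epsilon>" using out by eventually_elim (auto simp: z_def)
      fix k j :: real assume k: "\<epsilon> \<le> k" and j: "0 < j"
      define A where "A = {x\<in>\<Omega>. k < z x}"
      have [measurable]: "A \<in> sets borel" unfolding A_def by measurable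
      have Af: "emeasure lborel A < \<infinity>"
        using fin by (intro le_less_trans[OF emeasure_mono[of A \<Omega>]]) (auto simp: A_def)
      define w where "w x = slice k j (z x)" for x
      have wz: "AE x in lborel. x \<notin> A \<or> x + h \<notin> \<Omega> \<longrightarrow> w x = 0"
        using out by eventually_elim (use k j in \<open>auto simp: A_def w_def z_def slice_def\<close>)
      have wH: "w \<in> Hs s" unfolding w_def using k j \<epsilon> by (intro Hs_slice z) auto
      note [measurable] = Hs_measurable[OF wH]
      have w: "w \<in> H0 s \<Omega>" using wH wz unfolding H0_def by (auto simp: A_def elim!: eventually_mono)
      have wb: "\<bar>w x\<bar> \<le> j" for x using j by (simp add: w_def slice_abs_le)
      define w' where "w' x = w (x + - h)" for x
      have w'H: "w' \<in> Hs s" unfolding w'_def by (rule Hs_translate[OF wH])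
      have "AE x in lborel. x \<notin> \<Omega> \<longrightarrow> w' x = 0"
        using AE_lborel_translate[OF wz, of "- h"] unfolding w'_def by eventually_elim auto
      with w'H have w': "w' \<in> H0 s \<Omega>" by (simp add: H0_def)
      note [measurable] = Hs_measurable[OF w'H]
      have wi: "integrable lborel w"
        by (rule integrable_bounded_support[OF \<Omega> _ fin, of _ j]) (use wb H0_zero[OF w] in auto)
      have w'b: "\<bar>w' x\<bar> \<le> j" for x using wb by (simp add: w'_def)
      have ww: "w = (\<lambda>x. w' (x + h))" by (simp add: w'_def)
      have "gagliardo s z w = gagliardo s (\<lambda>x. v (x + h)) w - gagliardo s v w"
        unfolding z_def by (intro gagliardo_diff_left Hs_translate v wH)
      also have "gagliardo s (\<lambda>x. v (x + h)) w = gagliardo s v w'"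
        unfolding ww by (rule gagliardo_translate) auto
      also have "\<dots> = (LINT x|lborel. g x * w' x)" by (rule weak_sol_test[OF sol w' w'b])
      also have "\<dots> = (LINT x|lborel. g (x + h) * w' (x + h))"
        by (rule integral_lborel_translate[symmetric]) auto
      also have "\<dots> = (LINT x|lborel. g (x + h) * w x)" by (simp add: w'_def)
      also have "gagliardo s v w = (LINT x|lborel. g x * w x)" by (rule weak_sol_test[OF sol w wb])
      also have "(LINT x|lborel. g (x + h) * w x) - (LINT x|lborel. g x * w x)
          = (LINT x|lborel. g (x + h) * w x - g x * w x)"
        by (rule Bochner_Integration.integral_diff[symmetric])
          (auto intro!: integrable_mult_bounded[OF wi, where B=M] gM)
      also have "\<dots> \<le> (LINT x|lborel. (j * \<sigma>) * indicator A x)"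
      proof (rule integral_mono_AE)
        show "integrable lborel (\<lambda>x. g (x + h) * w x - g x * w x)"
          by (intro Bochner_Integration.integrable_diff integrable_mult_bounded[OF wi, where B=M] gM) auto
        show "integrable lborel (\<lambda>x. (j * \<sigma>) * indicator A x)" using Af by (simp add: integrable_indicator_iff)
        show "AE x in lborel. g (x + h) * w x - g x * w x \<le> (j * \<sigma>) * indicator A x"
          using wz
        proof eventually_elim
          case (elim x)
          show ?case
          proof (cases "x \<in> A \<and> x + h \<in> \<Omega>")
            case True
            have w0: "0 \<le> w x" using j slice_bounds(1)[of j k "z x"] by (simp add: w_def)
            have "g (x + h) * w x - g x * w x = (g (x + h) - g x) * w x" by (simp add: algebra_simps)
            also have "\<dots> \<le> \<sigma> * w x" using True gs w0 by (intro mult_right_mono) (auto simp: A_def)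
            also have "\<dots> \<le> \<sigma> * j" using wb[of x] \<sigma> by (intro mult_left_mono) auto
            finally show ?thesis using True by (simp add: mult.commute)
          qed (use elim j \<sigma> in \<open>auto simp: indicator_def\<close>)
        qed
      qed
      also have "\<dots> = j * \<sigma> * measure lborel A powr 1" by simp
      finally show "gagliardo s z (\<lambda>x. slice k j (z x)) \<le> j * \<sigma> * measure lborel {x\<in>\<Omega>. k < z x} powr 1"
        by (simp add: w_def[abs_def] A_def)
    qed
    then show ?thesis by (simp add: z_def)
  qed
  show ?thesis by (rule that[OF C main])
qed

section \<open>From estimates almost everywhere to continuity\<close>

section \<open>Continuous representatives\<close>

text \<open>The exceptional null set may depend on \<open>h\<close>, since each translate is
  estimated on its own.\<close>

definition AE_equicontinuous :: "('a::euclidean_space \<Rightarrow> real) \<Rightarrow> bool" where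
  "AE_equicontinuous v \<longleftrightarrow> (\<forall>\<epsilon>>0. \<exists>\<delta>>0. \<forall>h. norm h < \<delta> \<longrightarrow> (AE x in lborel. \<bar>v (x + h) - v x\<bar> \<le> \<epsilon>))"

lemma open_AE_empty:
  fixes U :: "'a::euclidean_space set"
  assumes "open U" "AE x in lborel. x \<notin> U" shows "U = {}"
proof (rule ccontr)
  assume "U \<noteq> {}"
  have "U \<in> null_sets lborel" using assms by (subst AE_iff_null_sets) (auto simp: borel_open)
  then have "negligible U" using assms(1) by (simp add: negligible_iff_null_sets null_sets_completionI)
  then show False using open_not_negligible[OF assms(1) \<open>U \<noteq> {}\<close>] by simp
qed

lemma integral_abs_le_AE:
  fixes f g :: "'b \<Rightarrow> real"
  assumes "integrable M f" "integrable M g" "AE x in M. \<bar>f x\<bar> \<le> g x"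
  shows "\<bar>LINT x|M. f x\<bar> \<le> (LINT x|M. g x)"
proof -
  have "\<bar>LINT x|M. f x\<bar> \<le> (LINT x|M. \<bar>f x\<bar>)" by (rule integral_abs_bound)
  also have "\<dots> \<le> (LINT x|M. g x)" using assms by (intro integral_mono_AE) auto
  finally show ?thesis .
qed

text \<open>The averages \<open>I n x / c n\<close> over small balls inherit the modulus of
  continuity of \<open>v\<close> at every point and are within \<open>1 / (n + 1)\<close> of
  \<open>v\<close> off a null set. So \<open>v\<close> is uniformly continuous on a set of full
  measure; such a set is dense, and \<open>v\<close> extends from it.\<close>

lemma continuous_representative:
  fixes v :: "'a::euclidean_space \<Rightarrow> real"
  assumes vi: "integrable lborel v" and eq: "AE_equicontinuous v"
  obtains v' where "continuous_on UNIV v'" "AE x in lborel. v x = v' x"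
proof -
  have [measurable]: "v \<in> borel_measurable borel" using vi by auto
  have "\<forall>n. \<exists>\<delta>>0. \<forall>h. norm h < \<delta> \<longrightarrow> (AE x in lborel. \<bar>v (x + h) - v x\<bar> \<le> 1 / real (Suc n))"
    using eq unfolding AE_equicontinuous_def by auto
  then obtain \<delta> where \<delta>: "\<And>n. 0 < \<delta> n" and \<delta>v: "\<And>n h. norm h < \<delta> n \<Longrightarrow> AE x in lborel. \<bar>v (x + h) - v x\<bar> \<le> 1 / real (Suc n)"
    by metis
  have [measurable]: "ball (0::'a) (\<delta> n) \<in> sets borel" for n by simp
  have [measurable]: "(\<lambda>p. v (fst p + snd p)) \<in> borel_measurable lborel2"
    by (rule measurable_compose[of _ _ borel]) measurable
  have [measurable]: "(\<lambda>p. v (snd p)) \<in> borel_measurable (lborel2 :: ('a \<times> 'a) measure)"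
    by (rule measurable_compose[of _ _ borel]) measurable
  define c where "c n = measure lborel (ball (0::'a) (\<delta> n))" for n
  have c: "c n > 0" for n unfolding c_def using \<delta>[of n] by (simp add: content_ball)
  define I where "I n x = (LINT z|lborel. indicator (ball 0 (\<delta> n)) z * v (z + x))" for n x
  have vx: "integrable lborel (\<lambda>z. v (z + x))" for x by (rule integrable_lborel_translate[OF vi])
  have iI: "integrable lborel (\<lambda>z. indicator (ball 0 (\<delta> n)) z * v (z + x))" for n x
    by (rule integrable_mult_bounded[OF vx, where B=1]) (auto simp: indicator_def)
  have ib: "integrable lborel (\<lambda>z. indicator (ball (0::'a) (\<delta> n)) z * (d::real))" for n d
    using \<delta>[of n] by (simp add: integrable_indicator_iff emeasure_ball)
  have close: "\<bar>I n (x + h) - I n x\<bar> \<le> c n * \<epsilon>"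
    if h: "AE x in lborel. \<bar>v (x + h) - v x\<bar> \<le> \<epsilon>" for n x h \<epsilon>
  proof -
    have "\<bar>I n (x + h) - I n x\<bar> = \<bar>LINT z|lborel. indicator (ball 0 (\<delta> n)) z * v (z + (x + h)) - indicator (ball 0 (\<delta> n)) z * v (z + x)\<bar>"
      unfolding I_def by (subst Bochner_Integration.integral_diff[OF iI iI]) simp
    also have "\<dots> \<le> (LINT z|lborel. indicator (ball (0::'a) (\<delta> n)) z * \<epsilon>)"
    proof (rule integral_abs_le_AE[OF _ ib])
      show "integrable lborel (\<lambda>z. indicator (ball 0 (\<delta> n)) z * v (z + (x + h)) - indicator (ball 0 (\<delta> n)) z * v (z + x))"
        by (intro Bochner_Integration.integrable_diff iI)
      show "AE z in lborel. \<bar>indicator (ball 0 (\<delta> n)) z * v (z + (x + h)) - indicator (ball 0 (\<delta> n)) z * v (z + x)\<bar>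
          \<le> indicator (ball 0 (\<delta> n)) z * \<epsilon>"
        using AE_lborel_translate[OF h, of x] by eventually_elim (auto simp: indicator_def add.assoc)
    qed
    also have "\<dots> = c n * \<epsilon>" by (simp add: c_def)
    finally show ?thesis .
  qed
  have avg: "AE x in lborel. \<bar>I n x - c n * v x\<bar> \<le> c n * (1 / real (Suc n))" for n
  proof -
    have "AE z in lborel. AE x in lborel. z \<in> ball 0 (\<delta> n) \<longrightarrow> \<bar>v (z + x) - v x\<bar> \<le> 1 / real (Suc n)"
    proof (rule AE_I2)
      fix z :: 'a
      show "AE x in lborel. z \<in> ball 0 (\<delta> n) \<longrightarrow> \<bar>v (z + x) - v x\<bar> \<le> 1 / real (Suc n)"
      proof (cases "z \<in> ball 0 (\<delta> n)")
        case True
        then show ?thesis using \<delta>v[of z n] by (simp add: add.commute)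
      qed simp
    qed
    \<comment> \<open>Fubini exchanges the two quantifiers: for almost every point the estimate now
      holds for almost every shift, which is what averaging over shifts requires.\<close>
    then have "AE x in lborel. AE z in lborel. z \<in> ball 0 (\<delta> n) \<longrightarrow> \<bar>v (z + x) - v x\<bar> \<le> 1 / real (Suc n)"
      by (subst (asm) lborel_pair.AE_commute) measurable
    then show ?thesis
    proof eventually_elim
      case (elim x)
      have "c n * v x = (LINT z|lborel. indicator (ball (0::'a) (\<delta> n)) z * v x)" by (simp add: c_def)
      then have "\<bar>I n x - c n * v x\<bar> = \<bar>LINT z|lborel. indicator (ball 0 (\<delta> n)) z * v (z + x) - indicator (ball 0 (\<delta> n)) z * v x\<bar>"
        unfolding I_def by (simp only: Bochner_Integration.integral_diff[OF iI ib])
      also have "\<dots> \<le> (LINT z|lborel. indicator (ball (0::'a) (\<delta> n)) z * (1 / real (Suc n)))"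
      proof (rule integral_abs_le_AE[OF _ ib])
        show "integrable lborel (\<lambda>z. indicator (ball 0 (\<delta> n)) z * v (z + x) - indicator (ball 0 (\<delta> n)) z * v x)"
          by (intro Bochner_Integration.integrable_diff iI ib)
        show "AE z in lborel. \<bar>indicator (ball 0 (\<delta> n)) z * v (z + x) - indicator (ball 0 (\<delta> n)) z * v x\<bar>
            \<le> indicator (ball 0 (\<delta> n)) z * (1 / real (Suc n))"
          using elim by eventually_elim (auto simp: indicator_def)
      qed
      also have "\<dots> = c n * (1 / real (Suc n))" by (simp add: c_def)
      finally show ?case .
    qed
  qed
  define G where "G = {x. \<forall>n. \<bar>I n x - c n * v x\<bar> \<le> c n * (1 / real (Suc n))}"
  have G: "AE x in lborel. x \<in> G" using avg by (simp add: G_def AE_all_countable)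
  have uc: "uniformly_continuous_on G v"
    unfolding uniformly_continuous_on_def
  proof (intro allI impI)
    fix \<epsilon> :: real assume \<epsilon>: "0 < \<epsilon>"
    then obtain d where d: "d > 0" "\<And>h. norm h < d \<Longrightarrow> AE x in lborel. \<bar>v (x + h) - v x\<bar> \<le> \<epsilon> / 2"
      using eq unfolding AE_equicontinuous_def by (meson half_gt_zero)
    have "dist (v y) (v x) < \<epsilon>" if xy: "x \<in> G" "y \<in> G" "dist y x < d" for x y
    proof -
      have b: "\<bar>v y - v x\<bar> - \<epsilon> / 2 \<le> 2 * inverse (real (Suc n))" for n
      proof -
        have 1: "\<bar>I n y - I n x\<bar> \<le> c n * (\<epsilon> / 2)"
          using close[of "y - x" "\<epsilon> / 2" n x] d(2)[of "y - x"] xy(3) by (simp add: dist_norm)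
        have 2: "\<bar>I n x - c n * v x\<bar> \<le> c n * inverse (real (Suc n))" "\<bar>I n y - c n * v y\<bar> \<le> c n * inverse (real (Suc n))"
          using xy(1,2) by (auto simp: G_def inverse_eq_divide)
        have "c n * \<bar>v y - v x\<bar> = \<bar>c n * v y - c n * v x\<bar>"
          using c[of n] by (simp add: abs_mult flip: right_diff_distrib)
        also have "\<dots> \<le> c n * (\<epsilon> / 2 + 2 * inverse (real (Suc n)))"
          using 1 2 unfolding distrib_left mult.left_commute[of "c n" 2] by linarith
        finally show ?thesis using c[of n] by (simp del: of_nat_Suc)
      qed
      have "(\<lambda>n. 2 * inverse (real (Suc n))) \<longlonglongrightarrow> 2 * 0"
        by (intro tendsto_intros LIMSEQ_inverse_real_of_nat)
      then have "\<bar>v y - v x\<bar> - \<epsilon> / 2 \<le> 2 * 0" by (rule LIMSEQ_le_const) (use b in blast)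
      then show ?thesis using \<epsilon> by (simp add: dist_real_def)
    qed
    then show "\<exists>d>0. \<forall>x\<in>G. \<forall>x'\<in>G. dist x' x < d \<longrightarrow> dist (v x') (v x) < \<epsilon>"
      using d(1) by blast
  qed
  have "- closure G = {}"
  proof (rule open_AE_empty)
    show "AE x in lborel. x \<notin> - closure G" using G by eventually_elim (use closure_subset in auto)
  qed auto
  then have cl: "closure G = UNIV" by auto
  obtain v' where v': "uniformly_continuous_on (closure G) v'" "\<And>x. x \<in> G \<Longrightarrow> v x = v' x"
    by (rule uniformly_continuous_on_extension_on_closure[OF uc]) (rule that)
  show ?thesis
  proof (rule that[of v'])
    show "continuous_on UNIV v'" using v'(1) uniformly_continuous_imp_continuous unfolding cl by blast
    show "AE x in lborel. v x = v' x" using G by eventually_elim (rule v'(2))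
  qed
qed

section \<open>Continuity of weak solutions\<close>

text \<open>Compactness of the frontier makes the decay uniform. The segment from a point outside to
  a point \<open>y\<close> of \<open>\<Omega>\<close> meets the frontier, so being close to the
  complement means being close to one of finitely many frontier points.\<close>

lemma weak_sol_uniform_decay:
  fixes \<Omega> :: "'a::euclidean_space set"
  assumes s: "0 < s" "s < 1" and \<Omega>: "open \<Omega>" "bounded \<Omega>"
    and ext: "\<And>z. z \<in> frontier \<Omega> \<Longrightarrow> \<exists>\<rho>>0. exterior_ball_at \<rho> \<Omega> z"
    and sol: "weak_sol s \<Omega> v g" and g[measurable]: "g \<in> borel_measurable borel"
    and gM: "\<And>x. \<bar>g x\<bar> \<le> M" and g0: "\<And>x. x \<notin> \<Omega> \<Longrightarrow> g x = 0" and \<epsilon>: "0 < \<epsilon>"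
  obtains \<delta> where "0 < \<delta>" "AE y in lborel. (\<exists>x. x \<notin> \<Omega> \<and> dist x y < \<delta>) \<longrightarrow> \<bar>v y\<bar> \<le> \<epsilon>"
proof -
  have \<Omega>b: "\<Omega> \<in> sets borel" using \<Omega>(1) by simp
  have fin: "emeasure lborel \<Omega> < \<infinity>" using \<Omega>(2) by (rule emeasure_bounded_finite)
  obtain B where vB: "AE x in lborel. \<bar>v x\<bar> \<le> B"
    by (rule weak_sol_bounded[OF s(1) \<Omega>b fin sol g gM g0])
  have vB1: "AE x in lborel. v x \<le> B" and vB2: "AE x in lborel. - v x \<le> B"
    using vB by (auto elim!: eventually_mono)
  have "\<exists>r>0. AE x in lborel. x \<in> ball z r \<longrightarrow> \<bar>v x\<bar> \<le> \<epsilon>" if z: "z \<in> frontier \<Omega>" for z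
  proof -
    obtain \<rho> where \<rho>: "\<rho> > 0" "exterior_ball_at \<rho> \<Omega> z" using ext[OF z] by blast
    obtain r1 where r1: "r1 > 0" "AE x in lborel. x \<in> ball z r1 \<longrightarrow> v x \<le> \<epsilon>"
      using boundary_decay[OF s \<rho>(1) \<Omega>b fin \<rho>(2) sol g gM vB1 \<epsilon>] by blast
    have g': "(\<lambda>x. - g x) \<in> borel_measurable borel" "\<And>x. \<bar>- g x\<bar> \<le> M" using gM by auto
    obtain r2 where r2: "r2 > 0" "AE x in lborel. x \<in> ball z r2 \<longrightarrow> - v x \<le> \<epsilon>"
      using boundary_decay[OF s \<rho>(1) \<Omega>b fin \<rho>(2) weak_sol_uminus[OF sol] g' vB2 \<epsilon>] by blast
    have "AE x in lborel. x \<in> ball z (min r1 r2) \<longrightarrow> \<bar>v x\<bar> \<le> \<epsilon>"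
      using r1(2) r2(2) by eventually_elim auto
    then show ?thesis using r1(1) r2(1) by (intro exI[of _ "min r1 r2"]) auto
  qed
  then obtain r where r: "\<And>z. z \<in> frontier \<Omega> \<Longrightarrow> r z > 0"
    and rv: "\<And>z. z \<in> frontier \<Omega> \<Longrightarrow> AE x in lborel. x \<in> ball z (r z) \<longrightarrow> \<bar>v x\<bar> \<le> \<epsilon>" by metis
  have "compact (frontier \<Omega>)" using \<Omega>(2) by (rule compact_frontier_bounded)
  then obtain Z where Z: "Z \<subseteq> frontier \<Omega>" "finite Z" "frontier \<Omega> \<subseteq> (\<Union>z\<in>Z. ball z (r z / 2))"
  proof (rule compactE_image)
    show "frontier \<Omega> \<subseteq> (\<Union>z\<in>frontier \<Omega>. ball z (r z / 2))" using r by force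
  qed auto
  \<comment> \<open>The inserted 1 keeps the minimum defined if \<open>Z\<close> is empty.\<close>
  define \<delta> where "\<delta> = Min (insert 1 ((\<lambda>z. r z / 2) ` Z))"
  have \<delta>: "\<delta> > 0" unfolding \<delta>_def using Z r by (subst Min_gr_iff) auto
  have \<delta>Z: "\<delta> \<le> r z / 2" if "z \<in> Z" for z unfolding \<delta>_def using Z(2) that by (intro Min_le) auto
  have "AE y in lborel. \<forall>z\<in>Z. y \<in> ball z (r z) \<longrightarrow> \<bar>v y\<bar> \<le> \<epsilon>"
    using Z rv by (intro AE_finite_allI) auto
  with H0_zero[OF weak_sol_H0[OF sol]] have "AE y in lborel. (\<exists>x. x \<notin> \<Omega> \<and> dist x y < \<delta>) \<longrightarrow> \<bar>v y\<bar> \<le> \<epsilon>"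
  proof eventually_elim
    case (elim y)
    show ?case
    proof (intro impI, elim exE conjE)
      fix x assume x: "x \<notin> \<Omega>" "dist x y < \<delta>"
      show "\<bar>v y\<bar> \<le> \<epsilon>"
      proof (cases "y \<in> \<Omega>")
        case False then show ?thesis using elim \<epsilon> by simp
      next
        case True
        have "closed_segment x y \<inter> frontier \<Omega> \<noteq> {}"
          by (rule connected_Int_frontier) (use True x in auto)
        then obtain f where f: "f \<in> closed_segment x y" "f \<in> frontier \<Omega>" by blast
        have fy: "dist f y \<le> dist x y" using segment_bound(2)[OF f(1)] by (simp add: dist_norm norm_minus_commute)
        obtain z where z: "z \<in> Z" "f \<in> ball z (r z / 2)" using Z(3) f(2) by blast
        have "dist z y < r z" using dist_triangle[of z y f] fy x(2) z(2) \<delta>Z[OF z(1)] by simp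
        then have "y \<in> ball z (r z)" by simp
        then show ?thesis using elim(2) z(1) by blast
      qed
    qed
  qed
  then show ?thesis using that \<delta> by blast
qed

text \<open>If one of \<open>x\<close>, \<open>x + h\<close> is outside, both values are small by
  uniform decay; if both are inside, uniform continuity of \<open>g\<close> on the compact closure
  makes the datum of the difference small. The shift \<open>- h\<close> supplies the other
  sign.\<close>

lemma weak_sol_equicontinuous_of_continuous:
  fixes \<Omega> :: "'a::euclidean_space set"
  assumes s: "0 < s" "s < 1" and \<Omega>: "open \<Omega>" "bounded \<Omega>"
    and ext: "\<And>z. z \<in> frontier \<Omega> \<Longrightarrow> \<exists>\<rho>>0. exterior_ball_at \<rho> \<Omega> z"
    and sol: "weak_sol s \<Omega> v (\<lambda>x. indicator \<Omega> x * g x)" and g: "continuous_on UNIV g" and gM: "\<And>x. \<bar>g x\<bar> \<le> M"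
  shows "AE_equicontinuous v"
  unfolding AE_equicontinuous_def
proof (intro allI impI)
  fix \<epsilon> :: real assume \<epsilon>: "0 < \<epsilon>"
  have \<Omega>b[measurable]: "\<Omega> \<in> sets borel" using \<Omega>(1) by simp
  have fin: "emeasure lborel \<Omega> < \<infinity>" using \<Omega>(2) by (rule emeasure_bounded_finite)
  have [measurable]: "g \<in> borel_measurable borel" using g by (rule borel_measurable_continuous_onI)
  have G: "(\<lambda>x. indicator \<Omega> x * g x) \<in> borel_measurable borel" by measurable
  have M: "0 \<le> M" using gM[of undefined] by linarith
  have GM: "\<bar>indicator \<Omega> x * g x\<bar> \<le> M" for x using gM[of x] M by (auto simp: indicator_def)
  obtain C where C: "0 \<le> C" and T: "\<And>h \<epsilon> \<sigma>. 0 \<le> \<epsilon> \<Longrightarrow> 0 \<le> \<sigma> \<Longrightarrow> AE x in lborel. x \<notin> \<Omega> \<or> x + h \<notin> \<Omega> \<longrightarrow> v (x + h) - v x \<le> \<epsilon> \<Longrightarrow>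
      \<forall>x. x \<in> \<Omega> \<longrightarrow> x + h \<in> \<Omega> \<longrightarrow> indicator \<Omega> (x + h) * g (x + h) - indicator \<Omega> x * g x \<le> \<sigma> \<Longrightarrow>
      AE x in lborel. v (x + h) - v x \<le> \<epsilon> + C * \<sigma>"
    by (rule weak_sol_translate_le[OF s(1) \<Omega>b fin sol G GM]) (rule that)
  \<comment> \<open>Splits \<open>\<epsilon>\<close> between the boundary error and \<open>C\<close>
    times the error of the datum.\<close>
  define e where "e = \<epsilon> / (1 + C)"
  have "e * (1 + C) = \<epsilon>" using C by (simp add: e_def)
  then have "e + C * e = \<epsilon>" by (simp only: algebra_simps)
  moreover have "e > 0" using \<epsilon> C by (simp add: e_def)
  ultimately have e: "e > 0" "e + C * e = \<epsilon>" by blast+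
  obtain \<delta>1 where \<delta>1: "\<delta>1 > 0" "AE y in lborel. (\<exists>x. x \<notin> \<Omega> \<and> dist x y < \<delta>1) \<longrightarrow> \<bar>v y\<bar> \<le> e"
    by (rule weak_sol_uniform_decay[OF s \<Omega> ext sol G GM _ e(1)]) auto
  have "uniformly_continuous_on (closure \<Omega>) g"
    using \<Omega>(2) g by (intro compact_uniformly_continuous continuous_on_subset[OF g]) auto
  then obtain \<delta>2 where \<delta>2: "\<delta>2 > 0" "\<And>x y. x \<in> closure \<Omega> \<Longrightarrow> y \<in> closure \<Omega> \<Longrightarrow> dist y x < \<delta>2 \<Longrightarrow> dist (g y) (g x) < e"
    using e(1) unfolding uniformly_continuous_on_def by metis
  define \<delta> where "\<delta> = min \<delta>1 \<delta>2"
  have one: "AE x in lborel. v (x + h) - v x \<le> \<epsilon>" if h: "norm h < \<delta>" for h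
    unfolding e(2)[symmetric]
  proof (rule T)
    show "AE x in lborel. x \<notin> \<Omega> \<or> x + h \<notin> \<Omega> \<longrightarrow> v (x + h) - v x \<le> e"
      using H0_zero[OF weak_sol_H0[OF sol]] AE_lborel_translate[OF H0_zero[OF weak_sol_H0[OF sol]], of h]
        \<delta>1(2) AE_lborel_translate[OF \<delta>1(2), of h]
    proof eventually_elim
      case (elim x)
      show ?case
      proof (intro impI, elim disjE)
        assume x: "x \<notin> \<Omega>"
        then have "\<bar>v (x + h)\<bar> \<le> e" using elim(4) h by (auto simp: \<delta>_def dist_norm)
        then show "v (x + h) - v x \<le> e" using elim(1) x by simp
      next
        assume x: "x + h \<notin> \<Omega>"
        then have "\<bar>v x\<bar> \<le> e" using elim(3) h by (auto simp: \<delta>_def dist_norm)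
        then show "v (x + h) - v x \<le> e" using elim(2) x by simp
      qed
    qed
    show "\<forall>x. x \<in> \<Omega> \<longrightarrow> x + h \<in> \<Omega> \<longrightarrow> indicator \<Omega> (x + h) * g (x + h) - indicator \<Omega> x * g x \<le> e"
    proof (intro allI impI)
      fix x assume "x \<in> \<Omega>" "x + h \<in> \<Omega>"
      then have "dist (g (x + h)) (g x) < e"
        using h closure_subset[of \<Omega>] by (intro \<delta>2(2)) (auto simp: \<delta>_def dist_norm)
      then show "indicator \<Omega> (x + h) * g (x + h) - indicator \<Omega> x * g x \<le> e"
        using \<open>x \<in> \<Omega>\<close> \<open>x + h \<in> \<Omega>\<close> by (simp add: dist_real_def)
    qed
  qed (use e in auto)
  have "AE x in lborel. \<bar>v (x + h) - v x\<bar> \<le> \<epsilon>" if h: "norm h < \<delta>" for h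
  proof -
    have "AE x in lborel. v (x + h + - h) - v (x + h) \<le> \<epsilon>"
      using one[of "- h"] h by (intro AE_lborel_translate[of "\<lambda>x. v (x + - h) - v x \<le> \<epsilon>"]) simp
    with one[OF h] show ?thesis by eventually_elim auto
  qed
  then show "\<exists>\<delta>>0. \<forall>h. norm h < \<delta> \<longrightarrow> (AE x in lborel. \<bar>v (x + h) - v x\<bar> \<le> \<epsilon>)"
    using \<delta>1(1) \<delta>2(1) by (intro exI[of _ \<delta>]) (auto simp: \<delta>_def)
qed

section \<open>The p-norm of the data\<close>

section \<open>Integral norms\<close>

definition lp_norm :: "real \<Rightarrow> ('a::euclidean_space \<Rightarrow> real) \<Rightarrow> real" where
  "lp_norm p f = (LINT x|lborel. \<bar>f x\<bar> powr p) powr (1 / p)"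

lemma lp_norm_nonneg [simp]: "0 \<le> lp_norm p f"
  by (simp add: lp_norm_def)

lemma lp_norm_uminus [simp]: "lp_norm p (\<lambda>x. - f x) = lp_norm p f"
  by (simp add: lp_norm_def)

lemma young_one:
  fixes u p :: real
  assumes "1 \<le> p" "0 \<le> u" shows "u \<le> u powr p / p + (1 - 1 / p)"
proof (cases "p = 1")
  case False
  define q where "q = p / (p - 1)"
  have "u * 1 \<le> u powr p / p + 1 powr q / q"
    using assms False by (intro Youngs_inequality) (auto simp: q_def field_simps)
  then show ?thesis using assms False by (simp add: q_def field_simps)
qed (use assms in auto)

text \<open>Young's inequality with a free scale \<open>c\<close>, integrated and then optimised in
  \<open>c\<close>. The same computation is valid for p = 1, where the second term drops
  out.\<close>

lemma holder_indicator:
  fixes f :: "'a::euclidean_space \<Rightarrow> real"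
  assumes p: "1 \<le> p" and [measurable]: "f \<in> borel_measurable borel" "A \<in> sets borel"
    and fp: "integrable lborel (\<lambda>x. \<bar>f x\<bar> powr p)" and A: "emeasure lborel A < \<infinity>"
  shows "(LINT x|lborel. indicator A x * \<bar>f x\<bar>) \<le> lp_norm p f * measure lborel A powr (1 - 1 / p)"
    and "integrable lborel (\<lambda>x. indicator A x * \<bar>f x\<bar>)"
proof -
  have young: "t \<le> c * ((1 / (p * c powr p)) * t powr p + (1 - 1 / p))" if "0 \<le> t" "0 < c" for t c :: real
  proof -
    have "t / c \<le> (t / c) powr p / p + (1 - 1 / p)" using that by (intro young_one p) auto
    then have "c * (t / c) \<le> c * ((t / c) powr p / p + (1 - 1 / p))"
      using that by (intro mult_left_mono) auto
    then show ?thesis using that by (simp add: powr_divide mult.commute)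
  qed
  have bnd_int: "integrable lborel (\<lambda>x. c * ((1 / (p * c powr p)) * \<bar>f x\<bar> powr p + (1 - 1 / p) * indicator A x))" for c
    using fp A by (auto simp: integrable_indicator_iff)
  have bnd: "indicator A x * \<bar>f x\<bar> \<le> c * ((1 / (p * c powr p)) * \<bar>f x\<bar> powr p + (1 - 1 / p) * indicator A x)"
    if "0 < c" for x c
    using young[of "\<bar>f x\<bar>" c] that p by (auto simp: indicator_def)
  show int: "integrable lborel (\<lambda>x. indicator A x * \<bar>f x\<bar>)"
  proof (rule Bochner_Integration.integrable_bound[OF bnd_int[of 1]])
    show "AE x in lborel. norm (indicator A x * \<bar>f x\<bar>) \<le>
      norm (1 * (1 / (p * 1 powr p) * \<bar>f x\<bar> powr p + (1 - 1 / p) * indicator A x))"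
    proof (rule AE_I2)
      fix x
      have "0 \<le> indicator A x * \<bar>f x\<bar>" by simp
      with bnd[of 1 x] show "norm (indicator A x * \<bar>f x\<bar>) \<le>
        norm (1 * (1 / (p * 1 powr p) * \<bar>f x\<bar> powr p + (1 - 1 / p) * indicator A x))"
        unfolding real_norm_def by linarith
    qed
  qed measurable
  define I where "I = (LINT x|lborel. \<bar>f x\<bar> powr p)"
  define m where "m = measure lborel A"
  have I: "I \<ge> 0" by (simp add: I_def)
  have le: "(LINT x|lborel. indicator A x * \<bar>f x\<bar>) \<le> c * ((1 / (p * c powr p)) * I + (1 - 1 / p) * m)" if "0 < c" for c
  proof -
    have "(LINT x|lborel. indicator A x * \<bar>f x\<bar>) \<le>
        (LINT x|lborel. c * ((1 / (p * c powr p)) * \<bar>f x\<bar> powr p + (1 - 1 / p) * indicator A x))"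
      by (intro integral_mono int bnd_int bnd that)
    also have "\<dots> = c * ((1 / (p * c powr p)) * I + (1 - 1 / p) * m)"
      using fp A by (simp add: I_def m_def integrable_indicator_iff)
    finally show ?thesis .
  qed
  show "(LINT x|lborel. indicator A x * \<bar>f x\<bar>) \<le> lp_norm p f * measure lborel A powr (1 - 1 / p)"
  proof (cases "m = 0 \<or> I = 0")
    case True
    have "AE x in lborel. indicator A x * \<bar>f x\<bar> = 0"
    proof (cases "m = 0")
      case True
      then have "AE x in lborel. x \<notin> A"
        using A by (intro AE_not_in) (auto simp: m_def emeasure_eq_ennreal_measure)
      then show ?thesis by eventually_elim auto
    next
      case False
      then have "I = 0" using True by simp
      then have "AE x in lborel. \<bar>f x\<bar> powr p = 0"
        unfolding I_def using integral_nonneg_eq_0_iff_AE[OF fp] by simp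
      then show ?thesis by eventually_elim auto
    qed
    then have "(LINT x|lborel. indicator A x * \<bar>f x\<bar>) = 0" by (rule integral_eq_zero_AE)
    then show ?thesis by simp
  next
    case False
    then have m: "m > 0" and I0: "I > 0" using I by (auto simp: m_def zero_less_measure_iff)
    \<comment> \<open>The minimising scale: with it the two terms of Young's bound add up to
      \<open>c * m\<close>. It is positive only when \<open>m\<close> and \<open>I\<close> are,
      hence the separate degenerate cases.\<close>
    define c where "c = (I / m) powr (1 / p)"
    have l: "c > 0" using m I0 by (simp add: c_def)
    have lp: "c powr p = I / m" using m I0 p by (simp add: c_def powr_powr)
    have "c * ((1 / (p * c powr p)) * I + (1 - 1 / p) * m) = c * m"
      using m I0 p unfolding lp by (simp add: field_simps)
    also have "\<dots> = I powr (1 / p) * m powr (1 - 1 / p)"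
      using m I0 by (simp add: c_def powr_divide powr_diff)
    finally show ?thesis using le[OF l] by (simp add: lp_norm_def I_def m_def)
  qed
qed

lemma lp_norm_tendsto_zero:
  fixes f :: "nat \<Rightarrow> 'a::euclidean_space \<Rightarrow> real"
  assumes p: "1 \<le> p" and [measurable]: "\<And>n. f n \<in> borel_measurable borel"
    and b: "integrable lborel (\<lambda>x. b x powr p)" and le: "\<And>n x. \<bar>f n x\<bar> \<le> b x"
    and lim: "AE x in lborel. (\<lambda>n. f n x) \<longlonglongrightarrow> 0"
  shows "(\<lambda>n. lp_norm p (f n)) \<longlonglongrightarrow> 0"
proof -
  have "(\<lambda>n. LINT x|lborel. \<bar>f n x\<bar> powr p) \<longlonglongrightarrow> (LINT x|(lborel :: 'a measure). 0)"
  proof (rule integral_dominated_convergence[OF _ _ b])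
    show "AE x in lborel. (\<lambda>n. \<bar>f n x\<bar> powr p) \<longlonglongrightarrow> 0"
      using lim
    proof eventually_elim
      case (elim x)
      have "(\<lambda>n. \<bar>f n x\<bar> powr p) \<longlonglongrightarrow> \<bar>0\<bar> powr p"
        using p by (intro tendsto_powr' tendsto_rabs elim tendsto_const) auto
      then show ?case by simp
    qed
    show "AE x in lborel. norm (\<bar>f n x\<bar> powr p) \<le> b x powr p" for n
      using le p by (auto intro!: powr_mono2)
  qed measurable
  then have "(\<lambda>n. LINT x|lborel. \<bar>f n x\<bar> powr p) \<longlonglongrightarrow> 0" by simp
  then have "(\<lambda>n. (LINT x|lborel. \<bar>f n x\<bar> powr p) powr (1 / p)) \<longlonglongrightarrow> 0 powr (1 / p)"
    using p by (intro tendsto_powr' tendsto_const) auto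
  then show ?thesis by (simp add: lp_norm_def)
qed

section \<open>The inverse operator on bounded data and its transpose\<close>

section \<open>The Green operator\<close>

lemma AE_le_imp_le:
  fixes f :: "'a::euclidean_space \<Rightarrow> real"
  assumes "continuous_on UNIV f" "AE x in lborel. f x \<le> c" shows "f x \<le> c"
proof -
  have "open {x. c < f x}" using assms(1) by (intro open_Collect_less continuous_on_const)
  moreover have "AE x in lborel. x \<notin> {x. c < f x}" using assms(2) by eventually_elim auto
  ultimately have "{x. c < f x} = {}" by (rule open_AE_empty)
  then show ?thesis by (auto simp: not_less)
qed

lemma H0_AE_cong:
  assumes u: "u \<in> H0 s \<Omega>" and [measurable]: "v \<in> borel_measurable borel" and eq: "AE x in lborel. u x = v x"
  shows "v \<in> H0 s \<Omega>" "w \<in> Hs s \<Longrightarrow> gagliardo s v w = gagliardo s u w"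
proof -
  have uH: "u \<in> Hs s" using u by (simp add: H0_def)
  note [measurable] = Hs_measurable[OF uH]
  have eq2: "AE p in lborel2. incr v p = incr u p"
    using AE_lborel2_fst[OF eq] AE_lborel2_snd[OF eq] by eventually_elim (simp add: incr_def)
  have "integrable lborel (\<lambda>x. (v x)\<^sup>2)"
    by (rule integrable_cong_AE_imp[OF Hs_integrable_square[OF uH]]) (use eq in \<open>auto elim!: eventually_mono\<close>)
  moreover have "integrable lborel2 (\<lambda>p. (incr v p)\<^sup>2 * pair_kernel s p)"
    by (rule integrable_cong_AE_imp[OF Hs_integrable_energy[OF uH]]) (use eq2 in \<open>auto elim!: eventually_mono\<close>)
  moreover have "AE x in lborel. x \<notin> \<Omega> \<longrightarrow> v x = 0"
    using eq H0_zero[OF u] by eventually_elim auto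
  ultimately show "v \<in> H0 s \<Omega>" by (simp add: H0_def Hs_def)
  assume "w \<in> Hs s"
  note [measurable] = Hs_measurable[OF this]
  show "gagliardo s v w = gagliardo s u w" unfolding gagliardo_def
    using eq2 by (intro Bochner_Integration.integral_cong_AE) (auto elim!: eventually_mono)
qed

text \<open>The second condition on p says that \<open>\<gamma> = 1 - 1 / p\<close> satisfies
  \<open>1 < \<gamma> + 2 * s / N\<close>, the superlinearity required by truncation. The three
  ranges of the dimension in the theorem all lead to it.\<close>

locale exterior_domain =
  fixes s p :: real and \<Omega> :: "'a::euclidean_space set"
  assumes s: "0 < s" "s < 1" and open_domain: "open \<Omega>" and bounded_domain: "bounded \<Omega>"
    and exterior: "\<And>z. z \<in> frontier \<Omega> \<Longrightarrow> \<exists>\<rho>>0. exterior_ball_at \<rho> \<Omega> z"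
    and p: "1 \<le> p" "1 / p < 2 * s / real DIM('a)"
begin

definition bdd_data :: "('a \<Rightarrow> real) \<Rightarrow> bool" where
  "bdd_data g \<longleftrightarrow> g \<in> borel_measurable borel \<and> (\<exists>M. \<forall>x. \<bar>g x\<bar> \<le> M) \<and> (\<forall>x. x \<notin> \<Omega> \<longrightarrow> g x = 0)"

definition green_sol :: "('a \<Rightarrow> real) \<Rightarrow> ('a \<Rightarrow> real) \<Rightarrow> bool" where
  "green_sol g v \<longleftrightarrow> v \<in> H0 s \<Omega> \<and> (\<forall>w\<in>H0 s \<Omega>. gagliardo s v w = (LINT x|lborel. g x * w x)) \<and>
     continuous_on UNIV v \<and> (\<forall>x. x \<notin> \<Omega> \<longrightarrow> v x = 0)"

lemma domain_measurable [measurable]: "\<Omega> \<in> sets borel"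
  using open_domain by simp

lemma domain_finite: "emeasure lborel \<Omega> < \<infinity>"
  using bounded_domain by (rule emeasure_bounded_finite)

lemma bdd_data_measurable: "bdd_data g \<Longrightarrow> g \<in> borel_measurable borel"
  by (simp add: bdd_data_def)

lemma bdd_data_integrable:
  assumes "bdd_data g" shows "integrable lborel g"
proof -
  obtain M where "\<And>x. \<bar>g x\<bar> \<le> M" using assms by (auto simp: bdd_data_def)
  then show ?thesis
    using assms by (intro integrable_bounded_support[OF domain_measurable _ domain_finite, of _ M]) (auto simp: bdd_data_def)
qed

lemma bdd_data_powr_integrable:
  assumes "bdd_data g" shows "integrable lborel (\<lambda>x. \<bar>g x\<bar> powr p)"
proof -
  obtain M where M: "\<And>x. \<bar>g x\<bar> \<le> M" using assms by (auto simp: bdd_data_def)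
  have [measurable]: "g \<in> borel_measurable borel" using assms by (simp add: bdd_data_def)
  show ?thesis
  proof (rule integrable_bounded_support[OF domain_measurable _ domain_finite, of _ "M powr p"])
    show "AE x in lborel. \<bar>\<bar>g x\<bar> powr p\<bar> \<le> M powr p" using M p by (auto intro!: powr_mono2)
    show "AE x in lborel. x \<notin> \<Omega> \<longrightarrow> \<bar>g x\<bar> powr p = 0" using assms by (auto simp: bdd_data_def)
  qed measurable
qed

lemma bdd_data_add: "bdd_data f \<Longrightarrow> bdd_data g \<Longrightarrow> bdd_data (\<lambda>x. f x + g x)"
  unfolding bdd_data_def
  by (auto intro!: borel_measurable_add) (meson abs_triangle_ineq add_mono order_trans)

lemma bdd_data_cmult: "bdd_data f \<Longrightarrow> bdd_data (\<lambda>x. c * f x)"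
  unfolding bdd_data_def
  by (auto intro!: borel_measurable_times simp: abs_mult) (meson abs_ge_zero mult_left_mono)

lemma bdd_data_diff: "bdd_data f \<Longrightarrow> bdd_data g \<Longrightarrow> bdd_data (\<lambda>x. f x - g x)"
  using bdd_data_add[of f "\<lambda>x. -1 * g x"] bdd_data_cmult[of g "-1"] by simp

lemma bdd_data_restrict:
  assumes "u \<in> borel_measurable borel" "\<And>x. \<bar>u x\<bar> \<le> M"
  shows "bdd_data (\<lambda>x. indicator \<Omega> x * u x)"
proof -
  have "0 \<le> M" using assms(2)[of undefined] by linarith
  then have "\<bar>indicator \<Omega> x * u x\<bar> \<le> M" for x using assms(2)[of x] by (auto simp: indicator_def)
  then show ?thesis using assms(1) unfolding bdd_data_def by (auto intro!: borel_measurable_times)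
qed

lemma bdd_data_indicator: "A \<in> sets borel \<Longrightarrow> bdd_data (indicator (A \<inter> \<Omega>))"
  unfolding bdd_data_def by (auto intro!: exI[of _ 1] simp: indicator_def)

lemma sup_bound_exists:
  "\<exists>C\<ge>0. \<forall>v f. weak_sol s \<Omega> v f \<longrightarrow> integrable lborel f \<longrightarrow> integrable lborel (\<lambda>x. \<bar>f x\<bar> powr p) \<longrightarrow>
    (AE x in lborel. \<bar>v x\<bar> \<le> C * lp_norm p f)"
proof -
  have \<gamma>: "1 < (1 - 1 / p) + 2 * s / real DIM('a)" using p by simp
  obtain C where C: "0 \<le> C" and L: "\<And>v f F. weak_sol s \<Omega> v f \<Longrightarrow> integrable lborel f \<Longrightarrow> 0 \<le> F \<Longrightarrow>
      \<forall>A\<in>sets borel. A \<subseteq> \<Omega> \<longrightarrow> (LINT x|lborel. indicator A x * max (f x) 0) \<le> F * measure lborel A powr (1 - 1 / p) \<Longrightarrow>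
      AE x in lborel. v x \<le> C * F"
    by (rule weak_sol_le[OF s(1) domain_measurable domain_finite \<gamma>]) (rule that)
  have one: "AE x in lborel. v x \<le> C * lp_norm p f"
    if sol: "weak_sol s \<Omega> v f" and f: "integrable lborel f" and fp: "integrable lborel (\<lambda>x. \<bar>f x\<bar> powr p)" for v f
  proof (rule L[OF sol f lp_norm_nonneg], intro ballI impI)
    have [measurable]: "f \<in> borel_measurable borel" using f by auto
    fix A assume A[measurable]: "A \<in> sets borel" and AO: "A \<subseteq> \<Omega>"
    have Af: "emeasure lborel A < \<infinity>" using AO domain_finite by (auto intro: le_less_trans[OF emeasure_mono])
    note H = holder_indicator[OF p(1) _ A fp Af]
    have "(LINT x|lborel. indicator A x * max (f x) 0) \<le> (LINT x|lborel. indicator A x * \<bar>f x\<bar>)"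
    proof (rule integral_mono)
      show "integrable lborel (\<lambda>x. indicator A x * max (f x) 0)"
        using f by (intro integrable_mult_bounded[where B=1] integrable_max) (auto simp: indicator_def)
      show "integrable lborel (\<lambda>x. indicator A x * \<bar>f x\<bar>)" by (rule H(2)) measurable
    qed (auto simp: indicator_def)
    also have "\<dots> \<le> lp_norm p f * measure lborel A powr (1 - 1 / p)" by (rule H(1)) measurable
    finally show "(LINT x|lborel. indicator A x * max (f x) 0) \<le> lp_norm p f * measure lborel A powr (1 - 1 / p)" .
  qed
  have "AE x in lborel. \<bar>v x\<bar> \<le> C * lp_norm p f"
    if sol: "weak_sol s \<Omega> v f" and f: "integrable lborel f" and fp: "integrable lborel (\<lambda>x. \<bar>f x\<bar> powr p)" for v f
    using one[OF sol f fp] one[OF weak_sol_uminus[OF sol]] f fp by (auto elim!: eventually_elim2)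
  then show ?thesis using C by blast
qed

text \<open>Fixed once for the domain, so that the final constant depends on neither datum nor
  measure.\<close>

definition sup_const :: real where
  "sup_const = (SOME C. 0 \<le> C \<and> (\<forall>v f. weak_sol s \<Omega> v f \<longrightarrow> integrable lborel f \<longrightarrow>
    integrable lborel (\<lambda>x. \<bar>f x\<bar> powr p) \<longrightarrow> (AE x in lborel. \<bar>v x\<bar> \<le> C * lp_norm p f)))"

lemma sup_const_nonneg: "0 \<le> sup_const"
  and sup_bound: "weak_sol s \<Omega> v f \<Longrightarrow> integrable lborel f \<Longrightarrow> integrable lborel (\<lambda>x. \<bar>f x\<bar> powr p) \<Longrightarrow>
    AE x in lborel. \<bar>v x\<bar> \<le> sup_const * lp_norm p f"
  using someI_ex[OF sup_bound_exists[unfolded Bex_def]] unfolding sup_const_def[symmetric] by blast+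

text \<open>The datum of \<open>- v\<close> has zero positive part, so the truncation bound applies
  to \<open>- v\<close> with \<open>F = 0\<close>.\<close>

lemma weak_maximum_principle:
  assumes sol: "weak_sol s \<Omega> v f" and f: "integrable lborel f" and f0: "\<And>x. 0 \<le> f x"
  shows "AE x in lborel. 0 \<le> v x"
proof -
  have \<gamma>: "1 < 1 + 2 * s / real DIM('a)" using s by simp
  obtain C where C: "0 \<le> C" and L: "\<And>v f F. weak_sol s \<Omega> v f \<Longrightarrow> integrable lborel f \<Longrightarrow> 0 \<le> F \<Longrightarrow>
      \<forall>A\<in>sets borel. A \<subseteq> \<Omega> \<longrightarrow> (LINT x|lborel. indicator A x * max (f x) 0) \<le> F * measure lborel A powr 1 \<Longrightarrow>
      AE x in lborel. v x \<le> C * F"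
    by (rule weak_sol_le[OF s(1) domain_measurable domain_finite \<gamma>]) (rule that)
  have "max (- f x) 0 = 0" for x using f0[of x] by simp
  then have "AE x in lborel. - v x \<le> C * 0"
    using f by (intro L[OF weak_sol_uminus[OF sol]]) auto
  then show ?thesis by eventually_elim auto
qed

text \<open>The datum is replaced by a continuous one that is close in the p-norm only. The sup
  bound makes the two solutions uniformly close, and the modulus of the continuous case passes over
  with three errors of size \<open>\<epsilon> / 3\<close>.\<close>

lemma weak_sol_equicontinuous:
  assumes sol: "weak_sol s \<Omega> v g" and g: "bdd_data g"
  shows "AE_equicontinuous v"
  unfolding AE_equicontinuous_def
proof (intro allI impI)
  fix \<epsilon> :: real assume \<epsilon>: "0 < \<epsilon>"
  obtain M where M: "\<And>x. \<bar>g x\<bar> \<le> M" using g by (auto simp: bdd_data_def)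
  have M0: "0 \<le> M" using M[of undefined] by linarith
  have gm[measurable]: "g \<in> borel_measurable borel" using g by (simp add: bdd_data_def)
  have "g measurable_on UNIV"
    by (intro lebesgue_measurable_imp_measurable_on measurable_completion) auto
  then obtain N h where N: "negligible N" and h: "\<And>n. continuous_on UNIV (h n)"
    and lim: "\<And>x. x \<notin> N \<Longrightarrow> (\<lambda>n. h n x) \<longlonglongrightarrow> g x"
    unfolding measurable_on_def by auto
  have "AE x in lebesgue. x \<notin> N" using N by (intro AE_not_in) (simp add: negligible_iff_null_sets)
  then have N': "AE x in lborel. x \<notin> N" by (simp add: AE_completion_iff)
  \<comment> \<open>The continuous approximations converge merely almost everywhere; clipping them
    at the bound of \<open>g\<close> preserves the limit and provides the dominating
    function.\<close>
  define k where "k n x = max (- M) (min M (h n x))" for n x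
  have k: "continuous_on UNIV (k n)" for n unfolding k_def by (intro continuous_intros h)
  have kM: "\<bar>k n x\<bar> \<le> M" for n x using M0 by (auto simp: k_def)
  have [measurable]: "k n \<in> borel_measurable borel" for n by (rule borel_measurable_continuous_onI[OF k])
  define G where "G n x = indicator \<Omega> x * k n x" for n x
  have G: "bdd_data (G n)" for n unfolding G_def by (rule bdd_data_restrict) (auto intro: kM)
  have "(\<lambda>n. lp_norm p (\<lambda>x. g x - G n x)) \<longlonglongrightarrow> 0"
  proof (rule lp_norm_tendsto_zero[OF p(1), where b="\<lambda>x. 2 * M * indicator \<Omega> x"])
    show "(\<lambda>x. g x - G n x) \<in> borel_measurable borel" for n unfolding G_def by measurable
    have "integrable lborel (\<lambda>x. (2 * M) powr p * indicator \<Omega> x)"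
      using domain_finite by (simp add: integrable_indicator_iff)
    also have "(\<lambda>x. (2 * M) powr p * indicator \<Omega> x) = (\<lambda>x. (2 * M * indicator \<Omega> x) powr p)"
      by (auto simp: indicator_def)
    finally show "integrable lborel (\<lambda>x. (2 * M * indicator \<Omega> x) powr p)" .
    show "\<bar>g x - G n x\<bar> \<le> 2 * M * indicator \<Omega> x" for n x
      using M[of x] kM[of n x] g by (auto simp: G_def bdd_data_def indicator_def)
    show "AE x in lborel. (\<lambda>n. g x - G n x) \<longlonglongrightarrow> 0"
      using N'
    proof eventually_elim
      case (elim x)
      have "(\<lambda>n. k n x) \<longlonglongrightarrow> max (- M) (min M (g x))"
        unfolding k_def by (intro tendsto_intros lim elim)
      also have "max (- M) (min M (g x)) = g x" using M[of x] by auto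
      finally have "(\<lambda>n. g x - indicator \<Omega> x * k n x) \<longlonglongrightarrow> g x - indicator \<Omega> x * g x"
        by (intro tendsto_intros)
      also have "g x - indicator \<Omega> x * g x = 0" using g by (auto simp: bdd_data_def indicator_def)
      finally show ?case by (simp add: G_def)
    qed
  qed
  then have "(\<lambda>n. sup_const * lp_norm p (\<lambda>x. g x - G n x)) \<longlonglongrightarrow> sup_const * 0" by (intro tendsto_intros)
  then have "\<forall>\<^sub>F n in sequentially. sup_const * lp_norm p (\<lambda>x. g x - G n x) < \<epsilon> / 3"
    using \<epsilon> by (intro order_tendstoD(2)) auto
  then obtain n where n: "sup_const * lp_norm p (\<lambda>x. g x - G n x) < \<epsilon> / 3" by (auto simp: eventually_sequentially)
  obtain u where u: "u \<in> H0 s \<Omega>" "\<And>w. w \<in> H0 s \<Omega> \<Longrightarrow> gagliardo s u w = (LINT x|lborel. G n x * w x)"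
  proof (rule weak_solution_exists[OF s(1) domain_measurable domain_finite, of "G n" M])
    show "\<bar>G n x\<bar> \<le> M" for x using kM[of n x] M0 by (auto simp: G_def indicator_def)
  qed (use G[of n] in \<open>auto simp: bdd_data_def\<close>)
  have usol: "weak_sol s \<Omega> u (G n)" using u by (simp add: weak_sol_def)
  have "AE_equicontinuous u"
    by (rule weak_sol_equicontinuous_of_continuous[OF s open_domain bounded_domain exterior usol[unfolded G_def] k kM])
  then obtain \<delta> where \<delta>: "\<delta> > 0" "\<And>h. norm h < \<delta> \<Longrightarrow> AE x in lborel. \<bar>u (x + h) - u x\<bar> \<le> \<epsilon> / 3"
    using \<epsilon> unfolding AE_equicontinuous_def by (meson divide_pos_pos zero_less_numeral)
  have "AE x in lborel. \<bar>v x - u x\<bar> \<le> sup_const * lp_norm p (\<lambda>x. g x - G n x)"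
    using g G[of n] by (intro sup_bound weak_sol_diff sol usol bdd_data_integrable bdd_data_powr_integrable Bochner_Integration.integrable_diff bdd_data_diff)
  then have close: "AE x in lborel. \<bar>v x - u x\<bar> \<le> \<epsilon> / 3" using n by (auto elim!: eventually_mono)
  have "AE x in lborel. \<bar>v (x + h) - v x\<bar> \<le> \<epsilon>" if h: "norm h < \<delta>" for h
    using close AE_lborel_translate[OF close, of h] \<delta>(2)[OF h] by eventually_elim linarith
  then show "\<exists>\<delta>>0. \<forall>h. norm h < \<delta> \<longrightarrow> (AE x in lborel. \<bar>v (x + h) - v x\<bar> \<le> \<epsilon>)"
    using \<delta>(1) by blast
qed

lemma green_sol_weak_sol: "green_sol g v \<Longrightarrow> weak_sol s \<Omega> v g"
  by (simp add: green_sol_def weak_sol_def)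

text \<open>It remains to see that the continuous representative vanishes at every point off
  \<open>\<Omega>\<close>, frontier points included. If not, it would stay above half its value on a
  small ball, against the uniform decay.\<close>

lemma green_exists:
  assumes g: "bdd_data g" shows "\<exists>v. green_sol g v"
proof -
  obtain M where M: "\<And>x. \<bar>g x\<bar> \<le> M" using g by (auto simp: bdd_data_def)
  have gm[measurable]: "g \<in> borel_measurable borel" and g0: "\<And>x. x \<notin> \<Omega> \<Longrightarrow> g x = 0" using g by (auto simp: bdd_data_def)
  obtain u where u: "u \<in> H0 s \<Omega>" "\<And>w. w \<in> H0 s \<Omega> \<Longrightarrow> gagliardo s u w = (LINT x|lborel. g x * w x)"
  proof (rule weak_solution_exists[OF s(1) domain_measurable domain_finite gm M])
    show "g x = 0" if "x \<notin> \<Omega>" for x by (rule g0[OF that])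
  qed (rule that)
  have usol: "weak_sol s \<Omega> u g" using u by (simp add: weak_sol_def)
  obtain B where B: "AE x in lborel. \<bar>u x\<bar> \<le> B"
    by (rule weak_sol_bounded[OF s(1) domain_measurable domain_finite usol gm M g0])
  have ui: "integrable lborel u"
    by (rule integrable_bounded_support[OF domain_measurable _ domain_finite B H0_zero[OF u(1)]])
      (use u(1) in \<open>auto dest: H0_Hs Hs_measurable\<close>)
  obtain v where v: "continuous_on UNIV v" "AE x in lborel. u x = v x"
    by (rule continuous_representative[OF ui weak_sol_equicontinuous[OF usol g]])
  have vm: "v \<in> borel_measurable borel" using v(1) by (rule borel_measurable_continuous_onI)
  have "v x = 0" if x: "x \<notin> \<Omega>" for x
  proof (rule ccontr)
    assume "v x \<noteq> 0"
    then have e: "\<bar>v x\<bar> / 2 > 0" by simp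
    obtain \<delta> where \<delta>: "0 < \<delta>" "AE y in lborel. (\<exists>x. x \<notin> \<Omega> \<and> dist x y < \<delta>) \<longrightarrow> \<bar>u y\<bar> \<le> \<bar>v x\<bar> / 2"
      by (rule weak_sol_uniform_decay[OF s open_domain bounded_domain exterior usol gm M g0 e])
    define U where "U = ball x \<delta> \<inter> {y. \<bar>v x\<bar> / 2 < \<bar>v y\<bar>}"
    have "U = {}"
    proof (rule open_AE_empty)
      show "open U" unfolding U_def using v(1)
        by (intro open_Int open_ball open_Collect_less continuous_intros)
      show "AE y in lborel. y \<notin> U" using \<delta>(2) v(2)
        by eventually_elim (use x in \<open>force simp: U_def\<close>)
    qed
    moreover have "x \<in> U" using \<delta>(1) e by (simp add: U_def)
    ultimately show False by blast
  qed
  then have "green_sol g v"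
    using H0_AE_cong[OF u(1) vm v(2)] u(2) v(1) by (auto simp: green_sol_def H0_def)
  then show ?thesis by blast
qed

definition green :: "('a \<Rightarrow> real) \<Rightarrow> 'a \<Rightarrow> real" where
  "green g = (SOME v. green_sol g v)"

lemma green_sol_green: "bdd_data g \<Longrightarrow> green_sol g (green g)"
  unfolding green_def by (rule someI_ex[OF green_exists])

lemma green_sol_bound:
  assumes "green_sol g v" "bdd_data g" shows "\<bar>v x\<bar> \<le> sup_const * lp_norm p g"
proof (rule AE_le_imp_le[where f="\<lambda>x. \<bar>v x\<bar>"])
  show "continuous_on UNIV (\<lambda>x. \<bar>v x\<bar>)" using assms by (auto simp: green_sol_def intro!: continuous_intros)
  show "AE x in lborel. \<bar>v x\<bar> \<le> sup_const * lp_norm p g"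
    using assms by (intro sup_bound green_sol_weak_sol bdd_data_integrable bdd_data_powr_integrable)
qed

lemma green_sol_diff:
  assumes "green_sol f u" "green_sol g v" "bdd_data f" "bdd_data g"
  shows "green_sol (\<lambda>x. f x - g x) (\<lambda>x. u x - v x)"
  unfolding green_sol_def
proof (intro conjI ballI allI impI)
  show "(\<lambda>x. u x - v x) \<in> H0 s \<Omega>" using assms by (auto simp: green_sol_def intro: H0_diff)
  show "continuous_on UNIV (\<lambda>x. u x - v x)" using assms by (auto simp: green_sol_def intro!: continuous_intros)
  show "u x - v x = 0" if "x \<notin> \<Omega>" for x using assms that by (auto simp: green_sol_def)
  fix w assume w: "w \<in> H0 s \<Omega>"
  have "integrable lborel (\<lambda>x. f x * w x)" if f: "bdd_data f" for f
  proof (rule integrable_mult_squares)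
    obtain M where M: "\<And>x. \<bar>f x\<bar> \<le> M" using f by (auto simp: bdd_data_def)
    have "(f x)\<^sup>2 \<le> M\<^sup>2" for x using M[of x] by (intro power2_le_iff_abs_le[THEN iffD2]) auto
    then show "integrable lborel (\<lambda>x. (f x)\<^sup>2)"
      using f by (intro integrable_bounded_support[OF domain_measurable _ domain_finite, of _ "M\<^sup>2"]) (auto simp: bdd_data_def)
  qed (use w f in \<open>auto dest: H0_Hs Hs_measurable Hs_integrable_square bdd_data_measurable\<close>)
  then have "(LINT x|lborel. (f x - g x) * w x) = (LINT x|lborel. f x * w x) - (LINT x|lborel. g x * w x)"
    using assms by (simp add: left_diff_distrib)
  moreover have "gagliardo s (\<lambda>x. u x - v x) w = gagliardo s u w - gagliardo s v w"
    using assms w by (intro gagliardo_diff_left) (auto simp: green_sol_def dest: H0_Hs)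
  ultimately show "gagliardo s (\<lambda>x. u x - v x) w = (LINT x|lborel. (f x - g x) * w x)"
    using assms w by (simp add: green_sol_def)
qed

text \<open>The difference of two solutions has datum 0, and the sup bound holds at every point, so
  they agree everywhere.\<close>

lemma green_sol_unique:
  assumes u: "green_sol g u" and g: "bdd_data g" shows "u = green g"
proof
  fix x
  have "bdd_data (\<lambda>x. g x - g x)" using g by (intro bdd_data_diff)
  then have "\<bar>u x - green g x\<bar> \<le> sup_const * lp_norm p (\<lambda>x. g x - g x)"
    by (intro green_sol_bound green_sol_diff u green_sol_green g)
  then show "u x = green g x" by (simp add: lp_norm_def)
qed

lemma green_diff: "bdd_data f \<Longrightarrow> bdd_data g \<Longrightarrow> green (\<lambda>x. f x - g x) = (\<lambda>x. green f x - green g x)"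
  by (rule green_sol_unique[symmetric]) (auto intro: green_sol_diff green_sol_green bdd_data_diff)

lemma green_cmult:
  assumes g: "bdd_data g" shows "green (\<lambda>x. c * g x) = (\<lambda>x. c * green g x)"
proof (rule green_sol_unique[symmetric])
  have "(LINT x|lborel. c * g x * w x) = c * (LINT x|lborel. g x * w x)" for w
    by (simp add: mult.assoc)
  then show "green_sol (\<lambda>x. c * g x) (\<lambda>x. c * green g x)"
    using green_sol_green[OF g] unfolding green_sol_def
    by (auto intro!: H0_cmult continuous_intros simp: gagliardo_cmult_left)
qed (rule bdd_data_cmult[OF g])

lemma green_add:
  assumes "bdd_data f" "bdd_data g" shows "green (\<lambda>x. f x + g x) = (\<lambda>x. green f x + green g x)"
  using green_diff[OF assms(1) bdd_data_cmult[OF assms(2), of "-1"]] green_cmult[OF assms(2), of "-1"] by simp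

lemma green_bound: "bdd_data g \<Longrightarrow> \<bar>green g x\<bar> \<le> sup_const * lp_norm p g"
  by (intro green_sol_bound green_sol_green)

lemma green_nonneg:
  assumes g: "bdd_data g" "\<And>x. 0 \<le> g x" shows "0 \<le> green g x"
proof -
  have sol: "green_sol g (green g)" using g by (intro green_sol_green)
  then have "continuous_on UNIV (\<lambda>x. - green g x)" by (auto simp: green_sol_def intro!: continuous_intros)
  moreover have "AE x in lborel. - green g x \<le> 0"
    using weak_maximum_principle[OF green_sol_weak_sol[OF sol] bdd_data_integrable[OF g(1)] g(2)]
    by eventually_elim simp
  ultimately have "- green g x \<le> 0" by (rule AE_le_imp_le[where f="\<lambda>x. - green g x"])
  then show ?thesis by simp
qed

lemma green_measurable: "bdd_data g \<Longrightarrow> green g \<in> borel_measurable borel"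
  using green_sol_green[of g] by (auto simp: green_sol_def intro: borel_measurable_continuous_onI)

section \<open>Integrating the Green operator against a measure\<close>

text \<open>The bound of \<open>L\<close> by the p-norm does the measure theory. By dominated
  convergence it makes \<open>L\<close> continuous along bounded pointwise limits, which gives
  countable additivity, and it vanishes on indicators of null sets, which gives absolute continuity.
  The density formula passes from sets to bounded data by induction over nonnegative Borel
  functions.\<close>

lemma green_density:
  assumes m: "finite_measure m" and sets: "sets m = sets (restrict_space borel \<Omega>)"
  obtains f where "integrable lborel f" "\<And>g. bdd_data g \<Longrightarrow> (LINT x|m. green g x) = (LINT x|lborel. f x * g x)"
proof -
  interpret m: finite_measure m by (rule m)
  define L where "L g = (LINT x|m. green g x)" for g
  define K where "K = sup_const * measure m (space m)"
  have meas: "green g \<in> borel_measurable m" if "bdd_data g" for g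
    using measurable_restrict_space1[OF green_measurable[OF that], of \<Omega>] sets measurable_cong_sets[OF sets refl] by blast
  have int: "integrable m (green g)" if "bdd_data g" for g
    using green_bound[OF that] meas[OF that] by (intro m.integrable_const_bound[of _ "sup_const * lp_norm p g"]) auto
  have L_diff: "L (\<lambda>x. f x - g x) = L f - L g" if "bdd_data f" "bdd_data g" for f g
    unfolding L_def green_diff[OF that] using int that by simp
  have L_add: "L (\<lambda>x. f x + g x) = L f + L g" if "bdd_data f" "bdd_data g" for f g
    unfolding L_def green_add[OF that] using int that by simp
  have L_cmult: "L (\<lambda>x. c * g x) = c * L g" if "bdd_data g" for c g
    unfolding L_def green_cmult[OF that] by simp
  have L_bound: "\<bar>L g\<bar> \<le> K * lp_norm p g" if g: "bdd_data g" for g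
  proof -
    have "\<bar>L g\<bar> \<le> (LINT x|m. sup_const * lp_norm p g)"
      unfolding L_def using green_bound[OF g] int[OF g] by (intro integral_abs_le_AE) auto
    then show ?thesis by (simp add: K_def mult_ac)
  qed
  have L_nonneg: "0 \<le> L g" if "bdd_data g" "\<And>x. 0 \<le> g x" for g
    unfolding L_def using green_nonneg[OF that] by simp
  have L_tendsto: "(\<lambda>n. L (h n)) \<longlonglongrightarrow> L g"
    if g: "bdd_data g" and h: "\<And>n. bdd_data (h n)" and M: "\<And>n x. \<bar>h n x\<bar> \<le> M" and gM: "\<And>x. \<bar>g x\<bar> \<le> M"
      and lim: "\<And>x. (\<lambda>n. h n x) \<longlonglongrightarrow> g x" for g h M
  proof -
    have M0: "0 \<le> M" using gM[of undefined] by linarith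
    have "(\<lambda>n. lp_norm p (\<lambda>x. h n x - g x)) \<longlonglongrightarrow> 0"
    proof (rule lp_norm_tendsto_zero[OF p(1), where b="\<lambda>x. 2 * M * indicator \<Omega> x"])
      show "(\<lambda>x. h n x - g x) \<in> borel_measurable borel" for n
        by (rule borel_measurable_diff[OF bdd_data_measurable[OF h] bdd_data_measurable[OF g]])
      have "integrable lborel (\<lambda>x. (2 * M) powr p * indicator \<Omega> x)"
        using domain_finite by (simp add: integrable_indicator_iff)
      also have "(\<lambda>x. (2 * M) powr p * indicator \<Omega> x) = (\<lambda>x. (2 * M * indicator \<Omega> x) powr p)"
        by (auto simp: indicator_def)
      finally show "integrable lborel (\<lambda>x. (2 * M * indicator \<Omega> x) powr p)" .
      show "\<bar>h n x - g x\<bar> \<le> 2 * M * indicator \<Omega> x" for n x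
        using M[of n x] gM[of x] g h[of n] by (auto simp: bdd_data_def indicator_def)
      show "AE x in lborel. (\<lambda>n. h n x - g x) \<longlonglongrightarrow> 0"
        using lim by (intro AE_I2) (simp add: LIM_zero)
    qed
    then have "(\<lambda>n. K * lp_norm p (\<lambda>x. h n x - g x)) \<longlonglongrightarrow> K * 0" by (intro tendsto_intros)
    then have "(\<lambda>n. L (h n) - L g) \<longlonglongrightarrow> 0"
    proof (intro Lim_null_comparison[of "\<lambda>n. L (h n) - L g" "\<lambda>n. K * lp_norm p (\<lambda>x. h n x - g x)"] always_eventually allI)
      show "norm (L (h n) - L g) \<le> K * lp_norm p (\<lambda>x. h n x - g x)" for n
        using L_bound[OF bdd_data_diff[OF h[of n] g]] L_diff[OF h[of n] g] by simp
    qed simp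
    then show ?thesis by (simp add: LIM_zero_iff)
  qed
  \<comment> \<open>Intersecting with \<open>\<Omega>\<close> yields an admissible datum for every
    Borel set, so that the set function lives on the same sets as \<open>lborel\<close>.\<close>
  define \<nu>0 where "\<nu>0 A = ennreal (L (indicator (A \<inter> \<Omega>)))" for A
  define \<nu> where "\<nu> = measure_of UNIV (sets (borel :: 'a measure)) \<nu>0"
  have sets_\<nu>: "sets \<nu> = sets borel" unfolding \<nu>_def
    using sets.sets_measure_of_eq[of "borel :: 'a measure" \<nu>0] by simp
  have L_zero: "L (\<lambda>x. 0) = 0"
    using L_cmult[OF bdd_data_indicator[of "{}"], of 0] by simp
  have "(\<lambda>x. 0) = (indicator ({} \<inter> \<Omega>) :: 'a \<Rightarrow> real)" by (simp add: fun_eq_iff)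
  with L_zero have L_empty: "L (indicator ({} \<inter> \<Omega>)) = 0" by (simp only:)
  have em: "emeasure \<nu> A = \<nu>0 A" if "A \<in> sets borel" for A
    unfolding \<nu>_def
  proof (rule emeasure_measure_of_sigma)
    show "sigma_algebra UNIV (sets (borel :: 'a measure))" using sets.sigma_algebra_axioms[of "borel :: 'a measure"] by simp
    show "positive (sets borel) \<nu>0" using L_empty by (simp add: positive_def \<nu>0_def)
    show "countably_additive (sets borel) \<nu>0"
    proof (rule countably_additiveI)
      fix A :: "nat \<Rightarrow> 'a set" assume A: "range A \<subseteq> sets borel" "disjoint_family A" "(\<Union>i. A i) \<in> sets borel"
      have sum_eq: "(\<Sum>i<n. L (indicator (A i \<inter> \<Omega>))) = L (indicator ((\<Union>i<n. A i) \<inter> \<Omega>))" for n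
      proof (induction n)
        case 0 show ?case by (simp only: lessThan_0 UN_empty sum.empty L_empty)
      next
        case (Suc n)
        have Am: "(\<Union>i<n. A i) \<in> sets borel" "A n \<in> sets borel" using A(1) by auto
        have "indicator ((\<Union>i<Suc n. A i) \<inter> \<Omega>) = (\<lambda>x. indicator ((\<Union>i<n. A i) \<inter> \<Omega>) x + indicator (A n \<inter> \<Omega>) x :: real)"
        proof
          fix x
          have "x \<notin> A i" if "x \<in> A n" "i < n" for i
          proof -
            have "A i \<inter> A n = {}" using A(2) that(2) by (intro disjoint_family_onD[of A UNIV]) auto
            then show ?thesis using that(1) by auto
          qed
          then show "indicator ((\<Union>i<Suc n. A i) \<inter> \<Omega>) x = (indicator ((\<Union>i<n. A i) \<inter> \<Omega>) x + indicator (A n \<inter> \<Omega>) x :: real)"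
            by (auto simp: indicator_def less_Suc_eq)
        qed
        then have "L (indicator ((\<Union>i<Suc n. A i) \<inter> \<Omega>)) = L (indicator ((\<Union>i<n. A i) \<inter> \<Omega>)) + L (indicator (A n \<inter> \<Omega>))"
          using L_add[OF bdd_data_indicator[OF Am(1)] bdd_data_indicator[OF Am(2)]] by simp
        then show ?case using Suc by simp
      qed
      have "(\<lambda>n. L (indicator ((\<Union>i<n. A i) \<inter> \<Omega>))) \<longlonglongrightarrow> L (indicator ((\<Union>i. A i) \<inter> \<Omega>))"
      proof (rule L_tendsto[where M=1])
        show "(\<lambda>n. indicator ((\<Union>i<n. A i) \<inter> \<Omega>) x) \<longlonglongrightarrow> (indicator ((\<Union>i. A i) \<inter> \<Omega>) x :: real)" for x
        proof (cases "x \<in> (\<Union>i. A i)")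
          case True
          then obtain i where "x \<in> A i" by blast
          then have "\<forall>n\<ge>Suc i. indicator ((\<Union>i<n. A i) \<inter> \<Omega>) x = (indicator ((\<Union>i. A i) \<inter> \<Omega>) x :: real)"
            by (auto simp: indicator_def)
          then show ?thesis by (intro tendsto_eventually) (auto simp: eventually_sequentially)
        qed (simp add: indicator_def)
      qed (use A in \<open>auto intro!: bdd_data_indicator simp: indicator_def\<close>)
      then have "(\<lambda>i. L (indicator (A i \<inter> \<Omega>))) sums L (indicator ((\<Union>i. A i) \<inter> \<Omega>))"
        by (simp add: sums_def sum_eq)
      then show "(\<Sum>i. \<nu>0 (A i)) = \<nu>0 (\<Union>i. A i)"
        unfolding \<nu>0_def using A(1) by (intro suminf_ennreal_eq L_nonneg bdd_data_indicator) auto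
    qed
  qed (use that in auto)
  have "absolutely_continuous lborel \<nu>"
    unfolding absolutely_continuous_def
  proof
    fix A :: "'a set" assume A: "A \<in> null_sets lborel"
    then have Ab: "A \<in> sets borel" by auto
    have "AE x in lborel. \<bar>indicator (A \<inter> \<Omega>) x\<bar> powr p = (0::real)"
      using AE_not_in[OF A] by eventually_elim simp
    then have "(LINT x|lborel. \<bar>indicator (A \<inter> \<Omega>) x :: real\<bar> powr p) = 0" by (rule integral_eq_zero_AE)
    then have "L (indicator (A \<inter> \<Omega>)) = 0"
      using L_bound[OF bdd_data_indicator[OF Ab]] by (simp add: lp_norm_def)
    then show "A \<in> null_sets \<nu>" using Ab em[OF Ab] sets_\<nu> by (simp add: null_sets_def \<nu>0_def)
  qed
  then obtain f0 where f0[measurable]: "f0 \<in> borel_measurable lborel" and dens: "density lborel f0 = \<nu>"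
    using sigma_finite_measure.Radon_Nikodym[OF lborel.sigma_finite_measure_axioms, of \<nu>] sets_\<nu> by auto
  have f0_int: "(\<integral>\<^sup>+x. f0 x * indicator A x \<partial>lborel) = ennreal (L (indicator (A \<inter> \<Omega>)))" if "A \<in> sets borel" for A
    using emeasure_density[OF f0, of A] that em[OF that] dens by (simp add: \<nu>0_def)
  define f where "f x = enn2real (f0 x)" for x
  have [measurable]: "f \<in> borel_measurable borel" unfolding f_def using f0 by measurable
  have "(\<integral>\<^sup>+x. f0 x \<partial>lborel) \<noteq> \<infinity>" using f0_int[of UNIV] by simp
  then have "AE x in lborel. f0 x \<noteq> \<infinity>" by (intro nn_integral_PInf_AE) auto
  then have ff0: "AE x in lborel. f0 x = ennreal (f x)" by eventually_elim (simp add: f_def less_top)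
  have f_int: "(\<integral>\<^sup>+x. ennreal (f x * indicator A x) \<partial>lborel) = ennreal (L (indicator (A \<inter> \<Omega>)))" if [measurable]: "A \<in> sets borel" for A
  proof -
    have "(\<integral>\<^sup>+x. ennreal (f x * indicator A x) \<partial>lborel) = (\<integral>\<^sup>+x. f0 x * indicator A x \<partial>lborel)"
      using ff0 by (intro nn_integral_cong_AE) (auto simp: indicator_def elim!: eventually_mono)
    then show ?thesis using f0_int[OF that] by simp
  qed
  have fi: "integrable lborel f"
    using f_int[of UNIV] by (intro integrableI_nonneg) (auto simp: f_def)
  have set_case: "L (indicator (A \<inter> \<Omega>)) = (LINT x|lborel. f x * indicator (A \<inter> \<Omega>) x)" if A[measurable]: "A \<in> sets borel" for A
  proof -
    have "(LINT x|lborel. f x * indicator (A \<inter> \<Omega>) x) = enn2real (ennreal (L (indicator (A \<inter> \<Omega>))))"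
      using f_int[of "A \<inter> \<Omega>"] by (subst integral_eq_nn_integral) (auto simp: f_def Int_assoc)
    then show ?thesis using L_nonneg[OF bdd_data_indicator[OF A]] by simp
  qed
  have fint: "integrable lborel (\<lambda>x. f x * g x)" if g: "bdd_data g" for g
  proof -
    obtain M where "\<And>x. \<bar>g x\<bar> \<le> M" using g by (auto simp: bdd_data_def)
    then have "integrable lborel (\<lambda>x. g x * f x)"
      using g by (intro integrable_mult_bounded[OF fi, of _ M]) (auto dest: bdd_data_measurable)
    then show ?thesis by (simp add: mult.commute)
  qed
  \<comment> \<open>The bound is quantified inside the induction. Multiples, summands and monotone
    approximants inherit a bound from the function they build, and for unbounded functions the claim
    is vacuous.\<close>
  have pos_case: "\<forall>M. (\<forall>x. u x \<le> M) \<longrightarrow> L (\<lambda>x. indicator \<Omega> x * u x) = (LINT x|lborel. f x * (indicator \<Omega> x * u x))"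
    if um: "u \<in> borel_measurable borel" and u0: "\<And>x. 0 \<le> u x" for u :: "'a \<Rightarrow> real"
    using um u0
  proof (induction rule: borel_measurable_induct_real)
    case (set A)
    have "indicator (A \<inter> \<Omega>) = (\<lambda>x. indicator \<Omega> x * indicator A x :: real)" by (auto simp: indicator_def)
    then show ?case using set_case[OF set] by simp
  next
    case (mult u c)
    show ?case
    proof (intro allI impI)
      fix M assume M: "\<forall>x. c * u x \<le> M"
      show "L (\<lambda>x. indicator \<Omega> x * (c * u x)) = (LINT x|lborel. f x * (indicator \<Omega> x * (c * u x)))"
      proof (cases "c = 0")
        case True
        then show ?thesis using L_zero by simp
      next
        case False
        then have uM: "u x \<le> M / c" for x using M mult by (simp add: field_simps)
        then have "bdd_data (\<lambda>x. indicator \<Omega> x * u x)"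
          using mult by (intro bdd_data_restrict[of _ "M / c"]) auto
        moreover have "L (\<lambda>x. indicator \<Omega> x * u x) = (LINT x|lborel. f x * (indicator \<Omega> x * u x))"
          using mult(4) uM by blast
        ultimately show ?thesis using L_cmult[of "\<lambda>x. indicator \<Omega> x * u x" c]
          by (simp add: mult.left_commute[of _ c])
      qed
    qed
  next
    case (add u v)
    show ?case
    proof (intro allI impI)
      fix M assume M: "\<forall>x. v x + u x \<le> M"
      have uM: "u x \<le> M" and vM: "v x \<le> M" for x
        using M[rule_format, of x] add(2)[of x] add(4)[of x] by linarith+
      have bu: "bdd_data (\<lambda>x. indicator \<Omega> x * u x)" and bv: "bdd_data (\<lambda>x. indicator \<Omega> x * v x)"
        using add uM vM by (auto intro!: bdd_data_restrict[of _ M])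
      have eu: "L (\<lambda>x. indicator \<Omega> x * u x) = (LINT x|lborel. f x * (indicator \<Omega> x * u x))"
        using add.IH(1) uM by blast
      have ev: "L (\<lambda>x. indicator \<Omega> x * v x) = (LINT x|lborel. f x * (indicator \<Omega> x * v x))"
        using add.IH(2) vM by blast
      show "L (\<lambda>x. indicator \<Omega> x * (v x + u x)) = (LINT x|lborel. f x * (indicator \<Omega> x * (v x + u x)))"
        using eu ev L_add[OF bv bu] fint[OF bu] fint[OF bv] by (simp add: distrib_left)
    qed
  next
    case (seq U)
    show ?case
    proof (intro allI impI)
      fix M assume M: "\<forall>x. u x \<le> M"
      have Uu: "U i x \<le> u x" for i x
        using seq(3,4) by (intro incseq_le) (auto simp: incseq_def le_fun_def)
      have UM: "U i x \<le> M" for i x using Uu[of i x] M by (meson order_trans)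
      have um': "u \<in> borel_measurable borel"
        by (rule borel_measurable_LIMSEQ_real[of borel U]) (use seq in auto)
      have u0': "0 \<le> u x" for x using Uu[of 0 x] seq(2)[of 0 x] by linarith
      have bu: "bdd_data (\<lambda>x. indicator \<Omega> x * u x)" by (rule bdd_data_restrict[OF um', of M]) (use M u0' in auto)
      have bU: "bdd_data (\<lambda>x. indicator \<Omega> x * U i x)" for i by (rule bdd_data_restrict[of _ M]) (use UM seq in auto)
      have M0: "0 \<le> M" using M u0'[of undefined] by (meson order_trans)
      have lim: "(\<lambda>n. indicator \<Omega> x * U n x) \<longlonglongrightarrow> indicator \<Omega> x * u x" for x
        using seq(4)[of x] by (intro tendsto_intros) auto
      have b1: "\<bar>indicator \<Omega> x * U n x\<bar> \<le> M" and b2: "\<bar>indicator \<Omega> x * u x\<bar> \<le> M" for n x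
        using UM[of n x] seq(2)[of n x] M u0'[of x] M0 by (auto simp: indicator_def)
      have 1: "(\<lambda>n. L (\<lambda>x. indicator \<Omega> x * U n x)) \<longlonglongrightarrow> L (\<lambda>x. indicator \<Omega> x * u x)"
        by (rule L_tendsto[OF bu bU b1 b2 lim])
      have "(\<lambda>n. LINT x|lborel. f x * (indicator \<Omega> x * U n x)) \<longlonglongrightarrow> (LINT x|lborel. f x * (indicator \<Omega> x * u x))"
      proof (rule integral_dominated_convergence[where w="\<lambda>x. M * f x"])
        show "AE x in lborel. (\<lambda>n. f x * (indicator \<Omega> x * U n x)) \<longlonglongrightarrow> f x * (indicator \<Omega> x * u x)"
          by (intro AE_I2) (rule tendsto_mult[OF tendsto_const lim])
        show "AE x in lborel. norm (f x * (indicator \<Omega> x * U n x)) \<le> M * f x" for n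
        proof (rule AE_I2)
          fix x
          have "\<bar>f x\<bar> * \<bar>indicator \<Omega> x * U n x\<bar> \<le> \<bar>f x\<bar> * M" using b1[of x n] by (intro mult_left_mono) auto
          then show "norm (f x * (indicator \<Omega> x * U n x)) \<le> M * f x" by (simp add: f_def abs_mult mult.commute)
        qed
      qed (use fi borel_measurable_integrable[OF fint[OF bU]] borel_measurable_integrable[OF fint[OF bu]] in auto)
      moreover have "L (\<lambda>x. indicator \<Omega> x * U n x) = (LINT x|lborel. f x * (indicator \<Omega> x * U n x))" for n
        using seq.IH[of n] UM by blast
      ultimately show "L (\<lambda>x. indicator \<Omega> x * u x) = (LINT x|lborel. f x * (indicator \<Omega> x * u x))"
        using LIMSEQ_unique[OF 1] by simp
    qed
  qed
  have "L g = (LINT x|lborel. f x * g x)" if g: "bdd_data g" for g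
  proof -
    obtain M where M: "\<And>x. \<bar>g x\<bar> \<le> M" using g by (auto simp: bdd_data_def)
    have M0: "0 \<le> M" using M[of undefined] by linarith
    have gm[measurable]: "g \<in> borel_measurable borel" using g by (simp add: bdd_data_def)
    define g1 where "g1 x = indicator \<Omega> x * max (g x) 0" for x
    define g2 where "g2 x = indicator \<Omega> x * max (- g x) 0" for x
    have b: "bdd_data g1" "bdd_data g2" unfolding g1_def g2_def
      using M M0 by (auto intro!: bdd_data_restrict[of _ M] simp: max_def abs_le_iff)
    have "max (g x) 0 \<le> M" "max (- g x) 0 \<le> M" for x using M[of x] M0 by auto
    then have e: "L g1 = (LINT x|lborel. f x * g1 x)" "L g2 = (LINT x|lborel. f x * g2 x)"
      using pos_case[of "\<lambda>x. max (g x) 0"] pos_case[of "\<lambda>x. max (- g x) 0"]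
      by (auto simp: g1_def[abs_def] g2_def[abs_def])
    have gg: "g = (\<lambda>x. g1 x - g2 x)" using g by (auto simp: g1_def g2_def bdd_data_def indicator_def max_def fun_eq_iff)
    show ?thesis using L_diff[OF b] e fint[OF b(1)] fint[OF b(2)]
      by (subst (1 2) gg) (simp add: right_diff_distrib)
  qed
  then show ?thesis using that fi unfolding L_def by blast
qed

end

section \<open>Signed measures and their pairing with continuous functions\<close>

section \<open>Radon measures\<close>

text \<open>The constant sequence of empty sets is disjoint, and a constant series converges only if
  its terms are 0.\<close>

lemma radon_measure_empty:
  assumes "radon_measure \<Omega> \<mu>" shows "\<mu> {} = 0"
proof -
  have "(\<lambda>i::nat. \<mu> {}) sums \<mu> (\<Union>i::nat. {})"
    using assms[unfolded radon_measure_def, rule_format, of "\<lambda>i. {}"] by (simp add: disjoint_family_on_def)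
  then have "summable (\<lambda>i::nat. \<mu> {})" by (rule sums_summable)
  then show ?thesis by (simp only: summable_const_iff)
qed

lemma radon_measure_Un:
  assumes \<mu>: "radon_measure \<Omega> \<mu>" and A: "A \<in> sets (restrict_space borel \<Omega>)" and B: "B \<in> sets (restrict_space borel \<Omega>)"
    and "A \<inter> B = {}"
  shows "\<mu> (A \<union> B) = \<mu> A + \<mu> B"
proof -
  have "range (binaryset A B) \<subseteq> sets (restrict_space borel \<Omega>)"
    using A B by (auto simp: binaryset_def)
  moreover have "disjoint_family (binaryset A B)"
    using assms(4) by (auto simp: disjoint_family_on_def binaryset_def)
  ultimately have "(\<lambda>i. \<mu> (binaryset A B i)) sums \<mu> (\<Union>i. binaryset A B i)"
    using \<mu> unfolding radon_measure_def by blast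
  moreover have "(\<lambda>i. \<mu> (binaryset A B i)) sums (\<mu> A + \<mu> B)"
    by (rule binaryset_sums) (rule radon_measure_empty[OF \<mu>])
  ultimately show ?thesis by (simp add: UN_binaryset_eq sums_unique2)
qed

text \<open>Suppose not. A set on whose subsets \<open>\<mu>\<close> is unbounded splits into two
  pieces of absolute measure at least 1, one of which is again such a set. Removing the other piece
  over and over gives disjoint sets of absolute measure at least 1, against convergence of the
  series of their measures.\<close>

lemma radon_measure_bounded:
  assumes \<mu>: "radon_measure \<Omega> \<mu>" and \<Omega>: "\<Omega> \<in> sets borel"
  obtains K where "\<And>B. B \<in> sets (restrict_space borel \<Omega>) \<Longrightarrow> \<bar>\<mu> B\<bar> \<le> K"
proof (rule ccontr)
  assume contr: "\<not> thesis"
  let ?S = "sets (restrict_space borel \<Omega>)"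
  define bad where "bad A \<longleftrightarrow> A \<in> ?S \<and> (\<forall>K. \<exists>B\<in>?S. B \<subseteq> A \<and> K < \<bar>\<mu> B\<bar>)" for A
  have \<Omega>S: "\<Omega> \<in> ?S" using \<Omega> by (auto simp: sets_restrict_space)
  have "bad \<Omega>"
    unfolding bad_def
  proof (intro conjI allI \<Omega>S)
    fix K
    have "\<not> (\<forall>B. B \<in> ?S \<longrightarrow> \<bar>\<mu> B\<bar> \<le> K)" using contr that[of K] by blast
    then obtain B where B: "B \<in> ?S" "K < \<bar>\<mu> B\<bar>" by (auto simp: not_le)
    then show "\<exists>B\<in>?S. B \<subseteq> \<Omega> \<and> K < \<bar>\<mu> B\<bar>" by (auto simp: sets_restrict_space)
  qed
  have step: "\<exists>A'. bad A' \<and> A' \<subseteq> A \<and> 1 \<le> \<bar>\<mu> (A - A')\<bar>" if A: "bad A" for A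
  proof -
    \<comment> \<open>The margin \<open>\<bar>\<mu> A\<bar> + 1\<close> makes the complement of
      \<open>B\<close> in \<open>A\<close> large as well.\<close>
    obtain B where B: "B \<in> ?S" "B \<subseteq> A" "\<bar>\<mu> A\<bar> + 1 < \<bar>\<mu> B\<bar>" using A unfolding bad_def by blast
    have AS: "A \<in> ?S" using A by (simp add: bad_def)
    define C where "C = A - B"
    have C: "C \<in> ?S" "C \<subseteq> A" unfolding C_def using AS B by auto
    have "\<mu> (B \<union> C) = \<mu> B + \<mu> C" by (rule radon_measure_Un[OF \<mu> B(1) C(1)]) (auto simp: C_def)
    moreover have "B \<union> C = A" using B by (auto simp: C_def)
    ultimately have muC: "1 \<le> \<bar>\<mu> C\<bar>" "1 \<le> \<bar>\<mu> B\<bar>" using B(3) by auto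
    have "bad B \<or> bad C"
    proof (rule ccontr)
      assume "\<not> (bad B \<or> bad C)"
      then obtain K1 K2 where K: "\<And>D. D \<in> ?S \<Longrightarrow> D \<subseteq> B \<Longrightarrow> \<bar>\<mu> D\<bar> \<le> K1" "\<And>D. D \<in> ?S \<Longrightarrow> D \<subseteq> C \<Longrightarrow> \<bar>\<mu> D\<bar> \<le> K2"
        using B(1) C(1) unfolding bad_def by (meson not_less)
      obtain D where D: "D \<in> ?S" "D \<subseteq> A" "K1 + K2 < \<bar>\<mu> D\<bar>" using A unfolding bad_def by blast
      have "\<mu> ((D \<inter> B) \<union> (D \<inter> C)) = \<mu> (D \<inter> B) + \<mu> (D \<inter> C)"
        using D B C by (intro radon_measure_Un[OF \<mu>] sets.Int) (auto simp: C_def)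
      moreover have "(D \<inter> B) \<union> (D \<inter> C) = D" using D(2) by (auto simp: C_def)
      ultimately show False
        using K(1)[of "D \<inter> B"] K(2)[of "D \<inter> C"] D B(1) C(1) by (auto simp: sets.Int)
    qed
    then show ?thesis
    proof
      assume "bad B" then show ?thesis using B muC by (intro exI[of _ B]) (auto simp: C_def)
    next
      assume "bad C"
      moreover have "A - C = B" using B by (auto simp: C_def)
      ultimately show ?thesis using C muC by (intro exI[of _ C]) auto
    qed
  qed
  obtain A where A: "\<And>n::nat. bad (A n)" "\<And>n. A (Suc n) \<subseteq> A n" "\<And>n. 1 \<le> \<bar>\<mu> (A n - A (Suc n))\<bar>"
  proof -
    have "\<exists>A. \<forall>n::nat. bad (A n) \<and> (A (Suc n) \<subseteq> A n \<and> 1 \<le> \<bar>\<mu> (A n - A (Suc n))\<bar>)"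
      by (rule dependent_nat_choice) (use \<open>bad \<Omega>\<close> step in auto)
    then show ?thesis using that by blast
  qed
  have dec: "A m \<subseteq> A n" if "n \<le> m" for n m using that A(2) by (rule lift_Suc_antimono_le[rotated])
  define D where "D n = A n - A (Suc n)" for n
  have "disjoint_family D"
    unfolding disjoint_family_on_def
  proof (intro ballI impI)
    fix m n :: nat assume "m \<noteq> n"
    then consider "Suc m \<le> n" | "Suc n \<le> m" by linarith
    then show "D m \<inter> D n = {}" by cases (use dec in \<open>auto simp: D_def\<close>)
  qed
  moreover have "range D \<subseteq> ?S" using A(1) by (auto simp: D_def bad_def)
  ultimately have "(\<lambda>n. \<mu> (D n)) sums \<mu> (\<Union>n. D n)" using \<mu> unfolding radon_measure_def by blast
  then have "(\<lambda>n. \<mu> (D n)) \<longlonglongrightarrow> 0" by (intro summable_LIMSEQ_zero sums_summable)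
  then have "\<forall>\<^sub>F n in sequentially. norm (\<mu> (D n)) < 1" using order_tendstoD(2)[OF tendsto_norm_zero] by force
  then obtain n where "\<bar>\<mu> (D n)\<bar> < 1" by (auto simp: eventually_sequentially)
  then show False using A(3)[of n] by (simp add: D_def)
qed

lemma radon_measure_uminus: "radon_measure \<Omega> \<mu> \<Longrightarrow> radon_measure \<Omega> (\<lambda>A. - \<mu> A)"
  unfolding radon_measure_def by (auto intro: sums_minus)

lemma sets_pos_variation: "\<Omega> \<in> sets borel \<Longrightarrow> sets (pos_variation \<Omega> \<mu>) = sets (restrict_space borel \<Omega>)"
  and space_pos_variation: "\<Omega> \<in> sets borel \<Longrightarrow> space (pos_variation \<Omega> \<mu>) = \<Omega>"
proof -
  have sp: "space (restrict_space borel \<Omega>) = \<Omega>" by (simp add: space_restrict_space)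
  show "sets (pos_variation \<Omega> \<mu>) = sets (restrict_space borel \<Omega>)"
    unfolding pos_variation_def using sets.sets_measure_of_eq[of "restrict_space borel \<Omega>"] by (simp add: sp)
  show "space (pos_variation \<Omega> \<mu>) = \<Omega>"
    unfolding pos_variation_def using sets.space_measure_of_eq[of "restrict_space borel \<Omega>"] by (simp add: sp)
qed

text \<open>That \<^const>\<open>pos_variation\<close> is given by its defining formula is never used: if the formula
  were not a measure, \<^const>\<open>measure_of\<close> would yield the zero measure, which is finite as well.\<close>

lemma finite_pos_variation:
  assumes \<mu>: "radon_measure \<Omega> \<mu>" and \<Omega>: "\<Omega> \<in> sets borel"
  shows "finite_measure (pos_variation \<Omega> \<mu>)"
proof (rule finite_measureI)
  obtain K where K: "\<And>B. B \<in> sets (restrict_space borel \<Omega>) \<Longrightarrow> \<bar>\<mu> B\<bar> \<le> K"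
    by (rule radon_measure_bounded[OF \<mu> \<Omega>]) (rule that)
  have "(SUP B \<in> {B \<in> sets (restrict_space borel \<Omega>). B \<subseteq> \<Omega>}. ennreal (\<mu> B)) \<le> ennreal K"
    by (intro SUP_least ennreal_leI) (use K in \<open>force simp: abs_le_iff\<close>)
  then have "emeasure (pos_variation \<Omega> \<mu>) \<Omega> \<le> ennreal K"
    unfolding pos_variation_def emeasure_measure_of_conv by auto
  then show "emeasure (pos_variation \<Omega> \<mu>) (space (pos_variation \<Omega> \<mu>)) \<noteq> \<infinity>"
    by (auto simp: space_pos_variation[OF \<Omega>] top_unique)
qed

lemma C0_measurable_pos_variation:
  assumes "v \<in> C0 \<Omega>" "\<Omega> \<in> sets borel" shows "v \<in> borel_measurable (pos_variation \<Omega> \<mu>)"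
proof -
  have "continuous_on \<Omega> v" using assms closure_subset by (auto simp: C0_def intro: continuous_on_subset)
  then have "v \<in> borel_measurable (restrict_space borel \<Omega>)" by (rule borel_measurable_continuous_on_restrict)
  then show ?thesis using measurable_cong_sets[OF sets_pos_variation[OF assms(2)] refl] by blast
qed

lemma C0_bounded:
  assumes "v \<in> C0 \<Omega>" "bounded \<Omega>" obtains c where "0 \<le> c" "\<And>x. \<bar>v x\<bar> \<le> c"
proof -
  have "compact (v ` closure \<Omega>)"
    using assms by (intro compact_continuous_image) (auto simp: C0_def)
  then have "bounded (v ` closure \<Omega>)" by (rule compact_imp_bounded)
  then obtain c where c: "\<And>x. x \<in> closure \<Omega> \<Longrightarrow> \<bar>v x\<bar> \<le> c" by (auto simp: bounded_iff)
  show ?thesis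
  proof (rule that[of "max c 0"])
    show "\<bar>v x\<bar> \<le> max c 0" for x
      using c[of x] closure_subset[of \<Omega>] assms(1) by (cases "x \<in> \<Omega>") (auto simp: C0_def)
  qed simp
qed

lemma C0_cmult: "v \<in> C0 \<Omega> \<Longrightarrow> (\<lambda>x. c * v x) \<in> C0 \<Omega>"
  by (auto simp: C0_def intro!: continuous_intros)

lemma C0_diff: "u \<in> C0 \<Omega> \<Longrightarrow> v \<in> C0 \<Omega> \<Longrightarrow> (\<lambda>x. u x - v x) \<in> C0 \<Omega>"
  by (auto simp: C0_def intro!: continuous_intros)

lemma pairing_cmult: "pairing \<Omega> \<mu> (\<lambda>x. c * v x) = c * pairing \<Omega> \<mu> v"
  by (simp add: pairing_def right_diff_distrib)

lemma integrable_C0_pos_variation: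
  assumes \<mu>: "radon_measure \<Omega> \<mu>" and \<Omega>: "\<Omega> \<in> sets borel" "bounded \<Omega>" and v: "v \<in> C0 \<Omega>"
  shows "integrable (pos_variation \<Omega> \<mu>) v"
proof -
  interpret finite_measure "pos_variation \<Omega> \<mu>" by (rule finite_pos_variation[OF \<mu> \<Omega>(1)])
  obtain c where "\<And>x. \<bar>v x\<bar> \<le> c" by (rule C0_bounded[OF v \<Omega>(2)]) (rule that)
  then show ?thesis
    by (intro integrable_const_bound[of _ c] C0_measurable_pos_variation[OF v \<Omega>(1)]) auto
qed

lemma pairing_diff:
  assumes \<mu>: "radon_measure \<Omega> \<mu>" and \<Omega>: "\<Omega> \<in> sets borel" "bounded \<Omega>" and "u \<in> C0 \<Omega>" "v \<in> C0 \<Omega>"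
  shows "pairing \<Omega> \<mu> (\<lambda>x. u x - v x) = pairing \<Omega> \<mu> u - pairing \<Omega> \<mu> v"
  using assms integrable_C0_pos_variation[OF \<mu> \<Omega>] integrable_C0_pos_variation[OF radon_measure_uminus[OF \<mu>] \<Omega>]
  by (simp add: pairing_def)

text \<open>\<open>radon_norm\<close> is a supremum of reals and has meaning only once it is known
  to be finite: the total masses of the two parts bound the pairing on the unit ball. The estimate
  then follows by scaling with \<open>1 / c\<close> and \<open>- 1 / c\<close>.\<close>

lemma pairing_le_radon_norm:
  assumes \<mu>: "radon_measure \<Omega> \<mu>" and \<Omega>: "\<Omega> \<in> sets borel" "bounded \<Omega>" and v: "v \<in> C0 \<Omega>" and vc: "\<And>x. \<bar>v x\<bar> \<le> c"
  shows "\<bar>pairing \<Omega> \<mu> v\<bar> \<le> radon_norm \<Omega> \<mu> * c"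
    and radon_norm_nonneg: "0 \<le> radon_norm \<Omega> \<mu>"
proof -
  interpret m1: finite_measure "pos_variation \<Omega> \<mu>" by (rule finite_pos_variation[OF \<mu> \<Omega>(1)])
  interpret m2: finite_measure "pos_variation \<Omega> (\<lambda>A. - \<mu> A)"
    by (rule finite_pos_variation[OF radon_measure_uminus[OF \<mu>] \<Omega>(1)])
  let ?B = "{v \<in> C0 \<Omega>. \<forall>x. \<bar>v x\<bar> \<le> 1}"
  have le: "\<bar>LINT x|pos_variation \<Omega> \<nu>. v x\<bar> \<le> measure (pos_variation \<Omega> \<nu>) (space (pos_variation \<Omega> \<nu>))"
    if \<nu>: "radon_measure \<Omega> \<nu>" and v: "v \<in> ?B" for \<nu> v
  proof -
    interpret finite_measure "pos_variation \<Omega> \<nu>" by (rule finite_pos_variation[OF \<nu> \<Omega>(1)])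
    have "\<bar>LINT x|pos_variation \<Omega> \<nu>. v x\<bar> \<le> (LINT x|pos_variation \<Omega> \<nu>. 1)"
      using v integrable_C0_pos_variation[OF \<nu> \<Omega>, of v] by (intro integral_abs_le_AE) auto
    then show ?thesis by simp
  qed
  have bdd: "bdd_above (pairing \<Omega> \<mu> ` ?B)"
  proof (rule bdd_aboveI2)
    fix v assume "v \<in> ?B"
    then show "pairing \<Omega> \<mu> v \<le> measure (pos_variation \<Omega> \<mu>) (space (pos_variation \<Omega> \<mu>))
        + measure (pos_variation \<Omega> (\<lambda>A. - \<mu> A)) (space (pos_variation \<Omega> (\<lambda>A. - \<mu> A)))"
      using le[OF \<mu>, of v] le[OF radon_measure_uminus[OF \<mu>], of v] by (simp add: pairing_def)
  qed
  have sup: "pairing \<Omega> \<mu> v \<le> radon_norm \<Omega> \<mu>" if "v \<in> ?B" for v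
    unfolding radon_norm_def using that by (intro cSUP_upper bdd)
  have "(\<lambda>x. 0) \<in> ?B" by (simp add: C0_def)
  from sup[OF this] show "0 \<le> radon_norm \<Omega> \<mu>" by (simp add: pairing_def)
  show "\<bar>pairing \<Omega> \<mu> v\<bar> \<le> radon_norm \<Omega> \<mu> * c"
  proof (cases "c = 0")
    case True
    then have "v = (\<lambda>x. 0)" using vc by (auto simp: fun_eq_iff)
    then show ?thesis using True by (simp add: pairing_def)
  next
    case False
    then have c: "c > 0" using vc[of undefined] by linarith
    have scaled: "k * pairing \<Omega> \<mu> v \<le> radon_norm \<Omega> \<mu>" if k: "\<bar>k\<bar> * c \<le> 1" for k
    proof -
      have "\<bar>k * v x\<bar> \<le> 1" for x
        using mult_left_mono[OF vc[of x], of "\<bar>k\<bar>"] k by (simp add: abs_mult)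
      then have "(\<lambda>x. k * v x) \<in> ?B" using C0_cmult[OF v] by blast
      from sup[OF this] show ?thesis by (simp add: pairing_cmult)
    qed
    show ?thesis using scaled[of "1 / c"] scaled[of "- 1 / c"] c by (simp add: abs_le_iff field_simps)
  qed
qed

section \<open>Balls inside exterior cones\<close>

section \<open>The exterior cone condition\<close>

text \<open>Cones are invariant under dilation, so a ball centred on the axis at height
  \<open>r / 2\<close> fits inside with a radius that is a fixed fraction of \<open>r\<close>. The
  height of the cone limits only the range of scales.\<close>

lemma exterior_cone_ball:
  assumes cone: "exterior_cone_condition \<Omega>" and \<Omega>: "open \<Omega>" and z: "z \<in> frontier \<Omega>"
  shows "\<exists>\<rho>>0. exterior_ball_at \<rho> \<Omega> z"
proof -
  obtain e \<theta> h where e: "norm e = 1" and \<theta>: "0 < \<theta>" "\<theta> < pi / 2" and h: "0 < h"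
    and fc: "finite_cone z e \<theta> h \<inter> closure \<Omega> = {z}"
    using cone z unfolding exterior_cone_condition_def by blast
  have c0: "0 < cos \<theta>" using \<theta> by (intro cos_gt_zero_pi) auto
  have c1: "cos \<theta> < 1" using cos_monotone_0_pi[of 0 \<theta>] \<theta> by simp
  \<comment> \<open>Seen from \<open>z\<close>, points of the ball have length at most
    \<open>(1/2 + \<rho>) r\<close> and axial component at least \<open>(1/2 - \<rho>) r\<close>.
    The cone inequality thus asks for
    \<open>\<rho> (1 + cos \<theta>) <= (1 - cos \<theta>) / 2\<close>, which holds as
    \<open>1 + cos \<theta> <= 2\<close>. Moreover \<open>\<rho> <= 1/4\<close> keeps the ball
    within \<open>ball z r\<close> and away from \<open>z\<close>.\<close>
  define \<rho> where "\<rho> = (1 - cos \<theta>) / 4"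
  have \<rho>: "0 < \<rho>" "\<rho> \<le> 1 / 4" using c0 c1 by (auto simp: \<rho>_def)
  have z\<Omega>: "z \<notin> \<Omega>" using z \<Omega> by (simp add: frontier_def interior_open)
  have "\<exists>c. ball c (\<rho> * r) \<subseteq> ball z r - \<Omega>" if r: "0 < r" "r < h" for r
  proof (intro exI[of _ "z + (r / 2) *\<^sub>R e"] subsetI)
    fix y assume y: "y \<in> ball (z + (r / 2) *\<^sub>R e) (\<rho> * r)"
    define d where "d = y - (z + (r / 2) *\<^sub>R e)"
    have d: "norm d < \<rho> * r" using y by (simp add: d_def dist_norm norm_minus_commute)
    have yz: "y - z = (r / 2) *\<^sub>R e + d" by (simp add: d_def)
    have de: "\<bar>d \<bullet> e\<bar> < \<rho> * r" using Cauchy_Schwarz_ineq2[of d e] e d by simp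
    have ee: "e \<bullet> e = 1" using e by (simp add: norm_eq_1)
    have in1: "(y - z) \<bullet> e = r / 2 + d \<bullet> e" unfolding yz by (simp add: inner_add_left ee)
    have n: "norm (y - z) < r / 2 + \<rho> * r"
      unfolding yz using norm_triangle_ineq[of "(r / 2) *\<^sub>R e" d] e d r by simp
    have rr: "\<rho> * r \<le> 1 / 4 * r" using \<rho> r by (intro mult_right_mono) auto
    have "norm (y - z) * cos \<theta> \<le> (r / 2 + \<rho> * r) * cos \<theta>" using n c0 by (intro mult_right_mono) auto
    also have "\<dots> \<le> r / 2 - \<rho> * r"
    proof -
      have "\<rho> * (1 + cos \<theta>) \<le> \<rho> * 2" using \<rho> c1 by (intro mult_left_mono) auto
      moreover have "\<rho> * 2 = 1 / 2 - 1 / 2 * cos \<theta>" by (simp add: \<rho>_def field_simps)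
      moreover have "\<rho> * (1 + cos \<theta>) = \<rho> + \<rho> * cos \<theta>" by (simp add: distrib_left)
      ultimately have "1 / 2 * cos \<theta> + \<rho> * cos \<theta> \<le> 1 / 2 - \<rho>" by linarith
      then have "r * (1 / 2 * cos \<theta> + \<rho> * cos \<theta>) \<le> r * (1 / 2 - \<rho>)" using r by (intro mult_left_mono) auto
      then show ?thesis by (simp add: algebra_simps)
    qed
    also have "\<dots> \<le> (y - z) \<bullet> e" using in1 de by simp
    finally have "norm (y - z) * cos \<theta> \<le> (y - z) \<bullet> e" .
    moreover have "(y - z) \<bullet> e \<le> h" using in1 de rr r by linarith
    ultimately have "y \<in> finite_cone z e \<theta> h" unfolding finite_cone_def by blast
    moreover have "y \<noteq> z"
    proof
      assume "y = z"
      then have "r / 2 + d \<bullet> e = 0" using in1 by simp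
      then show False using de rr r by linarith
    qed
    ultimately have "y \<notin> \<Omega>" using fc closure_subset[of \<Omega>] by blast
    moreover have "norm (y - z) < r" using n rr r by linarith
    then have "y \<in> ball z r" by (simp add: dist_norm norm_minus_commute)
    ultimately show "y \<in> ball z r - \<Omega>" by blast
  qed
  then show ?thesis using \<rho> h unfolding exterior_ball_at_def by blast
qed

section \<open>Passage from Lebesgue to Borel measurability\<close>

section \<open>Borel representatives\<close>

lemma frac_kernel_divide: "frac_kernel s h = 1 / norm h powr (real DIM('a) + 2 * s)"
  for h :: "'a::euclidean_space"
  unfolding frac_kernel_def by (rule powr_minus_divide)

text \<open>For Borel functions completion changes no integral, and Tonelli turns the iterated
  integral of the definition into one over the product.\<close>

lemma Hs_iff_W_s2:
  assumes [measurable]: "u \<in> borel_measurable (borel :: 'a::euclidean_space measure)"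
  shows "u \<in> W_s2 s \<longleftrightarrow> u \<in> Hs s"
proof -
  have "enn2real 2 = 2" using enn2real_ennreal[of 2] by simp
  then have sq: "\<bar>u x\<bar> powr enn2real 2 = (u x)\<^sup>2" for x by simp
  have "u \<in> Lp 2 lebesgue \<longleftrightarrow> integrable lborel (\<lambda>x. (u x)\<^sup>2)"
    unfolding Lp_def by (auto simp: sq integrable_completion measurable_completion)
  moreover have "(\<integral>\<^sup>+y. (\<integral>\<^sup>+x. ennreal (\<bar>u x - u y\<bar>\<^sup>2 / norm (x - y) powr (real DIM('a) + 2 * s)) \<partial>lebesgue) \<partial>lebesgue)
      = (\<integral>\<^sup>+p. ennreal ((incr u p)\<^sup>2 * pair_kernel s p) \<partial>lborel2)"
    by (subst lborel_pair.nn_integral_snd[symmetric])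
      (auto simp: nn_integral_completion incr_def pair_kernel_def frac_kernel_divide)
  moreover have "integrable lborel2 (\<lambda>p. (incr u p)\<^sup>2 * pair_kernel s p) \<longleftrightarrow>
      (\<integral>\<^sup>+p. ennreal ((incr u p)\<^sup>2 * pair_kernel s p) \<partial>lborel2) < \<infinity>"
    by (simp add: integrable_iff_bounded)
  ultimately show ?thesis unfolding W_s2_def Hs_def by simp
qed

lemma H0_iff_W0_s2:
  assumes "u \<in> borel_measurable borel"
  shows "u \<in> W0_s2 s \<Omega> \<longleftrightarrow> u \<in> H0 s \<Omega>"
  unfolding W0_s2_def H0_def using Hs_iff_W_s2[OF assms] by (simp add: AE_completion_iff)

lemma frac_form_eq_gagliardo:
  assumes "v \<in> Hs s" "w \<in> Hs s"
  shows "frac_form s v w = frac_const DIM('a) s / 2 * gagliardo s v (w :: 'a::euclidean_space \<Rightarrow> real)"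
proof -
  note [measurable] = Hs_measurable[OF assms(1)] Hs_measurable[OF assms(2)]
  let ?f = "\<lambda>x y. (v x - v y) * (w x - w y) / norm (x - y) powr (real DIM('a) + 2 * s)"
  have f: "case_prod ?f = (\<lambda>p. incr v p * incr w p * pair_kernel s p)"
    by (auto simp: incr_def pair_kernel_def frac_kernel_divide)
  have "(LINT x|lebesgue. ?f x y) = (LINT x|lborel. ?f x y)" for y
    by (rule integral_completion) measurable
  then have "(LINT y|lebesgue. LINT x|lebesgue. ?f x y) = (LINT y|lebesgue. LINT x|lborel. ?f x y)" by simp
  also have "\<dots> = (LINT y|lborel. LINT x|lborel. ?f x y)"
    by (rule integral_completion) measurable
  also have "\<dots> = integral\<^sup>L lborel2 (case_prod ?f)"
    by (rule lborel_pair.integral_snd) (unfold f, rule Hs_gagliardo_integrable[OF assms])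
  finally show ?thesis unfolding frac_form_def f gagliardo_def by simp
qed

lemma lebesgue_measurable_AE_cong:
  fixes f g :: "'a::euclidean_space \<Rightarrow> real"
  assumes g: "g \<in> borel_measurable lebesgue" and eq: "AE x in lborel. f x = g x"
  shows "f \<in> borel_measurable lebesgue"
proof (rule measurableI)
  fix A :: "real set" assume A: "A \<in> sets borel"
  obtain N where N: "N \<in> null_sets lborel" "{x. f x \<noteq> g x} \<subseteq> N"
    using eq unfolding eventually_ae_filter by auto
  have N': "N \<in> null_sets lebesgue" using N(1) by (rule null_sets_completionI)
  have "f -` A \<inter> N \<in> null_sets lebesgue" by (rule completion.complete2[OF _ N']) auto
  moreover have "g -` A \<inter> space lebesgue \<in> sets lebesgue" using g A by (rule measurable_sets)
  ultimately have "(g -` A \<inter> space lebesgue - N) \<union> (f -` A \<inter> N) \<in> sets lebesgue"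
    using N' by (intro sets.Un sets.Diff) auto
  moreover have "(g -` A \<inter> space lebesgue - N) \<union> (f -` A \<inter> N) = f -` A \<inter> space lebesgue"
    using N(2) by auto
  ultimately show "f -` A \<inter> space lebesgue \<in> sets lebesgue" by simp
qed simp

text \<open>Joint measurability of the integrand in both variables is never asked of
  \<open>w\<close>. Whenever \<open>w y = w' y\<close>, the inner integrals for \<open>w\<close> and
  \<open>w'\<close> agree, and the other \<open>y\<close> form a null set for the outer integral.
  Measurability of the sections of \<open>w\<close> comes from completeness of the Lebesgue
  measure.\<close>

lemma W0_s2_borel_representative:
  fixes w :: "'a::euclidean_space \<Rightarrow> real"
  assumes w: "w \<in> W0_s2 s \<Omega>"
  obtains w' where "w' \<in> H0 s \<Omega>" "AE x in lborel. w x = w' x"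
    "\<And>v. v \<in> borel_measurable borel \<Longrightarrow> frac_form s v w = frac_form s v w'"
proof -
  have wm: "w \<in> borel_measurable lebesgue" using w by (auto simp: W0_s2_def W_s2_def Lp_def)
  then obtain w' where w'[measurable]: "w' \<in> borel_measurable borel" and eq: "AE x in lborel. w x = w' x"
    using completion_ex_borel_measurable_real[of w lborel] by auto
  have eqL: "AE x in lebesgue. w x = w' x" using eq by (rule AE_completion)
  have w'L: "w' \<in> borel_measurable lebesgue" by (rule measurable_completion) simp
  have "w' \<in> W0_s2 s \<Omega>"
  proof -
    have "w' \<in> Lp 2 lebesgue"
    proof -
      have "integrable lebesgue (\<lambda>x. \<bar>w x\<bar> powr enn2real 2)"
        using w by (simp add: W0_s2_def W_s2_def Lp_def)
      then have "integrable lebesgue (\<lambda>x. \<bar>w' x\<bar> powr enn2real 2)"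
        by (rule integrable_cong_AE_imp) (use w'L eqL in \<open>auto elim!: eventually_mono\<close>)
      then show ?thesis using w'L by (simp add: Lp_def)
    qed
    moreover have "(\<integral>\<^sup>+y. (\<integral>\<^sup>+x. ennreal (\<bar>w' x - w' y\<bar>\<^sup>2 / norm (x - y) powr (real DIM('a) + 2 * s)) \<partial>lebesgue) \<partial>lebesgue)
        = (\<integral>\<^sup>+y. (\<integral>\<^sup>+x. ennreal (\<bar>w x - w y\<bar>\<^sup>2 / norm (x - y) powr (real DIM('a) + 2 * s)) \<partial>lebesgue) \<partial>lebesgue)"
    proof (rule nn_integral_cong_AE, use eqL in eventually_elim)
      case (elim y)
      show ?case by (rule nn_integral_cong_AE, use eqL in eventually_elim) (simp add: elim)
    qed
    moreover have "AE x in lebesgue. x \<notin> \<Omega> \<longrightarrow> w' x = 0"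
    proof -
      have "AE x in lebesgue. x \<notin> \<Omega> \<longrightarrow> w x = 0" using w by (simp add: W0_s2_def)
      with eqL show ?thesis by eventually_elim auto
    qed
    ultimately show ?thesis using w by (simp add: W0_s2_def W_s2_def)
  qed
  then have "w' \<in> H0 s \<Omega>" using H0_iff_W0_s2[OF w'] by blast
  moreover have "frac_form s v w = frac_form s v w'" if v[measurable]: "v \<in> borel_measurable borel" for v
  proof -
    let ?f = "\<lambda>w x y. (v x - v y) * (w x - w y) / norm (x - y) powr (real DIM('a) + 2 * s)"
    have "(LINT x|lebesgue. ?f w x y) = (LINT x|lebesgue. ?f w' x y)" if y: "w y = w' y" for y
    proof (rule Bochner_Integration.integral_cong_AE)
      show m: "(\<lambda>x. ?f w' x y) \<in> borel_measurable lebesgue" by (rule measurable_completion) measurable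
      show "AE x in lebesgue. ?f w x y = ?f w' x y" using eqL by eventually_elim (simp add: y)
      show "(\<lambda>x. ?f w x y) \<in> borel_measurable lebesgue"
        by (rule lebesgue_measurable_AE_cong[OF m]) (use eq in \<open>eventually_elim, simp add: y\<close>)
    qed
    then have inner: "AE y in lborel. (LINT x|lebesgue. ?f w x y) = (LINT x|lebesgue. ?f w' x y)"
      using eq by (auto elim!: eventually_mono)
    have e: "(LINT x|lebesgue. ?f w' x y) = (LINT x|lborel. ?f w' x y)" for y
      by (rule integral_completion) measurable
    have m: "(\<lambda>y. LINT x|lebesgue. ?f w' x y) \<in> borel_measurable lebesgue"
      unfolding e by (rule measurable_completion) measurable
    have "(LINT y|lebesgue. LINT x|lebesgue. ?f w x y) = (LINT y|lebesgue. LINT x|lebesgue. ?f w' x y)"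
      by (rule Bochner_Integration.integral_cong_AE[OF lebesgue_measurable_AE_cong[OF m inner] m AE_completion[OF inner]])
    then show ?thesis by (simp add: frac_form_def)
  qed
  ultimately show ?thesis using that eq by blast
qed

lemma integral_lebesgue_on_borel:
  assumes [measurable]: "\<Omega> \<in> sets borel" "h \<in> borel_measurable borel"
  shows "(LINT x|lebesgue_on \<Omega>. h x) = (LINT x|lborel. indicator \<Omega> x * (h x :: real))"
    and "integrable (lebesgue_on \<Omega>) h \<longleftrightarrow> integrable lborel (\<lambda>x. indicator \<Omega> x * h x)"
proof -
  have "(LINT x|lebesgue_on \<Omega>. h x) = (LINT x|lebesgue. indicator \<Omega> x * h x)"
    by (subst integral_restrict_space) auto
  also have "\<dots> = (LINT x|lborel. indicator \<Omega> x * h x)" by (rule integral_completion) measurable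
  finally show "(LINT x|lebesgue_on \<Omega>. h x) = (LINT x|lborel. indicator \<Omega> x * h x)" .
  have "integrable (lebesgue_on \<Omega>) h \<longleftrightarrow> integrable lebesgue (\<lambda>x. indicator \<Omega> x * h x)"
    by (subst integrable_restrict_space) auto
  also have "\<dots> \<longleftrightarrow> integrable lborel (\<lambda>x. indicator \<Omega> x * h x)" by (rule integrable_completion) measurable
  finally show "integrable (lebesgue_on \<Omega>) h \<longleftrightarrow> integrable lborel (\<lambda>x. indicator \<Omega> x * h x)" .
qed

lemma lebesgue_on_borel_representative:
  fixes g :: "'a::euclidean_space \<Rightarrow> real"
  assumes g: "g \<in> borel_measurable (lebesgue_on \<Omega>)" and \<Omega>[measurable]: "\<Omega> \<in> sets borel"
  obtains g' where "g' \<in> borel_measurable borel" "\<And>x. x \<notin> \<Omega> \<Longrightarrow> g' x = 0" "AE x in lebesgue_on \<Omega>. g x = g' x"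
proof -
  have "(\<lambda>x. indicator \<Omega> x *\<^sub>R g x) \<in> borel_measurable lebesgue"
    using g borel_measurable_restrict_space_iff[of \<Omega> lebesgue g] by simp
  then obtain g1 where g1[measurable]: "g1 \<in> borel_measurable borel" and eq: "AE x in lborel. indicator \<Omega> x *\<^sub>R g x = g1 x"
    using completion_ex_borel_measurable_real[of _ lborel] by auto
  show ?thesis
  proof (rule that[of "\<lambda>x. indicator \<Omega> x * g1 x"])
    have "AE x in lebesgue. x \<in> \<Omega> \<longrightarrow> g x = indicator \<Omega> x * g1 x"
      using AE_completion[OF eq] by eventually_elim (auto simp: indicator_def split: if_splits)
    then show "AE x in lebesgue_on \<Omega>. g x = indicator \<Omega> x * g1 x"
      by (subst AE_restrict_space_iff) auto
  qed (auto simp: indicator_def)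
qed

section \<open>Dual norms, extension to all test functions, solvability\<close>

section \<open>Duality\<close>

lemma frac_const_pos:
  assumes "0 < s" "s < 1" shows "0 < frac_const N s"
  unfolding frac_const_def using assms
  by (intro divide_pos_pos mult_pos_pos Gamma_real_pos) auto

lemma lp_norm_cmult:
  assumes "1 \<le> p" shows "lp_norm p (\<lambda>x. c * f x) = \<bar>c\<bar> * lp_norm p f"
proof -
  have "(LINT x|lborel. \<bar>c * f x\<bar> powr p) = \<bar>c\<bar> powr p * (LINT x|lborel. \<bar>f x\<bar> powr p)"
    by (simp add: abs_mult powr_mult)
  then show ?thesis using assms by (simp add: lp_norm_def powr_mult powr_powr)
qed

text \<open>Cancelling the finite term gives \<open>inverse p' = 1 - 1 / p\<close> in the extended
  reals, which is 0 exactly when \<open>p'\<close> is infinite.\<close>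

lemma conjugate_exponent:
  fixes p :: real and p' :: ennreal
  assumes p: "1 \<le> p" and eq: "inverse (ennreal p) + inverse p' = 1"
  shows "(p = 1 \<and> p' = \<infinity>) \<or> (1 < p \<and> p' = ennreal (p / (p - 1)))"
proof -
  have "inverse (ennreal p) = ennreal (1 / p)" using p by (simp add: inverse_ennreal inverse_eq_divide)
  moreover have "(1::ennreal) = ennreal (1 / p) + ennreal (1 - 1 / p)"
    using p by (simp flip: ennreal_plus)
  ultimately have inv: "inverse p' = ennreal (1 - 1 / p)"
    using eq by (metis ennreal_add_left_cancel ennreal_neq_top infinity_ennreal_def)
  show ?thesis
  proof (cases p')
    case (real r)
    have "r \<noteq> 0" using inv real by auto
    then have "r > 0" using real by simp
    then have "ennreal (1 / r) = ennreal (1 - 1 / p)" using inv real by (simp add: inverse_ennreal inverse_eq_divide)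
    then have r: "1 / r = 1 - 1 / p" using \<open>r > 0\<close> p by (subst (asm) ennreal_inj) auto
    then have "p \<noteq> 1" using \<open>r > 0\<close> by auto
    moreover have "r = p / (p - 1)" using r p \<open>p \<noteq> 1\<close> \<open>r > 0\<close> by (simp add: field_simps)
    ultimately show ?thesis using p real by auto
  next
    case top
    then have "ennreal (1 - 1 / p) = 0" using inv by simp
    then have "1 - 1 / p \<le> 0" by (simp add: ennreal_eq_0_iff)
    then have "p = 1" using p by (simp add: field_simps)
    then show ?thesis using top by simp
  qed
qed

context exterior_domain
begin

text \<open>The factor by which \<open>frac_form\<close> differs from the unnormalised form
  \<open>gagliardo\<close>. Dividing the datum by it converts the equation for one form into the
  equation for the other.\<close>

definition half_const :: real where "half_const = frac_const DIM('a) s / 2"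

lemma half_const_pos: "0 < half_const"
  unfolding half_const_def using frac_const_pos[OF s] by simp

definition solution :: "('a \<Rightarrow> real) \<Rightarrow> 'a \<Rightarrow> real" where
  "solution g = green (\<lambda>x. (1 / half_const) * g x)"

lemma solution_C0: "bdd_data g \<Longrightarrow> solution g \<in> C0 \<Omega>"
  using green_sol_green[OF bdd_data_cmult[of g "1 / half_const"]]
  by (auto simp: solution_def green_sol_def C0_def intro: continuous_on_subset)

lemma solution_weak:
  assumes g: "bdd_data g" shows "weak_frac_laplacian s (ennreal p) \<Omega> (solution g) g"
  unfolding weak_frac_laplacian_def
proof (intro conjI ballI)
  let ?v = "solution g"
  have sol: "green_sol (\<lambda>x. (1 / half_const) * g x) ?v"
    unfolding solution_def by (intro green_sol_green bdd_data_cmult g)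
  have v: "?v \<in> H0 s \<Omega>" using sol by (simp add: green_sol_def)
  have vm[measurable]: "?v \<in> borel_measurable borel" by (rule Hs_measurable[OF H0_Hs[OF v]])
  have gm[measurable]: "g \<in> borel_measurable borel" by (rule bdd_data_measurable[OF g])
  have g0: "indicator \<Omega> x * \<bar>g x\<bar> powr p = \<bar>g x\<bar> powr p" "indicator \<Omega> x * (g x * y) = g x * y" for x y
    using g by (auto simp: bdd_data_def indicator_def)
  show "?v \<in> W0_s2 s \<Omega>" using v H0_iff_W0_s2[OF vm] by blast
  have gL: "g \<in> borel_measurable (lebesgue_on \<Omega>)"
    by (intro measurable_restrict_space1 measurable_completion) simp
  have "integrable (lebesgue_on \<Omega>) (\<lambda>x. \<bar>g x\<bar> powr p)"
    using bdd_data_powr_integrable[OF g]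
    by (subst integral_lebesgue_on_borel(2)) (simp_all add: g0)
  then show "g \<in> Lp (ennreal p) (lebesgue_on \<Omega>)" using gL p by (simp add: Lp_def)
  fix w assume w: "w \<in> W0_s2 s \<Omega>"
  then have wL: "w \<in> borel_measurable (lebesgue_on \<Omega>)"
    by (intro measurable_restrict_space1) (auto simp: W0_s2_def W_s2_def Lp_def)
  obtain w' where w': "w' \<in> H0 s \<Omega>" and eq: "AE x in lborel. w x = w' x"
    and form: "\<And>v. v \<in> borel_measurable borel \<Longrightarrow> frac_form s v w = frac_form s v w'"
    by (rule W0_s2_borel_representative[OF w]) (rule that)
  have w'm[measurable]: "w' \<in> borel_measurable borel" by (rule Hs_measurable[OF H0_Hs[OF w']])
  have w'L: "w' \<in> borel_measurable (lebesgue_on \<Omega>)"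
    by (intro measurable_restrict_space1 measurable_completion) simp
  have "frac_form s ?v w = half_const * gagliardo s ?v w'"
    using form[OF vm] frac_form_eq_gagliardo[OF H0_Hs[OF v] H0_Hs[OF w']] by (simp add: half_const_def)
  also have "gagliardo s ?v w' = (LINT x|lborel. (1 / half_const) * g x * w' x)"
    using sol w' by (simp add: green_sol_def)
  also have "\<dots> = (1 / half_const) * (LINT x|lborel. g x * w' x)" by (simp add: mult.assoc)
  also have "half_const * \<dots> = (LINT x|lborel. g x * w' x)" using half_const_pos by simp
  also have "\<dots> = (LINT x|lborel. indicator \<Omega> x * (g x * w' x))"
    by (simp only: g0)
  also have "\<dots> = (LINT x|lebesgue_on \<Omega>. g x * w' x)" by (rule integral_lebesgue_on_borel(1)[symmetric]) auto
  also have "\<dots> = (LINT x|lebesgue_on \<Omega>. g x * w x)"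
  proof (rule Bochner_Integration.integral_cong_AE)
    have "AE x in lebesgue. x \<in> \<Omega> \<longrightarrow> g x * w' x = g x * w x"
      using AE_completion[OF eq] by eventually_elim simp
    then show "AE x in lebesgue_on \<Omega>. g x * w' x = g x * w x" by (subst AE_restrict_space_iff) auto
  qed (use gL wL w'L in \<open>auto intro: borel_measurable_times\<close>)
  finally show "frac_form s ?v w = (LINT x|lebesgue_on \<Omega>. g x * w x)" .
qed

lemma solution_V_space: "bdd_data g \<Longrightarrow> solution g \<in> V_space s (ennreal p) \<Omega>"
  using solution_C0 solution_weak by (auto simp: V_space_def weak_frac_laplacian_def)

text \<open>Replaces the Lebesgue measurable datum by a Borel one that is 0 off
  \<open>\<Omega>\<close>. On a set of finite measure p-integrability implies integrability, so the
  result is a datum in the sense of \<open>weak_sol\<close>.\<close>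

lemma weak_frac_laplacian_representative:
  assumes v: "v \<in> C0 \<Omega>" and weak: "weak_frac_laplacian s (ennreal p) \<Omega> v g"
  obtains g' where "g' \<in> borel_measurable borel" "\<And>x. x \<notin> \<Omega> \<Longrightarrow> g' x = 0" "AE x in lebesgue_on \<Omega>. g x = g' x"
    "integrable lborel (\<lambda>x. \<bar>g' x\<bar> powr p)" "integrable lborel g'" "weak_sol s \<Omega> v (\<lambda>x. (1 / half_const) * g' x)"
proof -
  have gL: "g \<in> borel_measurable (lebesgue_on \<Omega>)" and gp: "integrable (lebesgue_on \<Omega>) (\<lambda>x. \<bar>g x\<bar> powr p)"
    using weak p by (auto simp: weak_frac_laplacian_def Lp_def)
  obtain g' where g'[measurable]: "g' \<in> borel_measurable borel" and g'0: "\<And>x. x \<notin> \<Omega> \<Longrightarrow> g' x = 0"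
    and eq: "AE x in lebesgue_on \<Omega>. g x = g' x"
    by (rule lebesgue_on_borel_representative[OF gL domain_measurable]) (rule that)
  have g'L: "g' \<in> borel_measurable (lebesgue_on \<Omega>)"
    by (intro measurable_restrict_space1 measurable_completion) simp
  have g0: "indicator \<Omega> x * \<bar>g' x\<bar> powr p = \<bar>g' x\<bar> powr p" "indicator \<Omega> x * \<bar>g' x\<bar> = \<bar>g' x\<bar>"
    "indicator \<Omega> x * (g' x * y) = g' x * y" for x y
    using g'0[of x] by (auto simp: indicator_def)
  have "integrable (lebesgue_on \<Omega>) (\<lambda>x. \<bar>g' x\<bar> powr p)"
    by (rule integrable_cong_AE_imp[OF gp]) (use eq g'L in \<open>auto elim!: eventually_mono\<close>)
  then have g'p: "integrable lborel (\<lambda>x. \<bar>g' x\<bar> powr p)"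
    by (subst (asm) integral_lebesgue_on_borel(2)) (simp_all add: g0)
  have "integrable lborel (\<lambda>x. indicator \<Omega> x * \<bar>g' x\<bar>)"
    by (rule holder_indicator(2)[OF p(1) g' domain_measurable g'p domain_finite])
  then have g'i: "integrable lborel g'"
    unfolding g0 by (subst (asm) integrable_abs_iff) auto
  \<comment> \<open>Continuity on \<open>\<Omega>\<close> together with the value 0 elsewhere makes
    \<open>v\<close> Borel as it stands; no representative has to be chosen.\<close>
  have vm[measurable]: "v \<in> borel_measurable borel"
  proof -
    have "continuous_on \<Omega> v" using v closure_subset by (auto simp: C0_def intro: continuous_on_subset)
    then have "(\<lambda>x. indicator \<Omega> x *\<^sub>R v x) \<in> borel_measurable borel"
      using borel_measurable_continuous_on_indicator[OF domain_measurable] by blast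
    moreover have "(\<lambda>x. indicator \<Omega> x *\<^sub>R v x) = v" using v by (auto simp: C0_def indicator_def fun_eq_iff)
    ultimately show ?thesis by simp
  qed
  have vH: "v \<in> H0 s \<Omega>" using weak H0_iff_W0_s2[OF vm] by (auto simp: weak_frac_laplacian_def)
  have "gagliardo s v w = (LINT x|lborel. (1 / half_const) * g' x * w x)" if w: "w \<in> H0 s \<Omega>" for w
  proof -
    have wm[measurable]: "w \<in> borel_measurable borel" by (rule Hs_measurable[OF H0_Hs[OF w]])
    have wL: "w \<in> borel_measurable (lebesgue_on \<Omega>)"
      by (intro measurable_restrict_space1 measurable_completion) simp
    have "half_const * gagliardo s v w = frac_form s v w"
      using frac_form_eq_gagliardo[OF H0_Hs[OF vH] H0_Hs[OF w]] by (simp add: half_const_def)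
    also have "\<dots> = (LINT x|lebesgue_on \<Omega>. g x * w x)"
      using weak w H0_iff_W0_s2[OF wm] by (auto simp: weak_frac_laplacian_def)
    also have "\<dots> = (LINT x|lebesgue_on \<Omega>. g' x * w x)"
      by (rule Bochner_Integration.integral_cong_AE)
        (use gL g'L wL eq in \<open>auto intro: borel_measurable_times elim!: eventually_mono\<close>)
    also have "\<dots> = (LINT x|lborel. indicator \<Omega> x * (g' x * w x))" by (rule integral_lebesgue_on_borel(1)) auto
    also have "\<dots> = (LINT x|lborel. g' x * w x)" by (simp only: g0)
    finally have "gagliardo s v w = (1 / half_const) * (LINT x|lborel. g' x * w x)"
      using half_const_pos by (simp add: field_simps)
    also have "\<dots> = (LINT x|lborel. (1 / half_const) * (g' x * w x))" by (rule integral_mult_right_zero[symmetric])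
    finally show ?thesis by (simp only: mult.assoc)
  qed
  then have "weak_sol s \<Omega> v (\<lambda>x. (1 / half_const) * g' x)" using vH by (simp add: weak_sol_def)
  then show ?thesis using that g' g'0 eq g'p g'i by blast
qed

text \<open>The Green operator is not defined for an unbounded datum \<open>g\<close>. The estimate
  shows instead that any \<open>v\<close> in \<open>C0\<close> solving with \<open>g\<close> is the
  uniform limit of \<open>solution h\<close> as bounded \<open>h\<close> approach \<open>g\<close>
  in the p-norm. It extends from almost every point to all of them by continuity inside and the
  common value 0 outside.\<close>

lemma solution_approx:
  assumes v: "v \<in> C0 \<Omega>" and sol: "weak_sol s \<Omega> v (\<lambda>x. (1 / half_const) * g x)" and g: "integrable lborel g"
    and h: "bdd_data h" and gh: "integrable lborel (\<lambda>x. \<bar>g x - h x\<bar> powr p)"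
  shows "\<bar>v x - solution h x\<bar> \<le> sup_const / half_const * lp_norm p (\<lambda>x. g x - h x)"
proof -
  define d where "d x = v x - solution h x" for x
  define c where "c = sup_const / half_const * lp_norm p (\<lambda>x. g x - h x)"
  have c: "0 \<le> c" using sup_const_nonneg half_const_pos by (simp add: c_def)
  have hsol: "weak_sol s \<Omega> (solution h) (\<lambda>x. (1 / half_const) * h x)"
    unfolding solution_def by (intro green_sol_weak_sol green_sol_green bdd_data_cmult h)
  have eq: "(\<lambda>x. (1 / half_const) * g x - (1 / half_const) * h x) = (\<lambda>x. (1 / half_const) * (g x - h x))"
    by (simp add: right_diff_distrib)
  have "weak_sol s \<Omega> d (\<lambda>x. (1 / half_const) * (g x - h x))"
    unfolding d_def eq[symmetric]
    using g bdd_data_integrable[OF h] by (intro weak_sol_diff sol hsol) auto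
  moreover have "integrable lborel (\<lambda>x. \<bar>(1 / half_const) * (g x - h x)\<bar> powr p)"
    using gh by (simp add: abs_mult powr_mult del: times_divide_eq_left)
  ultimately have "AE x in lborel. \<bar>d x\<bar> \<le> sup_const * lp_norm p (\<lambda>x. (1 / half_const) * (g x - h x))"
    using g bdd_data_integrable[OF h] by (intro sup_bound) auto
  then have ae: "AE x in lborel. \<bar>d x\<bar> \<le> c"
    unfolding lp_norm_cmult[OF p(1)] using half_const_pos by (simp add: c_def)
  have dC0: "d \<in> C0 \<Omega>" unfolding d_def by (intro C0_diff v solution_C0 h)
  have "\<Omega> \<inter> (\<lambda>x. \<bar>d x\<bar>) -` {c<..} = {}"
  proof (rule open_AE_empty)
    have "continuous_on \<Omega> d" using dC0 closure_subset by (auto simp: C0_def intro: continuous_on_subset)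
    then show "open (\<Omega> \<inter> (\<lambda>x. \<bar>d x\<bar>) -` {c<..})"
      by (intro continuous_open_preimage open_domain continuous_intros) auto
    show "AE x in lborel. x \<notin> \<Omega> \<inter> (\<lambda>x. \<bar>d x\<bar>) -` {c<..}" using ae by eventually_elim auto
  qed
  moreover have "d x = 0" if "x \<notin> \<Omega>" using that dC0 by (simp add: C0_def)
  ultimately have "\<bar>d x\<bar> \<le> c" using c by (cases "x \<in> \<Omega>") force+
  then show ?thesis by (simp add: d_def c_def)
qed

lemma solution_bound:
  assumes g: "bdd_data g" shows "\<bar>solution g x\<bar> \<le> sup_const / half_const * lp_norm p g"
  using green_bound[OF bdd_data_cmult[OF g], of "1 / half_const" x] half_const_pos
  unfolding solution_def lp_norm_cmult[OF p(1)] by simp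

text \<open>Each of the two parts in \<open>pairing\<close> is a finite measure with its own
  density. The difference of the densities is rescaled by \<open>1 / half_const\<close>, as the
  datum is in \<open>solution\<close>, and cut off outside \<open>\<Omega>\<close>.\<close>

lemma pairing_representation:
  assumes \<mu>: "radon_measure \<Omega> \<mu>"
  obtains u where "integrable lborel u" "\<And>x. x \<notin> \<Omega> \<Longrightarrow> u x = 0"
    "\<And>g. bdd_data g \<Longrightarrow> pairing \<Omega> \<mu> (solution g) = (LINT x|lborel. u x * g x)"
proof -
  note \<mu>' = radon_measure_uminus[OF \<mu>]
  obtain f1 where f1: "integrable lborel f1"
    "\<And>g. bdd_data g \<Longrightarrow> (LINT x|pos_variation \<Omega> \<mu>. green g x) = (LINT x|lborel. f1 x * g x)"
    by (rule green_density[OF finite_pos_variation[OF \<mu> domain_measurable] sets_pos_variation[OF domain_measurable]]) (rule that)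
  obtain f2 where f2: "integrable lborel f2"
    "\<And>g. bdd_data g \<Longrightarrow> (LINT x|pos_variation \<Omega> (\<lambda>A. - \<mu> A). green g x) = (LINT x|lborel. f2 x * g x)"
    by (rule green_density[OF finite_pos_variation[OF \<mu>' domain_measurable] sets_pos_variation[OF domain_measurable]]) (rule that)
  define u where "u x = indicator \<Omega> x * ((1 / half_const) * (f1 x - f2 x))" for x
  show ?thesis
  proof (rule that[of u])
    show "integrable lborel u" unfolding u_def
      using f1(1) f2(1) by (intro integrable_mult_bounded[where f="indicator \<Omega>" and B=1]) (auto simp: indicator_def)
    show "u x = 0" if "x \<notin> \<Omega>" for x using that by (simp add: u_def)
    fix g assume g: "bdd_data g"
    let ?g = "\<lambda>x. (1 / half_const) * g x"
    have g': "bdd_data ?g" by (rule bdd_data_cmult[OF g])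
    obtain M where M: "\<And>x. \<bar>?g x\<bar> \<le> M" using g' by (auto simp: bdd_data_def)
    have gm: "?g \<in> borel_measurable lborel" using bdd_data_measurable[OF g'] by simp
    have "integrable lborel (\<lambda>x. ?g x * f1 x)" "integrable lborel (\<lambda>x. ?g x * f2 x)"
      by (rule integrable_mult_bounded[OF f1(1) gm M], rule integrable_mult_bounded[OF f2(1) gm M])
    then have i: "integrable lborel (\<lambda>x. f1 x * ?g x)" "integrable lborel (\<lambda>x. f2 x * ?g x)"
      by (simp_all add: mult.commute)
    have "pairing \<Omega> \<mu> (solution g) = (LINT x|lborel. f1 x * ?g x) - (LINT x|lborel. f2 x * ?g x)"
      unfolding pairing_def solution_def f1(2)[OF g'] f2(2)[OF g'] ..
    also have "\<dots> = (LINT x|lborel. f1 x * ?g x - f2 x * ?g x)"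
      by (rule Bochner_Integration.integral_diff[OF i, symmetric])
    also have "\<dots> = (LINT x|lborel. u x * g x)"
    proof (rule Bochner_Integration.integral_cong[OF refl])
      fix x
      show "f1 x * ?g x - f2 x * ?g x = u x * g x"
        using g by (cases "x \<in> \<Omega>") (auto simp: u_def bdd_data_def algebra_simps diff_divide_distrib)
    qed
    finally show "pairing \<Omega> \<mu> (solution g) = (LINT x|lborel. u x * g x)" .
  qed
qed

text \<open>The datum is the sign of \<open>u\<close> on \<open>A\<close>, the set where
  \<open>K < \<bar>u x\<bar>\<close>. It gives an integral of \<open>\<bar>u x\<bar>\<close> over
  \<open>A\<close> of at most \<open>K\<close> times the measure of \<open>A\<close>, which forces
  \<open>A\<close> to be a null set.\<close>

lemma dual_bound_infinity:
  assumes u: "integrable lborel u" and u0: "\<And>x. x \<notin> \<Omega> \<Longrightarrow> u x = 0"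
    and K: "\<And>g. bdd_data g \<Longrightarrow> (LINT x|lborel. u x * g x) \<le> K * lp_norm 1 g" and K0: "0 \<le> K"
  shows "AE x in lborel. \<bar>u x\<bar> \<le> K"
proof -
  have [measurable]: "u \<in> borel_measurable borel" using u by auto
  define A where "A = {x\<in>\<Omega>. K < \<bar>u x\<bar>}"
  have [measurable]: "A \<in> sets borel" unfolding A_def by measurable
  have Af: "emeasure lborel A < \<infinity>"
    using domain_finite by (intro le_less_trans[OF emeasure_mono[of A \<Omega>]]) (auto simp: A_def)
  define g where "g x = sgn (u x) * indicator A x" for x
  have "bdd_data g" unfolding bdd_data_def
  proof (intro conjI exI allI impI)
    show "g \<in> borel_measurable borel" unfolding g_def by measurable
    show "\<bar>g x\<bar> \<le> 1" for x by (auto simp: g_def indicator_def sgn_if)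
    show "g x = 0" if "x \<notin> \<Omega>" for x using that by (simp add: g_def A_def)
  qed
  then have "(LINT x|lborel. u x * g x) \<le> K * lp_norm 1 g" by (rule K)
  also have "lp_norm 1 g = (LINT x|lborel. indicator A x)"
  proof -
    have "\<bar>g x\<bar> powr 1 = indicator A x" for x
      using K0 by (auto simp: g_def A_def indicator_def sgn_if)
    then show ?thesis by (simp add: lp_norm_def)
  qed
  also have "(\<lambda>x. u x * g x) = (\<lambda>x. indicator A x * \<bar>u x\<bar>)"
    by (auto simp: g_def abs_sgn fun_eq_iff mult_ac)
  finally have le: "(LINT x|lborel. indicator A x * \<bar>u x\<bar>) \<le> K * (LINT x|lborel. indicator A x)" .
  have i1: "integrable lborel (\<lambda>x. indicator A x * \<bar>u x\<bar>)"
    using u by (intro integrable_mult_bounded[where B=1]) (auto simp: indicator_def)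
  have i2: "integrable lborel (\<lambda>x. K * indicator A x)" using Af by (simp add: integrable_indicator_iff)
  have i: "integrable lborel (\<lambda>x. indicator A x * \<bar>u x\<bar> - K * indicator A x)"
    by (rule Bochner_Integration.integrable_diff[OF i1 i2])
  have nn: "0 \<le> indicator A x * \<bar>u x\<bar> - K * indicator A x" for x by (auto simp: A_def indicator_def)
  have "(LINT x|lborel. indicator A x * \<bar>u x\<bar> - K * indicator A x) \<le> 0"
    using le unfolding Bochner_Integration.integral_diff[OF i1 i2] by simp
  moreover have "0 \<le> (LINT x|lborel. indicator A x * \<bar>u x\<bar> - K * indicator A x)"
    by (intro integral_nonneg_AE AE_I2 nn)
  ultimately have "(LINT x|lborel. indicator A x * \<bar>u x\<bar> - K * indicator A x) = 0" by simp
  then have "AE x in lborel. indicator A x * \<bar>u x\<bar> - K * indicator A x = 0"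
    using integral_nonneg_eq_0_iff_AE[OF i] nn by simp
  then show ?thesis
  proof eventually_elim
    case (elim x)
    then have "x \<notin> A" by (auto simp: A_def)
    then show ?case using u0[of x] K0 by (cases "x \<in> \<Omega>") (auto simp: A_def not_less)
  qed
qed

text \<open>The extremal datum of the duality is the sign of \<open>u\<close> times
  \<open>\<bar>u x\<bar> powr (q - 1)\<close>. Cutting \<open>\<bar>u x\<bar>\<close> at
  \<open>n\<close> makes it bounded, and the resulting bound, free of \<open>n\<close>, passes to
  \<open>u\<close> by Fatou.\<close>

lemma dual_bound_finite:
  assumes p1: "1 < p" and u: "integrable lborel u" and u0: "\<And>x. x \<notin> \<Omega> \<Longrightarrow> u x = 0"
    and K: "\<And>g. bdd_data g \<Longrightarrow> (LINT x|lborel. u x * g x) \<le> K * lp_norm p g" and K0: "0 \<le> K"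
  defines "q \<equiv> p / (p - 1)"
  shows "integrable lborel (\<lambda>x. \<bar>u x\<bar> powr q)" "lp_norm q u \<le> K"
proof -
  have [measurable]: "u \<in> borel_measurable borel" using u by auto
  have q: "1 < q" "1 / q = 1 - 1 / p" "(q - 1) * p = q" using p1 by (auto simp: q_def field_simps)
  define m where "m n x = min \<bar>u x\<bar> (real n)" for n x
  have [measurable]: "m n \<in> borel_measurable borel" for n unfolding m_def by measurable
  have m: "0 \<le> m n x" "m n x \<le> \<bar>u x\<bar>" "m n x \<le> real n" for n x by (auto simp: m_def)
  have I: "(LINT x|lborel. m n x powr q) \<le> K powr q" and mi: "integrable lborel (\<lambda>x. m n x powr q)" for n
  proof -
    define g where "g x = sgn (u x) * m n x powr (q - 1)" for x
    have g: "bdd_data g" unfolding bdd_data_def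
    proof (intro conjI exI allI impI)
      show "g \<in> borel_measurable borel" unfolding g_def by measurable
      show "\<bar>g x\<bar> \<le> real n powr (q - 1)" for x
      proof -
        have "\<bar>g x\<bar> \<le> 1 * m n x powr (q - 1)"
          unfolding g_def abs_mult by (intro mult_mono) (auto simp: sgn_if)
        also have "\<dots> \<le> real n powr (q - 1)" using m[of n x] q by (simp add: powr_mono2)
        finally show ?thesis .
      qed
      show "g x = 0" if "x \<notin> \<Omega>" for x using u0[OF that] by (simp add: g_def)
    qed
    have gp: "\<bar>g x\<bar> powr p = m n x powr q" for x
    proof (cases "u x = 0")
      case True then show ?thesis by (simp add: g_def m_def)
    next
      case False
      then have "\<bar>g x\<bar> = m n x powr (q - 1)" by (simp add: g_def abs_mult abs_sgn_eq)
      then show ?thesis using q by (simp add: powr_powr)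
    qed
    show mi: "integrable lborel (\<lambda>x. m n x powr q)" using bdd_data_powr_integrable[OF g] by (simp add: gp)
    define J where "J = (LINT x|lborel. m n x powr q)"
    have J0: "0 \<le> J" by (simp add: J_def)
    have "J \<le> (LINT x|lborel. u x * g x)"
      unfolding J_def
    proof (rule integral_mono[OF mi])
      obtain M where "\<And>x. \<bar>g x\<bar> \<le> M" using g by (auto simp: bdd_data_def)
      then have "integrable lborel (\<lambda>x. g x * u x)"
        using bdd_data_measurable[OF g] by (intro integrable_mult_bounded[OF u, where B=M]) auto
      then show "integrable lborel (\<lambda>x. u x * g x)" by (simp add: mult.commute)
      fix x
      have "m n x powr q = m n x * m n x powr (q - 1)"
        using powr_add[of "m n x" 1 "q - 1"] m[of n x] by simp
      also have "\<dots> \<le> \<bar>u x\<bar> * m n x powr (q - 1)" using m[of n x] by (intro mult_right_mono) auto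
      also have "\<dots> = u x * g x" by (simp add: g_def abs_sgn mult.assoc)
      finally show "m n x powr q \<le> u x * g x" .
    qed
    also have "\<dots> \<le> K * lp_norm p g" by (rule K[OF g])
    also have "lp_norm p g = J powr (1 / p)" by (simp add: lp_norm_def gp J_def)
    finally have JK: "J \<le> K * J powr (1 / p)" .
    show "(LINT x|lborel. m n x powr q) \<le> K powr q"
    proof (cases "J = 0")
      case False
      then have J: "J > 0" using J0 by simp
      have "J powr (1 / q) = J / J powr (1 / p)" unfolding q(2) using J by (simp add: powr_diff)
      also have "\<dots> \<le> K" using JK J by (simp add: field_simps)
      finally have "(J powr (1 / q)) powr q \<le> K powr q" using q by (intro powr_mono2) auto
      moreover have "(J powr (1 / q)) powr q = J" using q(1) J by (simp add: powr_powr)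
      ultimately show ?thesis by (simp add: J_def)
    qed (simp add: J_def)
  qed
  have nn: "(\<integral>\<^sup>+x. ennreal (\<bar>u x\<bar> powr q) \<partial>lborel) \<le> ennreal (K powr q)"
  proof (rule nn_integral_fatou_bound[where f="\<lambda>n x. m n x powr q" and n=0])
    show "AE x in lborel. (\<lambda>n. m n x powr q) \<longlonglongrightarrow> \<bar>u x\<bar> powr q"
    proof (rule AE_I2)
      fix x
      obtain N :: nat where N: "\<bar>u x\<bar> \<le> real N" using real_arch_simple by blast
      have "\<forall>n\<ge>N. m n x powr q = \<bar>u x\<bar> powr q" using N by (auto simp: m_def)
      then show "(\<lambda>n. m n x powr q) \<longlonglongrightarrow> \<bar>u x\<bar> powr q"
        by (intro tendsto_eventually) (auto simp: eventually_sequentially)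
    qed
    show "(\<integral>\<^sup>+x. ennreal (m j x powr q) \<partial>lborel) \<le> ennreal (K powr q)" for j
      using I[of j] by (subst nn_integral_eq_integral[OF mi]) (auto intro: ennreal_leI)
  qed measurable
  then show ui: "integrable lborel (\<lambda>x. \<bar>u x\<bar> powr q)"
    by (intro integrableI_bounded) (auto intro: le_less_trans)
  have "ennreal (LINT x|lborel. \<bar>u x\<bar> powr q) \<le> ennreal (K powr q)"
    using nn by (subst (asm) nn_integral_eq_integral[OF ui]) auto
  then have "(LINT x|lborel. \<bar>u x\<bar> powr q) \<le> K powr q" by (subst (asm) ennreal_le_iff) auto
  then have "lp_norm q u \<le> (K powr q) powr (1 / q)"
    unfolding lp_norm_def using q(1) by (intro powr_mono2) auto
  then show "lp_norm q u \<le> K" using q(1) K0 by (simp add: powr_powr)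
qed

text \<open>Membership in the dual exponent space, in terms of p alone and on the whole space; p = 1
  is split off because there the dual exponent is infinite.\<close>

definition dual_integrable :: "('a \<Rightarrow> real) \<Rightarrow> bool" where
  "dual_integrable u \<longleftrightarrow> u \<in> borel_measurable borel \<and>
     (if p = 1 then \<exists>c. AE x in lborel. \<bar>u x\<bar> \<le> c else integrable lborel (\<lambda>x. \<bar>u x\<bar> powr (p / (p - 1))))"

lemma dual_integrable_mult:
  assumes u: "dual_integrable u" and g: "integrable lborel g" "integrable lborel (\<lambda>x. \<bar>g x\<bar> powr p)"
  shows "integrable lborel (\<lambda>x. u x * g x)"
proof -
  have [measurable]: "u \<in> borel_measurable borel" "g \<in> borel_measurable borel"
    using u g by (auto simp: dual_integrable_def)
  show ?thesis
  proof (cases "p = 1")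
    case True
    then obtain c where c: "AE x in lborel. \<bar>u x\<bar> \<le> c" using u[unfolded dual_integrable_def] by auto
    show ?thesis
    proof (rule Bochner_Integration.integrable_bound)
      show "integrable lborel (\<lambda>x. c * g x)" using g by simp
      show "AE x in lborel. norm (u x * g x) \<le> norm (c * g x)"
        using c by eventually_elim (auto simp: abs_mult intro!: mult_right_mono)
    qed measurable
  next
    case False
    then have p1: "1 < p" using p by simp
    define q where "q = p / (p - 1)"
    have q: "1 < q" "1 / p + 1 / q = 1" using p1 by (auto simp: q_def field_simps)
    have uq: "integrable lborel (\<lambda>x. \<bar>u x\<bar> powr q)" using u False by (simp add: dual_integrable_def q_def)
    show ?thesis
    proof (rule Bochner_Integration.integrable_bound)
      show "integrable lborel (\<lambda>x. \<bar>g x\<bar> powr p / p + \<bar>u x\<bar> powr q / q)" using uq g by auto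
      show "AE x in lborel. norm (u x * g x) \<le> norm (\<bar>g x\<bar> powr p / p + \<bar>u x\<bar> powr q / q)"
      proof (rule AE_I2)
        fix x
        have "\<bar>g x\<bar> * \<bar>u x\<bar> \<le> \<bar>g x\<bar> powr p / p + \<bar>u x\<bar> powr q / q"
          by (rule Youngs_inequality[OF p1 q]) auto
        then show "norm (u x * g x) \<le> norm (\<bar>g x\<bar> powr p / p + \<bar>u x\<bar> powr q / q)"
          unfolding real_norm_def abs_mult by (simp add: mult.commute)
      qed
    qed measurable
  qed
qed

lemma dual_integrable_Lp:
  assumes u[measurable]: "u \<in> borel_measurable borel" and u0: "\<And>x. x \<notin> \<Omega> \<Longrightarrow> u x = 0"
    and p': "inverse (ennreal p) + inverse p' = 1"
  shows "u \<in> Lp p' (lebesgue_on \<Omega>) \<longleftrightarrow> dual_integrable u"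
proof -
  have uL: "u \<in> borel_measurable (lebesgue_on \<Omega>)"
    by (intro measurable_restrict_space1 measurable_completion) simp
  have ae: "(AE x in lebesgue_on \<Omega>. \<bar>u x\<bar> \<le> c) \<longleftrightarrow> (AE x in lborel. x \<in> \<Omega> \<longrightarrow> \<bar>u x\<bar> \<le> c)" for c
    by (subst AE_restrict_space_iff) (auto simp: AE_completion_iff)
  have E1: "(\<exists>c. AE x in lebesgue_on \<Omega>. \<bar>u x\<bar> \<le> c) \<longleftrightarrow> (\<exists>c. AE x in lborel. \<bar>u x\<bar> \<le> c)"
  proof
    assume "\<exists>c. AE x in lebesgue_on \<Omega>. \<bar>u x\<bar> \<le> c"
    then obtain c where "AE x in lborel. x \<in> \<Omega> \<longrightarrow> \<bar>u x\<bar> \<le> c" unfolding ae by blast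
    then have "AE x in lborel. \<bar>u x\<bar> \<le> max c 0" by eventually_elim (use u0 in force)
    then show "\<exists>c. AE x in lborel. \<bar>u x\<bar> \<le> c" by blast
  next
    assume "\<exists>c. AE x in lborel. \<bar>u x\<bar> \<le> c"
    then obtain c where "AE x in lborel. \<bar>u x\<bar> \<le> c" by blast
    then have "AE x in lborel. x \<in> \<Omega> \<longrightarrow> \<bar>u x\<bar> \<le> c" by eventually_elim simp
    then show "\<exists>c. AE x in lebesgue_on \<Omega>. \<bar>u x\<bar> \<le> c" unfolding ae by blast
  qed
  have E2: "integrable (lebesgue_on \<Omega>) (\<lambda>x. \<bar>u x\<bar> powr q) \<longleftrightarrow> integrable lborel (\<lambda>x. \<bar>u x\<bar> powr q)" for q
  proof -
    have "(\<lambda>x. indicator \<Omega> x * \<bar>u x\<bar> powr q) = (\<lambda>x. \<bar>u x\<bar> powr q)"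
      using u0 by (auto simp: indicator_def fun_eq_iff)
    then show ?thesis by (subst integral_lebesgue_on_borel(2)) auto
  qed
  consider "p = 1" "p' = \<infinity>" | "1 < p" "p' = ennreal (p / (p - 1))"
    using conjugate_exponent[OF p(1) p'] by blast
  then show ?thesis
  proof cases
    case 1
    then show ?thesis unfolding Lp_def dual_integrable_def using uL u E1 by simp
  next
    case 2
    then have "enn2real p' = p / (p - 1)" by simp
    then show ?thesis unfolding Lp_def dual_integrable_def using uL u 2 by (simp add: E2)
  qed
qed

lemma Lp_norm_le:
  assumes u: "integrable lborel u" and u0: "\<And>x. x \<notin> \<Omega> \<Longrightarrow> u x = 0"
    and K: "\<And>g. bdd_data g \<Longrightarrow> (LINT x|lborel. u x * g x) \<le> K * lp_norm p g" and K0: "0 \<le> K"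
    and p': "inverse (ennreal p) + inverse p' = 1"
  shows "dual_integrable u" "Lp_norm p' (lebesgue_on \<Omega>) u \<le> K"
proof -
  have [measurable]: "u \<in> borel_measurable borel" using u by auto
  have uL: "u \<in> borel_measurable (lebesgue_on \<Omega>)"
    by (intro measurable_restrict_space1 measurable_completion) simp
  consider "p = 1" "p' = \<infinity>" | "1 < p" "p' = ennreal (p / (p - 1))"
    using conjugate_exponent[OF p(1) p'] by blast
  then have "dual_integrable u \<and> Lp_norm p' (lebesgue_on \<Omega>) u \<le> K"
  proof cases
    case 1
    have ae: "AE x in lborel. \<bar>u x\<bar> \<le> K"
      by (rule dual_bound_infinity[OF u u0 _ K0]) (use K 1 in auto)
    have "AE x in lebesgue_on \<Omega>. ennreal \<bar>u x\<bar> \<le> ennreal K"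
      by (subst AE_restrict_space_iff) (use AE_completion[OF ae] in \<open>auto elim!: eventually_mono intro: ennreal_leI\<close>)
    then have "esssup (lebesgue_on \<Omega>) (\<lambda>x. ennreal \<bar>u x\<bar>) \<le> ennreal K"
      using uL by (intro esssup_I) auto
    then have "enn2real (esssup (lebesgue_on \<Omega>) (\<lambda>x. ennreal \<bar>u x\<bar>)) \<le> K"
      using K0 by (rule enn2real_leI[rotated])
    then show ?thesis unfolding Lp_norm_def dual_integrable_def using ae 1 by auto
  next
    case 2
    define q where "q = p / (p - 1)"
    have q: "0 < q" using 2 by (simp add: q_def)
    note D = dual_bound_finite[OF 2(1) u u0 K K0, folded q_def]
    have "(\<lambda>x. indicator \<Omega> x * \<bar>u x\<bar> powr q) = (\<lambda>x. \<bar>u x\<bar> powr q)"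
      using u0 by (auto simp: indicator_def fun_eq_iff)
    then have "(LINT x|lebesgue_on \<Omega>. \<bar>u x\<bar> powr q) = (LINT x|lborel. \<bar>u x\<bar> powr q)"
      by (subst integral_lebesgue_on_borel(1)) auto
    then have "Lp_norm p' (lebesgue_on \<Omega>) u = lp_norm q u"
      using 2 q by (simp add: Lp_norm_def lp_norm_def q_def)
    then show ?thesis using D 2 by (simp add: dual_integrable_def q_def)
  qed
  then show "dual_integrable u" "Lp_norm p' (lebesgue_on \<Omega>) u \<le> K" by auto
qed

lemma dual_integrable_integrable:
  assumes u: "dual_integrable u" and u0: "\<And>x. x \<notin> \<Omega> \<Longrightarrow> u x = 0" shows "integrable lborel u"
proof -
  have [measurable]: "u \<in> borel_measurable borel" using u by (simp add: dual_integrable_def)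
  have one: "bdd_data (\<lambda>x. indicator \<Omega> x * 1)" by (rule bdd_data_restrict[of _ 1]) auto
  have "integrable lborel (\<lambda>x. u x * (indicator \<Omega> x * 1))"
    by (intro dual_integrable_mult u bdd_data_integrable bdd_data_powr_integrable one)
  moreover have "(\<lambda>x. u x * (indicator \<Omega> x * 1)) = u" using u0 by (auto simp: indicator_def fun_eq_iff)
  ultimately show ?thesis by simp
qed

text \<open>The datum \<open>g\<close> is cut at \<open>n\<close>. The corresponding solutions
  converge to \<open>v\<close> uniformly, and the pairing is continuous for the sup norm; the
  integrals against \<open>u\<close> converge by domination, \<open>u * g\<close> being integrable
  by Young's inequality or by boundedness of \<open>u\<close>.\<close>

lemma pairing_limit:
  assumes \<mu>: "radon_measure \<Omega> \<mu>" and u: "dual_integrable u"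
    and rep: "\<And>g. bdd_data g \<Longrightarrow> pairing \<Omega> \<mu> (solution g) = (LINT x|lborel. u x * g x)"
    and v: "v \<in> C0 \<Omega>" and g[measurable]: "g \<in> borel_measurable borel" and g0: "\<And>x. x \<notin> \<Omega> \<Longrightarrow> g x = 0"
    and gp: "integrable lborel (\<lambda>x. \<bar>g x\<bar> powr p)" and gi: "integrable lborel g"
    and sol: "weak_sol s \<Omega> v (\<lambda>x. (1 / half_const) * g x)"
  shows "(LINT x|lborel. u x * g x) = pairing \<Omega> \<mu> v"
proof -
  have [measurable]: "u \<in> borel_measurable borel" using u by (simp add: dual_integrable_def)
  define h where "h n x = max (- real n) (min (real n) (g x))" for n x
  have [measurable]: "h n \<in> borel_measurable borel" for n unfolding h_def by measurable
  have h: "bdd_data (h n)" for n unfolding bdd_data_def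
    by (intro conjI exI[of _ "real n"]) (auto simp: h_def g0)
  have hg: "\<bar>g x - h n x\<bar> \<le> \<bar>g x\<bar>" "\<bar>h n x\<bar> \<le> \<bar>g x\<bar>" for n x by (auto simp: h_def)
  have lim: "(\<lambda>n. h n x) \<longlonglongrightarrow> g x" for x
  proof -
    obtain N :: nat where N: "\<bar>g x\<bar> \<le> real N" using real_arch_simple by blast
    have "\<forall>n\<ge>N. h n x = g x"
    proof (intro allI impI)
      fix n assume "N \<le> n"
      then have "real N \<le> real n" by simp
      then show "h n x = g x" using N unfolding h_def by linarith
    qed
    then show ?thesis by (intro tendsto_eventually) (auto simp: eventually_sequentially)
  qed
  have ghp: "integrable lborel (\<lambda>x. \<bar>g x - h n x\<bar> powr p)" for n
    by (rule Bochner_Integration.integrable_bound[OF gp]) (use hg p in \<open>auto intro!: powr_mono2\<close>)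
  have "(\<lambda>n. lp_norm p (\<lambda>x. g x - h n x)) \<longlonglongrightarrow> 0"
  proof (rule lp_norm_tendsto_zero[OF p(1) _ gp hg(1)])
    have "(\<lambda>n. g x - h n x) \<longlonglongrightarrow> 0" for x
      using tendsto_diff[OF tendsto_const lim, of "g x" x] by simp
    then show "AE x in lborel. (\<lambda>n. g x - h n x) \<longlonglongrightarrow> 0" by simp
  qed measurable
  then have "(\<lambda>n. radon_norm \<Omega> \<mu> * (sup_const / half_const * lp_norm p (\<lambda>x. g x - h n x)))
      \<longlonglongrightarrow> radon_norm \<Omega> \<mu> * (sup_const / half_const * 0)" by (intro tendsto_intros)
  then have "(\<lambda>n. pairing \<Omega> \<mu> v - pairing \<Omega> \<mu> (solution (h n))) \<longlonglongrightarrow> 0"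
  proof (intro Lim_null_comparison[of "\<lambda>n. pairing \<Omega> \<mu> v - pairing \<Omega> \<mu> (solution (h n))"] always_eventually allI)
    fix n
    have "\<bar>pairing \<Omega> \<mu> (\<lambda>x. v x - solution (h n) x)\<bar>
        \<le> radon_norm \<Omega> \<mu> * (sup_const / half_const * lp_norm p (\<lambda>x. g x - h n x))"
      by (intro pairing_le_radon_norm(1)[OF \<mu> domain_measurable bounded_domain] C0_diff v solution_C0 h
        solution_approx[OF v sol gi h ghp])
    then show "norm (pairing \<Omega> \<mu> v - pairing \<Omega> \<mu> (solution (h n)))
        \<le> radon_norm \<Omega> \<mu> * (sup_const / half_const * lp_norm p (\<lambda>x. g x - h n x))"
      by (simp add: pairing_diff[OF \<mu> domain_measurable bounded_domain v solution_C0[OF h]])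
  qed simp
  from tendsto_diff[OF tendsto_const[of "pairing \<Omega> \<mu> v"] this]
  have 1: "(\<lambda>n. LINT x|lborel. u x * h n x) \<longlonglongrightarrow> pairing \<Omega> \<mu> v" by (simp add: rep[OF h])
  have ug: "integrable lborel (\<lambda>x. u x * g x)" by (rule dual_integrable_mult[OF u gi gp])
  have "(\<lambda>n. LINT x|lborel. u x * h n x) \<longlonglongrightarrow> (LINT x|lborel. u x * g x)"
  proof (rule integral_dominated_convergence[OF _ _ integrable_norm[OF ug]])
    show "AE x in lborel. (\<lambda>n. u x * h n x) \<longlonglongrightarrow> u x * g x" by (intro AE_I2 tendsto_mult tendsto_const lim)
    show "AE x in lborel. norm (u x * h n x) \<le> norm (u x * g x)" for n
      using hg(2) by (auto simp: abs_mult intro!: mult_left_mono)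
  qed measurable
  then show ?thesis using 1 by (rule LIMSEQ_unique)
qed

lemma integral_lebesgue_on_representative:
  assumes u[measurable]: "u \<in> borel_measurable borel" and u0: "\<And>x. x \<notin> \<Omega> \<Longrightarrow> u x = 0"
    and w: "w \<in> borel_measurable (lebesgue_on \<Omega>)" and eq: "AE x in lebesgue_on \<Omega>. w x = u x"
    and g: "bdd_data g"
  shows "(LINT x|lebesgue_on \<Omega>. w x * g x) = (LINT x|lborel. u x * g x)"
proof -
  have [measurable]: "g \<in> borel_measurable borel" by (rule bdd_data_measurable[OF g])
  have L: "u \<in> borel_measurable (lebesgue_on \<Omega>)" "g \<in> borel_measurable (lebesgue_on \<Omega>)"
    by (intro measurable_restrict_space1 measurable_completion, simp)+
  have "(LINT x|lebesgue_on \<Omega>. w x * g x) = (LINT x|lebesgue_on \<Omega>. u x * g x)"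
    by (rule Bochner_Integration.integral_cong_AE)
      (use L w eq in \<open>auto intro: borel_measurable_times elim!: eventually_mono\<close>)
  also have "\<dots> = (LINT x|lborel. indicator \<Omega> x * (u x * g x))" by (rule integral_lebesgue_on_borel(1)) auto
  also have "(\<lambda>x. indicator \<Omega> x * (u x * g x)) = (\<lambda>x. u x * g x)" using u0 by (auto simp: indicator_def fun_eq_iff)
  finally show ?thesis .
qed

text \<open>The sign of \<open>u x - v x\<close> is itself an admissible datum, and testing with it
  gives the integral of the absolute difference.\<close>

lemma AE_eq_of_bdd_data:
  assumes u: "integrable lborel u" and v: "integrable lborel v"
    and u0: "\<And>x. x \<notin> \<Omega> \<Longrightarrow> u x = 0" and v0: "\<And>x. x \<notin> \<Omega> \<Longrightarrow> v x = 0"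
    and eq: "\<And>g. bdd_data g \<Longrightarrow> (LINT x|lborel. u x * g x) = (LINT x|lborel. v x * g x)"
  shows "AE x in lborel. u x = v x"
proof -
  have [measurable]: "u \<in> borel_measurable borel" "v \<in> borel_measurable borel" using u v by auto
  define g where "g x = sgn (u x - v x)" for x
  have gb: "\<bar>g x\<bar> \<le> 1" for x by (simp add: g_def sgn_if)
  have [measurable]: "g \<in> borel_measurable borel" unfolding g_def by measurable
  have g: "bdd_data g" unfolding bdd_data_def using gb u0 v0 by (auto simp: g_def)
  have "integrable lborel (\<lambda>x. g x * u x)" "integrable lborel (\<lambda>x. g x * v x)"
    using u v gb by (auto intro!: integrable_mult_bounded[where B=1])
  then have i: "integrable lborel (\<lambda>x. u x * g x)" "integrable lborel (\<lambda>x. v x * g x)"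
    by (simp_all add: mult.commute)
  have "(LINT x|lborel. u x * g x - v x * g x) = 0"
    using eq[OF g] by (simp add: Bochner_Integration.integral_diff[OF i])
  moreover have "u x * g x - v x * g x = \<bar>u x - v x\<bar>" for x
    by (simp add: g_def abs_sgn left_diff_distrib)
  ultimately have "(LINT x|lborel. \<bar>u x - v x\<bar>) = 0" by simp
  moreover have "integrable lborel (\<lambda>x. \<bar>u x - v x\<bar>)" using u v by auto
  ultimately have "AE x in lborel. \<bar>u x - v x\<bar> = 0" by (simp add: integral_nonneg_eq_0_iff_AE)
  then show ?thesis by eventually_elim simp
qed

lemma very_weak_solvability:
  assumes p': "inverse (ennreal p) + inverse p' = 1"
  shows "\<exists>C>0. \<forall>\<mu>. radon_measure \<Omega> \<mu> \<longrightarrow>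
    (\<exists>u. very_weak_solution s (ennreal p) p' \<Omega> \<mu> u \<and>
         (\<forall>w. very_weak_solution s (ennreal p) p' \<Omega> \<mu> w \<longrightarrow>
            (AE x in lebesgue_on \<Omega>. w x = u x)) \<and>
         Lp_norm p' (lebesgue_on \<Omega>) u \<le> C * radon_norm \<Omega> \<mu>)"
proof -
  \<comment> \<open>The sup bound of the Green operator over the normalisation of the form. It may
    be 0, so the positive constant claimed is \<open>C + 1\<close>.\<close>
  define C where "C = sup_const / half_const"
  have C: "0 \<le> C" using sup_const_nonneg half_const_pos by (simp add: C_def)
  have main: "\<exists>u. very_weak_solution s (ennreal p) p' \<Omega> \<mu> u \<and>
         (\<forall>w. very_weak_solution s (ennreal p) p' \<Omega> \<mu> w \<longrightarrow> (AE x in lebesgue_on \<Omega>. w x = u x)) \<and>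
         Lp_norm p' (lebesgue_on \<Omega>) u \<le> (C + 1) * radon_norm \<Omega> \<mu>" if \<mu>: "radon_measure \<Omega> \<mu>" for \<mu>
  proof -
    obtain u where ui: "integrable lborel u" and u0: "\<And>x. x \<notin> \<Omega> \<Longrightarrow> u x = 0"
      and rep: "\<And>g. bdd_data g \<Longrightarrow> pairing \<Omega> \<mu> (solution g) = (LINT x|lborel. u x * g x)"
      by (rule pairing_representation[OF \<mu>]) (rule that)
    have um[measurable]: "u \<in> borel_measurable borel" using ui by auto
    define K where "K = radon_norm \<Omega> \<mu> * C"
    have R: "0 \<le> radon_norm \<Omega> \<mu>"
      by (rule radon_norm_nonneg[OF \<mu> domain_measurable bounded_domain, of "\<lambda>x. 0" 0]) (auto simp: C0_def)
    have K0: "0 \<le> K" using R C by (simp add: K_def)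
    have K: "(LINT x|lborel. u x * g x) \<le> K * lp_norm p g" if g: "bdd_data g" for g
    proof -
      have "\<bar>pairing \<Omega> \<mu> (solution g)\<bar> \<le> radon_norm \<Omega> \<mu> * (C * lp_norm p g)"
        unfolding C_def by (intro pairing_le_radon_norm(1)[OF \<mu> domain_measurable bounded_domain] solution_C0 solution_bound g)
      then show ?thesis using rep[OF g] by (simp add: K_def mult.assoc)
    qed
    note D = Lp_norm_le[OF ui u0 K K0 p']
    have uL: "u \<in> Lp p' (lebesgue_on \<Omega>)" using dual_integrable_Lp[OF um u0 p'] D(1) by blast
    show ?thesis
    proof (intro exI[of _ u] conjI allI impI)
      show "very_weak_solution s (ennreal p) p' \<Omega> \<mu> u"
        unfolding very_weak_solution_def
      proof (intro conjI ballI allI impI uL)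
        fix v g assume "v \<in> V_space s (ennreal p) \<Omega>" and weak: "weak_frac_laplacian s (ennreal p) \<Omega> v g"
        then have v: "v \<in> C0 \<Omega>" by (simp add: V_space_def)
        have gL: "g \<in> borel_measurable (lebesgue_on \<Omega>)" using weak by (auto simp: weak_frac_laplacian_def Lp_def)
        obtain g' where g': "g' \<in> borel_measurable borel" "\<And>x. x \<notin> \<Omega> \<Longrightarrow> g' x = 0" "AE x in lebesgue_on \<Omega>. g x = g' x"
          "integrable lborel (\<lambda>x. \<bar>g' x\<bar> powr p)" "integrable lborel g'" "weak_sol s \<Omega> v (\<lambda>x. (1 / half_const) * g' x)"
          by (rule weak_frac_laplacian_representative[OF v weak]) (rule that)
        have L: "u \<in> borel_measurable (lebesgue_on \<Omega>)" "g' \<in> borel_measurable (lebesgue_on \<Omega>)"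
          using g'(1) by (intro measurable_restrict_space1 measurable_completion, simp)+
        have "(LINT x|lebesgue_on \<Omega>. u x * g x) = (LINT x|lebesgue_on \<Omega>. u x * g' x)"
          by (rule Bochner_Integration.integral_cong_AE)
            (use L gL g'(3) in \<open>auto intro: borel_measurable_times elim!: eventually_mono\<close>)
        also have "\<dots> = (LINT x|lborel. indicator \<Omega> x * (u x * g' x))"
          using g'(1) by (intro integral_lebesgue_on_borel(1)) auto
        also have "(\<lambda>x. indicator \<Omega> x * (u x * g' x)) = (\<lambda>x. u x * g' x)"
          using u0 by (auto simp: indicator_def fun_eq_iff)
        also have "(LINT x|lborel. u x * g' x) = pairing \<Omega> \<mu> v"
          by (rule pairing_limit[OF \<mu> D(1) rep v g'(1,2,4,5,6)])
        finally show "(LINT x|lebesgue_on \<Omega>. u x * g x) = pairing \<Omega> \<mu> v" .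
      qed
    next
      fix w assume w: "very_weak_solution s (ennreal p) p' \<Omega> \<mu> w"
      then have wL: "w \<in> borel_measurable (lebesgue_on \<Omega>)" by (auto simp: very_weak_solution_def Lp_def)
      obtain w' where w'[measurable]: "w' \<in> borel_measurable borel" and w'0: "\<And>x. x \<notin> \<Omega> \<Longrightarrow> w' x = 0"
        and eq: "AE x in lebesgue_on \<Omega>. w x = w' x"
        by (rule lebesgue_on_borel_representative[OF wL domain_measurable]) (rule that)
      have w'L: "w' \<in> borel_measurable (lebesgue_on \<Omega>)"
        by (intro measurable_restrict_space1 measurable_completion) simp
      \<comment> \<open>A competing solution passes to its Borel representative without leaving the
        space. It is then integrable, and agrees with \<open>u\<close> once both have been tested
        with \<open>solution g\<close> for all bounded data \<open>g\<close>.\<close>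
      have "w' \<in> Lp p' (lebesgue_on \<Omega>)"
      proof (cases "p' = \<infinity>")
        case True
        then obtain c where "AE x in lebesgue_on \<Omega>. \<bar>w x\<bar> \<le> c" using w by (auto simp: very_weak_solution_def Lp_def)
        with eq have "AE x in lebesgue_on \<Omega>. \<bar>w' x\<bar> \<le> c" by eventually_elim simp
        then show ?thesis using True w'L by (auto simp: Lp_def)
      next
        case False
        then have "integrable (lebesgue_on \<Omega>) (\<lambda>x. \<bar>w x\<bar> powr enn2real p')"
          using w by (auto simp: very_weak_solution_def Lp_def)
        then have "integrable (lebesgue_on \<Omega>) (\<lambda>x. \<bar>w' x\<bar> powr enn2real p')"
          by (rule integrable_cong_AE_imp) (use eq w'L in \<open>auto elim!: eventually_mono\<close>)
        then show ?thesis using False w'L by (simp add: Lp_def)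
      qed
      then have "dual_integrable w'" using dual_integrable_Lp[OF w' w'0 p'] by blast
      then have w'i: "integrable lborel w'" using w'0 by (rule dual_integrable_integrable)
      have "AE x in lborel. w' x = u x"
      proof (rule AE_eq_of_bdd_data[OF w'i ui w'0 u0])
        fix g assume g: "bdd_data g"
        have "(LINT x|lebesgue_on \<Omega>. w x * g x) = pairing \<Omega> \<mu> (solution g)"
          using w solution_V_space[OF g] solution_weak[OF g] unfolding very_weak_solution_def by blast
        then show "(LINT x|lborel. w' x * g x) = (LINT x|lborel. u x * g x)"
          using integral_lebesgue_on_representative[OF w' w'0 wL eq g] rep[OF g] by simp
      qed
      then have "AE x in lebesgue. w' x = u x" by (rule AE_completion)
      then have "AE x in lebesgue. x \<in> \<Omega> \<longrightarrow> w' x = u x" by eventually_elim simp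
      then have "AE x in lebesgue_on \<Omega>. w' x = u x" by (subst AE_restrict_space_iff) auto
      with eq show "AE x in lebesgue_on \<Omega>. w x = u x" by eventually_elim simp
    next
      have "Lp_norm p' (lebesgue_on \<Omega>) u \<le> K" by (rule D(2))
      also have "\<dots> \<le> (C + 1) * radon_norm \<Omega> \<mu>" using R by (simp add: K_def algebra_simps)
      finally show "Lp_norm p' (lebesgue_on \<Omega>) u \<le> (C + 1) * radon_norm \<Omega> \<mu>" .
    qed
  qed
  show ?thesis
  proof (intro exI[of _ "C + 1"] conjI allI impI main)
    show "0 < C + 1" using C by simp
  qed
qed

end

theorem theorem3p6:
  fixes \<Omega> :: "'a::euclidean_space set" and s p :: real and p' :: ennreal
  assumes "0 < s" and "s < 1"
    and "bounded_lipschitz_domain \<Omega>" and "exterior_cone_condition \<Omega>"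
    and "real DIM('a) > 2 * s \<Longrightarrow> p > real DIM('a) / (2 * s)"
    and "real DIM('a) = 2 * s \<Longrightarrow> p > 1"
    and "real DIM('a) < 2 * s \<Longrightarrow> p = 1"
    and "inverse (ennreal p) + inverse p' = 1"
  shows "\<exists>C>0. \<forall>\<mu>. radon_measure \<Omega> \<mu> \<longrightarrow>
    (\<exists>u. very_weak_solution s (ennreal p) p' \<Omega> \<mu> u \<and>
         (\<forall>w. very_weak_solution s (ennreal p) p' \<Omega> \<mu> w \<longrightarrow>
            (AE x in lebesgue_on \<Omega>. w x = u x)) \<and>
         Lp_norm p' (lebesgue_on \<Omega>) u \<le> C * radon_norm \<Omega> \<mu>)"
proof -
  have N: "0 < real DIM('a)" by simp
  \<comment> \<open>For \<open>N > 2 s\<close> the second inequality is the hypothesis on p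
    rearranged, for \<open>N = 2 s\<close> it reads p > 1, and for \<open>N < 2 s\<close> with p = 1
    it is the case assumption.\<close>
  have "1 \<le> p \<and> 1 / p < 2 * s / real DIM('a)"
  proof -
    consider "real DIM('a) > 2 * s" | "real DIM('a) = 2 * s" | "real DIM('a) < 2 * s" by linarith
    then show ?thesis
    proof cases
      case 1
      have "p > real DIM('a) / (2 * s)" by (rule assms(5)[OF 1])
      moreover have "real DIM('a) / (2 * s) > 1" using 1 assms(1) by simp
      ultimately have "1 < p" "real DIM('a) < p * (2 * s)" using assms(1) by (linarith, simp add: field_simps)
      then show ?thesis using N by (simp add: field_simps)
    next
      case 2
      have "p > 1" by (rule assms(6)[OF 2])
      then show ?thesis using 2 N by simp
    next
      case 3
      have "p = 1" by (rule assms(7)[OF 3])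
      then show ?thesis using 3 N by simp
    qed
  qed
  then interpret exterior_domain s p \<Omega>
    using assms(1-4) exterior_cone_ball[of \<Omega>]
    by unfold_locales (auto simp: bounded_lipschitz_domain_def)
  show ?thesis by (rule very_weak_solvability[OF assms(8)])
qed

end
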